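(* ${\rm inv}_3(n)\le \frac{257}{2592}(1+o(1))n^2$, where $o(1)\to 0$ as $n\to\infty$.
   Context: For an oriented graph $D$ and $X\subseteq V(D)$, inverting $X$ means reversing the direction of every edge of $D$ with both endpoints in $X$. A set $\{X_1,\dots,X_t\}$ of vertex subsets is $k$-decycling for $D$ if every $X_i$ has size at most $k$ and inverting $X_1,\dots,X_t$ yields an acyclic digraph. ${\rm inv}_k(D)$ is the minimum size of a $k$-decycling set of $D$, and ${\rm inv}_k(n)$ is the maximum of ${\rm inv}_k(D)$ over all oriented graphs (equivalently, all tournaments) $D$ on $n$ vertices. *)

theory Defs
  imports Complex_Main "Graph_Theory.Pair_Digraph"
begin

text \<open>\<open>pair_digraph\<close> gives a finite, loop-free digraph without parallel arcs; antisymmetry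
  excludes pairs of opposite arcs.\<close>

definition oriented_graph :: "'a pair_pre_digraph \<Rightarrow> bool" where
  "oriented_graph D \<longleftrightarrow> pair_digraph D \<and> antisym (parcs D)"

definition invert :: "'a set \<Rightarrow> 'a pair_pre_digraph \<Rightarrow> 'a pair_pre_digraph" where
  "invert X D = D\<lparr>parcs := {(u, v). if u \<in> X \<and> v \<in> X then (v, u) \<in> parcs D else (u, v) \<in> parcs D}\<rparr>"

lemma invert_commute: "invert X (invert Y D) = invert Y (invert X D)"
  by (rule pair_pre_digraph.equality) (auto simp: invert_def split: if_splits)

text \<open>Inverting all members of a (finite) set of vertex sets one after the other; by
  \<open>invert_commute\<close> the order is irrelevant, so \<open>Finite_Set.fold\<close> is meaningful.\<close>

definition invert_all :: "'a set set \<Rightarrow> 'a pair_pre_digraph \<Rightarrow> 'a pair_pre_digraph" where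
  "invert_all F D = Finite_Set.fold invert D F"

definition decycling :: "nat \<Rightarrow> 'a pair_pre_digraph \<Rightarrow> 'a set set \<Rightarrow> bool" where
  "decycling k D F \<longleftrightarrow> finite F \<and> (\<forall>X\<in>F. X \<subseteq> pverts D \<and> card X \<le> k) \<and> acyclic (parcs (invert_all F D))"

text \<open>Meaningful for \<open>k \<ge> 2\<close> only: then every oriented graph has a \<open>k\<close>-decycling set
  (lemma \<open>ex_decycling\<close>), whereas for \<open>k \<le> 1\<close> no inversion changes any arc.\<close>

definition inv_graph :: "nat \<Rightarrow> 'a pair_pre_digraph \<Rightarrow> nat" where
  "inv_graph k D = (LEAST t. \<exists>F. decycling k D F \<and> card F = t)"

text \<open>Oriented graphs with vertices in \<open>nat\<close> represent all finite ones up to isomorphism. The set of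
  values is finite and nonempty for \<open>k \<ge> 2\<close> (lemmas \<open>finite_inv_values\<close>, \<open>inv_values_nonempty\<close>).\<close>

definition inv_values :: "nat \<Rightarrow> nat \<Rightarrow> nat set" where
  "inv_values k n = {inv_graph k D | D :: nat pair_pre_digraph. oriented_graph D \<and> card (pverts D) = n}"

definition inv_max :: "nat \<Rightarrow> nat \<Rightarrow> nat" where
  "inv_max k n = Max (inv_values k n)"

lemma invert_all_empty [simp]: "invert_all {} D = D"
  by (simp add: invert_all_def)

lemma invert_all_insert:
  assumes "finite F" "X \<notin> F"
  shows "invert_all (insert X F) D = invert X (invert_all F D)"
proof -
  interpret comp_fun_commute "invert :: 'a set \<Rightarrow> 'a pair_pre_digraph \<Rightarrow> _"
    by unfold_locales (auto simp: invert_commute)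
  show ?thesis using assms by (simp add: invert_all_def)
qed

lemma parcs_invert_all_iff:
  assumes "finite F"
  shows "(u, v) \<in> parcs (invert_all F D) \<longleftrightarrow>
    (if even (card {X \<in> F. u \<in> X \<and> v \<in> X}) then (u, v) \<in> parcs D else (v, u) \<in> parcs D)"
  using assms
proof (induction F arbitrary: u v rule: finite_induct)
  case empty
  then show ?case by simp
next
  case (insert Y F)
  show ?case
  proof (cases "u \<in> Y \<and> v \<in> Y")
    case True
    have "{X \<in> insert Y F. u \<in> X \<and> v \<in> X} = insert Y {X \<in> F. u \<in> X \<and> v \<in> X}"
      using True by auto
    then have "card {X \<in> insert Y F. u \<in> X \<and> v \<in> X} = Suc (card {X \<in> F. u \<in> X \<and> v \<in> X})"
      using insert.hyps by simp
    moreover have "{X \<in> F. v \<in> X \<and> u \<in> X} = {X \<in> F. u \<in> X \<and> v \<in> X}" by auto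
    ultimately show ?thesis
      using insert True by (simp add: invert_all_insert invert_def)
  next
    case False
    then have "{X \<in> insert Y F. u \<in> X \<and> v \<in> X} = {X \<in> F. u \<in> X \<and> v \<in> X}" by auto
    then show ?thesis
      using insert False by (auto simp: invert_all_insert invert_def)
  qed
qed

lemma ex_decycling:
  fixes D :: "'a pair_pre_digraph"
  assumes D: "oriented_graph D" and k: "k \<ge> 2"
  obtains F where "decycling k D F" "card F \<le> card (pverts D) * card (pverts D)"
proof -
  from D interpret pair_digraph D by (simp add: oriented_graph_def)
  have as: "antisym (parcs D)" using D by (simp add: oriented_graph_def)
  obtain f :: "'a \<Rightarrow> nat" where f: "inj_on f (pverts D)"
    using finite_imp_inj_to_nat_seg[OF pair_finite_verts] by blast
  define B where "B = {(u, v). (u, v) \<in> parcs D \<and> f v < f u}"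
  define F where "F = (\<lambda>(u, v). {u, v}) ` B"
  have sub: "B \<subseteq> pverts D \<times> pverts D"
    by (auto simp: B_def dest: in_arcsD1 in_arcsD2)
  have finB: "finite B"
    using finite_subset[OF sub] pair_finite_verts by blast
  have cardF: "card F \<le> card (pverts D) * card (pverts D)"
  proof -
    have "card F \<le> card B" unfolding F_def by (rule card_image_le[OF finB])
    also have "\<dots> \<le> card (pverts D \<times> pverts D)"
      by (rule card_mono[OF _ sub]) (simp add: pair_finite_verts)
    finally show ?thesis by (simp add: card_cartesian_product)
  qed
  have "finite F" using finB by (simp add: F_def)
  have incr: "f u < f v" if uv: "(u, v) \<in> parcs (invert_all F D)" for u v
  proof -
    have arc: "(u, v) \<in> parcs D \<or> (v, u) \<in> parcs D"
      using uv by (auto simp: parcs_invert_all_iff[OF \<open>finite F\<close>] split: if_splits)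
    then have ne: "u \<noteq> v" by (auto dest: pair_no_loops)
    have fne: "f u \<noteq> f v"
      using arc ne f by (auto simp: inj_on_def dest: in_arcsD1 in_arcsD2)
    have mem: "{X \<in> F. u \<in> X \<and> v \<in> X} = (if {u, v} \<in> F then {{u, v}} else {})"
      using ne by (auto simp: F_def)
    have F_iff: "{u, v} \<in> F \<longleftrightarrow> (u, v) \<in> B \<or> (v, u) \<in> B"
      by (auto simp: F_def doubleton_eq_iff image_iff)
    show ?thesis
    proof (cases "{u, v} \<in> F")
      case True
      then have vu: "(v, u) \<in> parcs D"
        using uv by (simp add: parcs_invert_all_iff[OF \<open>finite F\<close>] mem)
      then have "(u, v) \<notin> parcs D" using as ne by (auto dest: antisymD)
      then show ?thesis using True F_iff by (auto simp: B_def)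
    next
      case False
      then have "(u, v) \<in> parcs D"
        using uv by (simp add: parcs_invert_all_iff[OF \<open>finite F\<close>] mem)
      then show ?thesis using False F_iff fne by (auto simp: B_def)
    qed
  qed
  have "parcs (invert_all F D) \<subseteq> measure f" using incr by auto
  then have "acyclic (parcs (invert_all F D))"
    by (meson wf_acyclic wf_measure wf_subset)
  moreover have "X \<subseteq> pverts D \<and> card X \<le> k" if "X \<in> F" for X
  proof -
    obtain u v where X: "X = {u, v}" "(u, v) \<in> B" using \<open>X \<in> F\<close> by (auto simp: F_def)
    have "card X \<le> 2" by (simp add: X card_insert_if)
    then show ?thesis using X sub k by auto
  qed
  ultimately have "decycling k D F"
    using \<open>finite F\<close> by (simp add: decycling_def)
  with cardF show thesis by (rule that[rotated])
qed

lemma inv_graph_attained: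
  assumes "oriented_graph D" "k \<ge> 2"
  obtains F where "decycling k D F" "card F = inv_graph k D"
proof -
  obtain F where "decycling k D F" using ex_decycling[OF assms] by blast
  then have "\<exists>t F. decycling k D F \<and> card F = t" by blast
  then have "\<exists>F. decycling k D F \<and> card F = inv_graph k D"
    unfolding inv_graph_def by (rule LeastI_ex)
  with that show thesis by blast
qed

lemma inv_graph_le: "decycling k D F \<Longrightarrow> inv_graph k D \<le> card F"
  unfolding inv_graph_def by (rule Least_le) blast

lemma finite_inv_values:
  assumes "k \<ge> 2"
  shows "finite (inv_values k n)"
proof (rule finite_subset)
  show "inv_values k n \<subseteq> {..n * n}"
  proof
    fix t assume "t \<in> inv_values k n"
    then obtain D :: "nat pair_pre_digraph"
      where D: "oriented_graph D" "card (pverts D) = n" "t = inv_graph k D"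
      by (auto simp: inv_values_def)
    obtain F where "decycling k D F" "card F \<le> n * n"
      using ex_decycling[OF D(1) assms] D(2) by blast
    then show "t \<in> {..n * n}" using inv_graph_le D(3) by fastforce
  qed
qed simp

lemma inv_values_nonempty: "inv_values k n \<noteq> {}"
proof -
  let ?D = "\<lparr>pverts = {..<n}, parcs = {}\<rparr> :: nat pair_pre_digraph"
  have "oriented_graph ?D"
    unfolding oriented_graph_def by (intro conjI; unfold_locales) auto
  then have "inv_graph k ?D \<in> inv_values k n"
    by (auto simp: inv_values_def intro!: exI[of _ ?D])
  then show ?thesis by blast
qed

end

theory Submission
  imports Defs "HOL-Library.FuncSet"
begin

text \<open>Any eventual bound \<open>inv_max 3 n \<le> c n\<^sup>2\<close> with \<open>c \<ge> 257/2592\<close> can be improved by a fixed amount.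
  Take a worst tournament on \<open>n\<close> vertices whose value is close to \<open>c n\<^sup>2\<close>. Reversing the backward
  arcs of an ordered partition and treating the parts recursively costs one triple per two
  backward arcs, and one triple per three arcs for those covered by edge-disjoint transitive
  triangles. Two-part partitions already force the scores to be nearly balanced. Now put the
  vertices into 24 ordered blocks at random. Give each triangle of backward arcs a weight depending
  on the blocks of its vertices. The load of an arc is governed by the common neighbourhoods of
  its ends; a count of 4-cycles bounds the variance of their sizes, so after trimming the
  overloaded arcs a large fractional triangle packing remains. Two triangles share at most one
  arc, hence a nibble turns it into an integral packing of almost the same size, which saves
  enough to beat \<open>c\<close>.\<close>

section \<open>Averages over finite product measures\<close>

text \<open>If every backward arc saves on average a fraction \<open>s\<close> of its half triple,
  the recursion over 24 equal blocks has the fixed point \<open>(1 - s) / 8\<close>, so 257/2592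
  stands for \<open>s = 67/324\<close>. The same number \<open>1 - 8 c\<close> limits the imbalance
  of an extremal tournament: at every cut the scores of \<open>U\<close> sum to at most about
  \<open>(1 - 8 c) |U| (n - |U|)\<close>. Balance is thus a consequence of extremality with respect
  to \<open>c\<close>, which is why a given bound is improved instead of a solution being built
  outright. Both conditions only get easier as \<open>c\<close> grows, so one certificate serves
  every \<open>c\<close>. The obstacle: adjacent blocks have no room for a middle vertex, so even
  with balanced scores the mean load there is about proportional to \<open>1 + D\<close>, where
  \<open>D\<close> is the correlation of two neighbourhoods. Its mean square can be 1/3, as in the
  circular tournament. The weights are a compromise, judged by a quadratic majorant of the overload,
  because only second moments are under control. Mixed moments of \<open>D\<close> with the scores
  vanish by skew-symmetry; a third moment of the scores is cancelled by the symmetry of the weights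
  under reversing the block order.\<close>

definition wexp :: "'i set \<Rightarrow> 'a set \<Rightarrow> ('i \<Rightarrow> 'a \<Rightarrow> real) \<Rightarrow> (('i \<Rightarrow> 'a) \<Rightarrow> real) \<Rightarrow> real" where
  "wexp I S \<mu> F = (\<Sum>p\<in>I \<rightarrow>\<^sub>E S. (\<Prod>i\<in>I. \<mu> i (p i)) * F p)"

locale finite_product =
  fixes I :: "'i set" and S :: "'a set" and \<mu> :: "'i \<Rightarrow> 'a \<Rightarrow> real"
  assumes finite_index: "finite I" and finite_values: "finite S"
    and \<mu>_nonneg: "\<And>i a. i \<in> I \<Longrightarrow> a \<in> S \<Longrightarrow> 0 \<le> \<mu> i a"
    and \<mu>_sum: "\<And>i. i \<in> I \<Longrightarrow> (\<Sum>a\<in>S. \<mu> i a) = 1"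
begin

abbreviation "Avg \<equiv> wexp I S \<mu>"

lemma Avg_prod:
  assumes "J \<subseteq> I"
  shows "Avg (\<lambda>p. \<Prod>i\<in>J. f i (p i)) = (\<Prod>i\<in>J. \<Sum>a\<in>S. \<mu> i a * f i a)"
proof -
  let ?g = "\<lambda>i a. \<mu> i a * (if i \<in> J then f i a else 1)"
  have J: "(\<Prod>i\<in>J. h i) = (\<Prod>i\<in>I. if i \<in> J then h i else 1)" for h :: "'i \<Rightarrow> real"
    using assms finite_index by (simp add: prod.If_cases Int_absorb1)
  have "Avg (\<lambda>p. \<Prod>i\<in>J. f i (p i)) = (\<Sum>p\<in>I \<rightarrow>\<^sub>E S. \<Prod>i\<in>I. ?g i (p i))"
    unfolding wexp_def by (simp add: J prod.distrib)
  also have "\<dots> = (\<Prod>i\<in>I. \<Sum>a\<in>S. ?g i a)"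
    by (rule prod_sum_PiE[symmetric]) (auto simp: finite_index finite_values)
  also have "\<dots> = (\<Prod>i\<in>I. if i \<in> J then \<Sum>a\<in>S. \<mu> i a * f i a else 1)"
    by (rule prod.cong) (auto simp: \<mu>_sum)
  finally show ?thesis by (simp add: J)
qed

lemma Avg_const [simp]: "Avg (\<lambda>p. c) = c"
  using Avg_prod[of "{}" "\<lambda>_ _. 1"] by (simp add: wexp_def flip: sum_distrib_right)

lemma Avg_add: "Avg (\<lambda>p. F p + G p) = Avg F + Avg G"
  by (simp add: wexp_def algebra_simps sum.distrib)

lemma Avg_diff: "Avg (\<lambda>p. F p - G p) = Avg F - Avg G"
  by (simp add: wexp_def algebra_simps sum_subtractf)

lemma Avg_cmult: "Avg (\<lambda>p. c * F p) = c * Avg F"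
  by (simp add: wexp_def sum_distrib_left algebra_simps)

lemma Avg_sum: "Avg (\<lambda>p. \<Sum>k\<in>K. F k p) = (\<Sum>k\<in>K. Avg (F k))"
  unfolding wexp_def by (subst sum.swap) (simp add: sum_distrib_left)

lemma Avg_mono: "(\<And>p. p \<in> I \<rightarrow>\<^sub>E S \<Longrightarrow> F p \<le> G p) \<Longrightarrow> Avg F \<le> Avg G"
  unfolding wexp_def
  by (intro sum_mono mult_left_mono prod_nonneg) (auto intro!: \<mu>_nonneg)

lemma Avg_attained: "\<exists>p \<in> I \<rightarrow>\<^sub>E S. Avg F \<le> F p"
proof (rule ccontr)
  assume "\<not> ?thesis"
  then have *: "F p < Avg F" if "p \<in> I \<rightarrow>\<^sub>E S" for p using that by force
  have w: "(\<Sum>p\<in>I \<rightarrow>\<^sub>E S. \<Prod>i\<in>I. \<mu> i (p i)) = 1"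
    using Avg_const[of 1] by (simp add: wexp_def)
  define e where "e = Avg F"
  have "Avg (\<lambda>p. e - F p) = 0" by (simp add: Avg_diff e_def)
  then have "(\<Sum>p\<in>I \<rightarrow>\<^sub>E S. (\<Prod>i\<in>I. \<mu> i (p i)) * (Avg F - F p)) = 0"
    by (simp add: wexp_def[of _ _ _ "\<lambda>p. e - F p"] flip: e_def)
  moreover have "0 \<le> (\<Prod>i\<in>I. \<mu> i (p i)) * (Avg F - F p)" if "p \<in> I \<rightarrow>\<^sub>E S" for p
    using *[OF that] that by (intro mult_nonneg_nonneg prod_nonneg) (auto intro!: \<mu>_nonneg)
  ultimately have "(\<Prod>i\<in>I. \<mu> i (p i)) * (Avg F - F p) = 0" if "p \<in> I \<rightarrow>\<^sub>E S" for p
    using that by (subst (asm) sum_nonneg_eq_0_iff) (auto simp: finite_PiE finite_index finite_values)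
  then have "(\<Prod>i\<in>I. \<mu> i (p i)) = 0" if "p \<in> I \<rightarrow>\<^sub>E S" for p using *[OF that] that by fastforce
  then show False using w by simp
qed

lemma Avg_two:
  assumes "x \<in> I" "y \<in> I" "x \<noteq> y"
  shows "Avg (\<lambda>p. f (p x) * g (p y)) = (\<Sum>a\<in>S. \<mu> x a * f a) * (\<Sum>a\<in>S. \<mu> y a * g a)"
proof -
  have "Avg (\<lambda>p. f (p x) * g (p y)) = Avg (\<lambda>p. \<Prod>i\<in>{x,y}. (if i = x then f else g) (p i))"
    using assms by simp
  also have "\<dots> = (\<Sum>a\<in>S. \<mu> x a * f a) * (\<Sum>a\<in>S. \<mu> y a * g a)"
    using assms by (subst Avg_prod) auto
  finally show ?thesis .
qed

lemma Avg_one: "x \<in> I \<Longrightarrow> Avg (\<lambda>p. f (p x)) = (\<Sum>a\<in>S. \<mu> x a * f a)"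
  using Avg_prod[of "{x}" "\<lambda>_. f"] by simp

end

section \<open>A nibble for linear triple systems\<close>

lemma prod_of_bool:
  "finite A \<Longrightarrow> (\<Prod>x\<in>A. of_bool (P x) :: real) = of_bool (\<forall>x\<in>A. P x)"
  by (induction A rule: finite_induct) auto

text \<open>The union bound for independent events, in the form of a product inequality.\<close>

lemma prod_one_minus_ge:
  fixes x :: "'i \<Rightarrow> real"
  assumes "\<And>i. i \<in> A \<Longrightarrow> 0 \<le> x i" "\<And>i. i \<in> A \<Longrightarrow> x i \<le> 1"
  shows "1 - (\<Sum>i\<in>A. x i) \<le> (\<Prod>i\<in>A. 1 - x i)"
  using assms
proof (induction A rule: infinite_finite_induct)
  case (insert a A)
  have "(1 - x a) * (1 - (\<Sum>i\<in>A. x i)) \<le> (1 - x a) * (\<Prod>i\<in>A. 1 - x i)"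
    using insert by (intro mult_left_mono) auto
  moreover have "0 \<le> x a * (\<Sum>i\<in>A. x i)" using insert by (intro mult_nonneg_nonneg sum_nonneg) auto
  ultimately show ?case using insert by (simp add: algebra_simps)
qed auto

text \<open>A linear 3-uniform hypergraph, with indexed triples so that weights sit on
  \<open>I\<close>. Linearity is what makes the survival of different elements almost independent in
  the nibble.\<close>

locale linear_triples =
  fixes E :: "'e set" and I :: "'i set" and ed :: "'i \<Rightarrow> 'e set"
  assumes finite_E: "finite E" and finite_I: "finite I"
    and ed_sub: "\<And>i. i \<in> I \<Longrightarrow> ed i \<subseteq> E"
    and card_ed: "\<And>i. i \<in> I \<Longrightarrow> card (ed i) = 3"
    and linear: "\<And>i j. i \<in> I \<Longrightarrow> j \<in> I \<Longrightarrow> i \<noteq> j \<Longrightarrow> card (ed i \<inter> ed j) \<le> 1"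
begin

definition load :: "('i \<Rightarrow> real) \<Rightarrow> 'e \<Rightarrow> real" where
  "load w e = (\<Sum>i\<in>{i\<in>I. e \<in> ed i}. w i)"

definition packing :: "'i set \<Rightarrow> bool" where
  "packing J \<longleftrightarrow> J \<subseteq> I \<and> (\<forall>i\<in>J. \<forall>j\<in>J. i \<noteq> j \<longrightarrow> ed i \<inter> ed j = {})"

lemma finite_ed: "i \<in> I \<Longrightarrow> finite (ed i)"
  using ed_sub finite_E finite_subset by blast

lemma load_nonneg: "(\<And>i. i \<in> I \<Longrightarrow> 0 \<le> w i) \<Longrightarrow> 0 \<le> load w e"
  unfolding load_def by (auto intro: sum_nonneg)

lemma sum_ed_swap: "(\<Sum>i\<in>I. w i * (\<Sum>e\<in>ed i. f e)) = (\<Sum>e\<in>E. load w e * f e)"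
proof -
  have "(\<Sum>i\<in>I. w i * (\<Sum>e\<in>ed i. f e)) = (\<Sum>i\<in>I. \<Sum>e\<in>{e\<in>E. e \<in> ed i}. w i * f e)"
    by (rule sum.cong[OF refl]) (use ed_sub in \<open>auto simp: sum_distrib_left intro!: sum.cong\<close>)
  also have "\<dots> = (\<Sum>e\<in>E. \<Sum>i\<in>{i\<in>I. e \<in> ed i}. w i * f e)"
    by (rule sum.swap_restrict) (auto simp: finite_E finite_I)
  finally show ?thesis by (simp add: load_def sum_distrib_right)
qed

lemma sum_load: "(\<Sum>e\<in>E. load w e) = 3 * (\<Sum>i\<in>I. w i)"
  using sum_ed_swap[of w "\<lambda>_. 1"] by (simp add: card_ed mult.commute flip: sum_distrib_left sum_distrib_right)

text \<open>\<open>\<phi> e\<close> is the fraction of the load at \<open>e\<close> in excess of 1,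
  and a triple loses the sum of the fractions of its three elements. Subtracting the fractions,
  instead of scaling by the worst of them, makes the loss additive, and double counting bounds it by
  the total overload.\<close>

lemma trim:
  assumes w: "\<And>i. i \<in> I \<Longrightarrow> 0 \<le> w i"
  obtains w' where "\<And>i. i \<in> I \<Longrightarrow> 0 \<le> w' i" "\<And>i. i \<in> I \<Longrightarrow> w' i \<le> w i"
    "\<And>e. e \<in> E \<Longrightarrow> load w' e \<le> 1"
    "(\<Sum>i\<in>I. w' i) \<ge> (\<Sum>i\<in>I. w i) - (\<Sum>e\<in>E. max 0 (load w e - 1))"
proof -
  define \<phi> where "\<phi> e = 1 - 1 / max 1 (load w e)" for e
  define w' where "w' i = w i * max 0 (1 - (\<Sum>e\<in>ed i. \<phi> e))" for i
  have \<phi>0: "0 \<le> \<phi> e" for e by (simp add: \<phi>_def)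
  show thesis
  proof
    show "0 \<le> w' i" if "i \<in> I" for i using w[OF that] by (simp add: w'_def)
    have "(\<Sum>e\<in>ed i. \<phi> e) \<ge> 0" for i using \<phi>0 by (simp add: sum_nonneg)
    then show "w' i \<le> w i" if "i \<in> I" for i using w[OF that] by (auto simp: w'_def intro!: mult_left_le)
    show "load w' e \<le> 1" if e: "e \<in> E" for e
    proof -
      have "load w' e \<le> (\<Sum>i\<in>{i\<in>I. e \<in> ed i}. w i * (1 - \<phi> e))"
        unfolding load_def w'_def
      proof (intro sum_mono mult_left_mono)
        fix i assume i: "i \<in> {i\<in>I. e \<in> ed i}"
        have "\<phi> e \<le> (\<Sum>e\<in>ed i. \<phi> e)" using i finite_ed \<phi>0 by (intro member_le_sum) auto
        moreover have "\<phi> e \<le> 1" by (simp add: \<phi>_def)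
        ultimately show "max 0 (1 - (\<Sum>e\<in>ed i. \<phi> e)) \<le> 1 - \<phi> e" by simp
      qed (use w in auto)
      also have "\<dots> = load w e / max 1 (load w e)" by (simp add: load_def \<phi>_def sum_divide_distrib)
      also have "\<dots> \<le> 1" by (simp add: divide_le_eq_1 max_def)
      finally show ?thesis .
    qed
    have "(\<Sum>i\<in>I. w i) - (\<Sum>e\<in>E. max 0 (load w e - 1)) = (\<Sum>i\<in>I. w i) - (\<Sum>e\<in>E. load w e * \<phi> e)"
    proof -
      have "load w e * \<phi> e = max 0 (load w e - 1)" for e
        by (auto simp: \<phi>_def max_def field_simps)
      then show ?thesis by simp
    qed
    also have "\<dots> = (\<Sum>i\<in>I. w i * (1 - (\<Sum>e\<in>ed i. \<phi> e)))"
      by (simp add: right_diff_distrib sum_subtractf flip: sum_ed_swap)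
    also have "\<dots> \<le> (\<Sum>i\<in>I. w' i)"
      unfolding w'_def by (intro sum_mono mult_left_mono) (auto simp: w)
    finally show "(\<Sum>i\<in>I. w' i) \<ge> (\<Sum>i\<in>I. w i) - (\<Sum>e\<in>E. max 0 (load w e - 1))" .
  qed
qed

definition cov :: "'e set \<Rightarrow> 'i set" where "cov T = {i\<in>I. ed i \<inter> T \<noteq> {}}"

lemma finite_cov [simp]: "finite (cov T)" and cov_sub: "cov T \<subseteq> I"
  by (auto simp: cov_def finite_I)

lemma cov_insert: "cov (insert e T) = cov {e} \<union> cov T" by (auto simp: cov_def)

lemma load_cov: "load w e = sum w (cov {e})"
  unfolding load_def cov_def by (rule sum.cong) auto

text \<open>By linearity each member of \<open>T\<close> has at most one triple in common with
  \<open>e\<close>. This limits the correlation between the survival of \<open>e\<close> and that of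
  \<open>T\<close>.\<close>

lemma card_cov_Int: "finite T \<Longrightarrow> e \<notin> T \<Longrightarrow> card (cov {e} \<inter> cov T) \<le> card T"
proof (induction T rule: finite_induct)
  case (insert f T)
  have "card (cov {e} \<inter> cov {f}) \<le> 1"
  proof (rule ccontr)
    assume "\<not> ?thesis"
    then obtain i j where ij: "i \<in> cov {e} \<inter> cov {f}" "j \<in> cov {e} \<inter> cov {f}" "i \<noteq> j"
      by (metis card_le_Suc0_iff_eq finite_Int finite_cov One_nat_def)
    then have "i \<in> I" "j \<in> I" "{e, f} \<subseteq> ed i \<inter> ed j" by (auto simp: cov_def)
    then have "card {e, f} \<le> card (ed i \<inter> ed j)" using finite_ed by (intro card_mono) auto
    then show False using linear[of i j] ij \<open>i \<in> I\<close> \<open>j \<in> I\<close> insert.prems by simp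
  qed
  moreover have "cov {e} \<inter> cov (insert f T) = (cov {e} \<inter> cov {f}) \<union> (cov {e} \<inter> cov T)"
    by (auto simp: cov_def)
  moreover have "card ((cov {e} \<inter> cov {f}) \<union> (cov {e} \<inter> cov T))
      \<le> card (cov {e} \<inter> cov {f}) + card (cov {e} \<inter> cov T)" by (rule card_Un_le)
  ultimately show ?case using insert by simp
qed (auto simp: cov_def)

end

section \<open>One random bite out of a fractional packing\<close>

locale nibble = linear_triples E I ed
  for E :: "'e set" and I :: "'i set" and ed :: "'i \<Rightarrow> 'e set" +
  fixes w :: "'i \<Rightarrow> real" and \<eta> \<epsilon> :: real
  assumes w_nonneg: "\<And>i. i \<in> I \<Longrightarrow> 0 \<le> w i" and w_le: "\<And>i. i \<in> I \<Longrightarrow> w i \<le> \<eta>"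
    and load_le: "\<And>e. e \<in> E \<Longrightarrow> load w e \<le> 1"
    and \<epsilon>: "0 < \<epsilon>" "\<epsilon> \<le> 1/2" and \<eta>: "0 < \<eta>" "\<eta> \<le> 1/2"
begin

text \<open>Coin \<open>Inl i\<close> selects the triple \<open>i\<close>; coin \<open>Inr e\<close> discards the element \<open>e\<close> for no reason
  other than to make every element survive with probability exactly \<open>1 - \<epsilon>\<close>.\<close>

definition keep :: "'i \<Rightarrow> real" where "keep i = 1 - \<epsilon> * w i"

definition \<mu> :: "'i + 'e \<Rightarrow> bool \<Rightarrow> real" where
  "\<mu> c b = (let a = (case c of Inl i \<Rightarrow> keep i | Inr e \<Rightarrow> (1 - \<epsilon>) / prod keep (cov {e})) in if b then 1 - a else a)"

lemma \<mu>_simps [simp]: "\<mu> (Inl i) False = keep i" "\<mu> (Inl i) True = \<epsilon> * w i"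
    "\<mu> (Inr e) False = (1 - \<epsilon>) / prod keep (cov {e})"
  by (auto simp: \<mu>_def keep_def)

lemma keep_bounds: assumes "i \<in> I" shows "1 - \<eta> \<le> keep i" "keep i \<le> 1"
proof -
  have "\<epsilon> * w i \<le> 1 * \<eta>" using w_nonneg[OF assms] w_le[OF assms] \<epsilon> by (intro mult_mono) auto
  then show "1 - \<eta> \<le> keep i" by (simp add: keep_def)
  show "keep i \<le> 1" using w_nonneg[OF assms] \<epsilon> by (simp add: keep_def)
qed

lemma keep_pos: "i \<in> I \<Longrightarrow> 0 < keep i" using keep_bounds(1)[of i] \<eta> by simp

lemma prod_keep_pos: "A \<subseteq> I \<Longrightarrow> 0 < prod keep A" by (auto intro!: prod_pos keep_pos)

lemma prod_keep_ge: assumes "A \<subseteq> I" shows "1 - \<epsilon> * sum w A \<le> prod keep A"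
proof -
  have "1 - (\<Sum>i\<in>A. \<epsilon> * w i) \<le> (\<Prod>i\<in>A. 1 - \<epsilon> * w i)"
  proof (rule prod_one_minus_ge)
    fix i assume "i \<in> A"
    then have i: "i \<in> I" using assms by blast
    show "0 \<le> \<epsilon> * w i" using w_nonneg[OF i] \<epsilon> by simp
    show "\<epsilon> * w i \<le> 1" using keep_pos[OF i] by (simp add: keep_def)
  qed
  then show ?thesis by (simp add: keep_def sum_distrib_left)
qed

lemma dummy_bounds: assumes "e \<in> E"
  shows "0 < (1 - \<epsilon>) / prod keep (cov {e})" "(1 - \<epsilon>) / prod keep (cov {e}) \<le> 1"
proof -
  have "\<epsilon> * sum w (cov {e}) \<le> \<epsilon> * 1"
    using load_le[OF assms] \<epsilon> by (intro mult_left_mono) (auto simp: load_cov)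
  then have "1 - \<epsilon> \<le> prod keep (cov {e})"
    using prod_keep_ge[of "cov {e}"] by (auto simp: cov_def)
  then show "(1 - \<epsilon>) / prod keep (cov {e}) \<le> 1" using \<epsilon> by (simp add: divide_le_eq_1)
  show "0 < (1 - \<epsilon>) / prod keep (cov {e})"
    using \<epsilon> prod_keep_pos[OF cov_sub] by simp
qed

sublocale finite_product "Inl ` I \<union> Inr ` E" "UNIV :: bool set" \<mu>
proof
  fix c :: "'i + 'e" and b :: bool assume c: "c \<in> Inl ` I \<union> Inr ` E"
  then show "0 \<le> \<mu> c b"
  proof
    assume "c \<in> Inl ` I"
    then obtain i where i: "i \<in> I" "c = Inl i" by blast
    show ?thesis using keep_bounds(2)[OF i(1)] keep_pos[OF i(1)] by (simp add: i(2) \<mu>_def Let_def)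
  next
    assume "c \<in> Inr ` E"
    then obtain e where e: "e \<in> E" "c = Inr e" by blast
    show ?thesis using dummy_bounds[OF e(1)] by (simp add: e(2) \<mu>_def Let_def)
  qed
qed (auto simp: finite_I finite_E \<mu>_def Let_def UNIV_bool)

text \<open>Expressed by coins and not by \<open>chosen\<close>: a selected triple kills its
  elements even if a conflict keeps it out of the packing. Survival is then an intersection of
  independent events and has a product formula.\<close>

definition alive :: "'e set \<Rightarrow> ('i + 'e \<Rightarrow> bool) \<Rightarrow> bool" where
  "alive T p \<longleftrightarrow> (\<forall>i\<in>cov T. \<not> p (Inl i)) \<and> (\<forall>e\<in>T. \<not> p (Inr e))"

lemma alive_Un: "alive (T \<union> T') p \<longleftrightarrow> alive T p \<and> alive T' p"
proof -
  have "cov (T \<union> T') = cov T \<union> cov T'" unfolding cov_def by blast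
  then show ?thesis unfolding alive_def by (simp only: ball_Un conj_ac)
qed

lemma Avg_off:
  assumes "A \<subseteq> I" "T \<subseteq> E"
  shows "Avg (\<lambda>p. of_bool ((\<forall>i\<in>A. \<not> p (Inl i)) \<and> (\<forall>e\<in>T. \<not> p (Inr e))))
    = prod keep A * (\<Prod>e\<in>T. (1 - \<epsilon>) / prod keep (cov {e}))"
proof -
  have fin: "finite A" "finite T"
    using finite_subset[OF assms(1) finite_I] finite_subset[OF assms(2) finite_E] by auto
  have ind: "(\<lambda>p. of_bool ((\<forall>i\<in>A. \<not> p (Inl i)) \<and> (\<forall>e\<in>T. \<not> p (Inr e))))
      = (\<lambda>p. \<Prod>c\<in>Inl ` A \<union> Inr ` T. of_bool (\<not> p c) :: real)"
    using fin by (simp add: prod_of_bool ball_Un)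
  have "Avg (\<lambda>p. of_bool ((\<forall>i\<in>A. \<not> p (Inl i)) \<and> (\<forall>e\<in>T. \<not> p (Inr e))))
      = (\<Prod>c\<in>Inl ` A \<union> Inr ` T. \<Sum>b\<in>UNIV. \<mu> c b * of_bool (\<not> b))"
    unfolding ind using assms by (intro Avg_prod[where f = "\<lambda>_ b. of_bool (\<not> b)"]) blast
  also have "\<dots> = (\<Prod>c\<in>Inl ` A \<union> Inr ` T. \<mu> c False)"
    by (simp add: UNIV_bool)
  also have "\<dots> = (\<Prod>c\<in>Inl ` A. \<mu> c False) * (\<Prod>c\<in>Inr ` T. \<mu> c False)"
    using fin by (intro prod.union_disjoint) auto
  finally show ?thesis by (simp add: prod.reindex)
qed

definition g :: "'e set \<Rightarrow> real" where "g T = Avg (\<lambda>p. of_bool (alive T p))"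

lemma g_eq: "T \<subseteq> E \<Longrightarrow> g T = prod keep (cov T) * (\<Prod>e\<in>T. (1 - \<epsilon>) / prod keep (cov {e}))"
  unfolding g_def alive_def using cov_sub by (rule Avg_off)

text \<open>Adding \<open>e\<close> multiplies the survival probability by
  \<open>1 - \<epsilon>\<close> and divides it by the \<open>keep\<close> factors of the triples
  that meet both \<open>e\<close> and \<open>T\<close>, which would otherwise count twice. At most
  \<open>card T\<close> such factors occur, each between \<open>1 - \<eta>\<close> and 1; the square
  in the exponent is a crude sum of these counts.\<close>

lemma g_bounds:
  assumes "finite T" "T \<subseteq> E"
  shows "(1 - \<epsilon>) ^ card T \<le> g T \<and> g T \<le> (1 - \<epsilon>) ^ card T / (1 - \<eta>) ^ (card T * card T)"
  using assms
proof (induction T rule: finite_induct)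
  case empty then show ?case by (simp add: g_eq cov_def)
next
  case (insert e T)
  let ?P = "prod keep"
  have T: "T \<subseteq> E" "e \<in> E" using insert.prems by auto
  have pos: "0 < ?P (cov U)" for U using prod_keep_pos[OF cov_sub] .
  have I: "i \<in> cov U \<Longrightarrow> i \<in> I" for i U by (auto simp: cov_def)
  have "0 \<le> (1 - \<epsilon>) ^ card T" using \<epsilon> by simp
  then have gT: "0 \<le> g T" using insert.IH[OF T(1)] by linarith
  have union: "?P (cov {e} \<union> cov T) * ?P (cov {e} \<inter> cov T) = ?P (cov {e}) * ?P (cov T)"
    by (rule prod.union_inter) auto
  have Pi: "0 < ?P (cov {e} \<inter> cov T)" by (rule prod_keep_pos) (auto dest: I)
  have g: "g (insert e T) = g T * (1 - \<epsilon>) / ?P (cov {e} \<inter> cov T)"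
  proof -
    have U: "?P (cov {e} \<union> cov T) = ?P (cov {e}) * ?P (cov T) / ?P (cov {e} \<inter> cov T)"
      using union Pi by (metis nonzero_eq_divide_eq less_irrefl)
    have *: "a * b / c * ((1 - \<epsilon>) / a * d) = b * d * (1 - \<epsilon>) / c" if "0 < a" for a b c d :: real
      using that by simp
    let ?D = "\<Prod>e\<in>T. (1 - \<epsilon>) / ?P (cov {e})"
    have "g (insert e T) = ?P (cov {e} \<union> cov T) * ((1 - \<epsilon>) / ?P (cov {e}) * ?D)"
      using T insert.hyps by (simp add: g_eq cov_insert[of e T])
    also have "\<dots> = ?P (cov T) * ?D * (1 - \<epsilon>) / ?P (cov {e} \<inter> cov T)"
      unfolding U by (rule *) (rule pos)
    finally show ?thesis using T by (simp add: g_eq)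
  qed
  have le1: "?P (cov {e} \<inter> cov T) \<le> 1" using keep_bounds(2) less_imp_le[OF keep_pos] I by (intro prod_le_1) blast
  have "(1 - \<eta>) ^ card T \<le> (1 - \<eta>) ^ card (cov {e} \<inter> cov T)"
    using \<eta> card_cov_Int[of T e] insert.hyps by (intro power_decreasing) auto
  also have "\<dots> = (\<Prod>i\<in>cov {e} \<inter> cov T. 1 - \<eta>)" by simp
  also have "\<dots> \<le> ?P (cov {e} \<inter> cov T)"
    using keep_bounds I \<eta> by (intro prod_mono) auto
  finally have ge: "(1 - \<eta>) ^ card T \<le> ?P (cov {e} \<inter> cov T)" .
  have \<eta>p: "0 < (1 - \<eta>) ^ k" for k using \<eta> by simp
  have "(1 - \<epsilon>) ^ card (insert e T) \<le> g T * (1 - \<epsilon>)"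
    using insert T \<epsilon> by (simp add: mult.commute mult_right_mono)
  also have "\<dots> \<le> g (insert e T)"
    unfolding g using le1 Pi gT \<epsilon>
    by (simp add: pos_le_divide_eq mult_left_le)
  finally have lower: "(1 - \<epsilon>) ^ card (insert e T) \<le> g (insert e T)" .
  have "g (insert e T) \<le> g T * (1 - \<epsilon>) / (1 - \<eta>) ^ card T"
    unfolding g using ge \<eta>p gT \<epsilon> by (intro divide_left_mono mult_nonneg_nonneg mult_pos_pos) (use Pi in auto)
  also have "\<dots> \<le> ((1 - \<epsilon>) ^ card T / (1 - \<eta>) ^ (card T * card T)) * (1 - \<epsilon>) / (1 - \<eta>) ^ card T"
    using insert.IH T \<eta>p \<epsilon> by (intro divide_right_mono mult_right_mono) (auto intro: less_imp_le)
  also have "\<dots> = (1 - \<epsilon>) ^ card (insert e T) / (1 - \<eta>) ^ (card T * card T + card T)"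
    using insert.hyps by (simp add: power_add mult.commute)
  also have "\<dots> \<le> (1 - \<epsilon>) ^ card (insert e T) / (1 - \<eta>) ^ (card (insert e T) * card (insert e T))"
    using \<eta> \<epsilon> insert.hyps \<eta>p by (intro divide_left_mono power_decreasing mult_pos_pos) auto
  finally show ?case using lower by blast
qed

end

section \<open>First and second moments of what a bite leaves\<close>

context nibble begin

definition chosen :: "('i + 'e \<Rightarrow> bool) \<Rightarrow> 'i set" where
  "chosen p = {i\<in>I. p (Inl i) \<and> (\<forall>j\<in>cov (ed i) - {i}. \<not> p (Inl j))}"

text \<open>The divisor has exponent 2 and not 3: seen from a surviving element, a triple survives
  through its two other elements, so this normalisation keeps the loads of survivors near their old
  values.\<close>

definition rest :: "('i + 'e \<Rightarrow> bool) \<Rightarrow> 'i \<Rightarrow> real" where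
  "rest p i = w i * of_bool (alive (ed i) p) / (1 - \<epsilon>)\<^sup>2"

text \<open>The load of \<open>e\<close> under \<open>rest\<close> with the survival of
  \<open>e\<close> itself ignored. It dominates that load in every outcome, so concentration can be
  shown without conditioning on \<open>e\<close>.\<close>

definition half :: "'e \<Rightarrow> ('i + 'e \<Rightarrow> bool) \<Rightarrow> real" where
  "half e p = (\<Sum>i\<in>cov {e}. w i * of_bool (alive (ed i - {e}) p)) / (1 - \<epsilon>)\<^sup>2"

lemma packing_chosen: "packing (chosen p)"
  unfolding packing_def chosen_def cov_def by blast

lemma rest_disjoint:
  assumes "i \<in> I" "rest p i \<noteq> 0" "j \<in> chosen p"
  shows "ed i \<inter> ed j = {}"
  using assms unfolding rest_def chosen_def alive_def cov_def by auto

lemma Avg_card_chosen: "\<epsilon> * (1 - 3 * \<epsilon>) * sum w I \<le> Avg (\<lambda>p. real (card (chosen p)))"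
proof -
  have "\<epsilon> * w i * (1 - 3 * \<epsilon>)
      \<le> Avg (\<lambda>p. of_bool (p (Inl i) \<and> (\<forall>j\<in>cov (ed i) - {i}. \<not> p (Inl j))))" if i: "i \<in> I" for i
  proof -
    let ?C = "cov (ed i) - {i}"
    have C: "?C \<subseteq> I" using cov_sub by blast
    have fC: "finite ?C" by simp
    have ind: "(\<lambda>p. of_bool (p (Inl i) \<and> (\<forall>j\<in>?C. \<not> p (Inl j))))
        = (\<lambda>p. \<Prod>c\<in>insert (Inl i) (Inl ` ?C). of_bool (p c = (c = Inl i)) :: real)"
      using fC by (subst prod_of_bool) auto
    have "Avg (\<lambda>p. of_bool (p (Inl i) \<and> (\<forall>j\<in>?C. \<not> p (Inl j))))
        = (\<Prod>c\<in>insert (Inl i) (Inl ` ?C). \<Sum>b\<in>UNIV. \<mu> c b * of_bool (b = (c = Inl i)))"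
      unfolding ind using i C by (intro Avg_prod[where f = "\<lambda>c b. of_bool (b = (c = Inl i))"]) blast
    also have "\<dots> = (\<Prod>c\<in>insert (Inl i) (Inl ` ?C). \<mu> c (c = Inl i))"
      by (intro prod.cong refl) (simp add: UNIV_bool)
    also have "\<dots> = \<epsilon> * w i * prod keep ?C"
      using fC by (subst prod.insert) (auto simp: prod.reindex intro!: prod.cong)
    \<comment> \<open>A conflicting triple meets one of the three elements of \<open>ed i\<close>,
      each of load at most 1, so the conflicting weight is at most 3.\<close>
    also have "\<dots> \<ge> \<epsilon> * w i * (1 - 3 * \<epsilon>)"
    proof -
      have "sum w ?C \<le> sum w (cov (ed i))" using w_nonneg cov_sub by (intro sum_mono2) auto
      also have "\<dots> \<le> (\<Sum>j\<in>cov (ed i). \<Sum>e\<in>ed i. if e \<in> ed j then w j else 0)"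
      proof (rule sum_mono)
        fix j assume j: "j \<in> cov (ed i)"
        then obtain e where e: "e \<in> ed i" "e \<in> ed j" "j \<in> I" by (auto simp: cov_def)
        then have "(if e \<in> ed j then w j else 0) \<le> (\<Sum>e\<in>ed i. if e \<in> ed j then w j else 0)"
          using finite_ed[OF i] w_nonneg by (intro member_le_sum) auto
        then show "w j \<le> (\<Sum>e\<in>ed i. if e \<in> ed j then w j else 0)" using e by simp
      qed
      also have "\<dots> = (\<Sum>e\<in>ed i. \<Sum>j\<in>cov (ed i). if e \<in> ed j then w j else 0)" by (rule sum.swap)
      also have "\<dots> = (\<Sum>e\<in>ed i. load w e)"
      proof (rule sum.cong[OF refl])
        fix e assume "e \<in> ed i"
        then have "{j\<in>cov (ed i). e \<in> ed j} = {j\<in>I. e \<in> ed j}" by (auto simp: cov_def)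
        then show "(\<Sum>j\<in>cov (ed i). if e \<in> ed j then w j else 0) = load w e"
          by (simp only: load_def sum.inter_filter[OF finite_cov, symmetric])
      qed
      also have "\<dots> \<le> (\<Sum>e\<in>ed i. 1)" using ed_sub[OF i] load_le by (intro sum_mono) auto
      finally have "\<epsilon> * sum w ?C \<le> \<epsilon> * 3" using \<epsilon> by (simp add: card_ed[OF i])
      then have "1 - 3 * \<epsilon> \<le> prod keep ?C" using prod_keep_ge[OF C] by simp
      then show ?thesis using \<epsilon> w_nonneg[OF i] by (intro mult_left_mono) auto
    qed
    finally show ?thesis .
  qed
  then have "(\<Sum>i\<in>I. \<epsilon> * w i * (1 - 3 * \<epsilon>))
      \<le> Avg (\<lambda>p. \<Sum>i\<in>I. of_bool (p (Inl i) \<and> (\<forall>j\<in>cov (ed i) - {i}. \<not> p (Inl j))))"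
    unfolding Avg_sum by (rule sum_mono)
  moreover have "real (card (chosen p)) = (\<Sum>i\<in>I. of_bool (p (Inl i) \<and> (\<forall>j\<in>cov (ed i) - {i}. \<not> p (Inl j))))" for p
    unfolding chosen_def by (simp add: finite_I Int_def)
  moreover have "(\<Sum>i\<in>I. \<epsilon> * w i * (1 - 3 * \<epsilon>)) = \<epsilon> * (1 - 3 * \<epsilon>) * sum w I"
    unfolding sum_distrib_left by (intro sum.cong) auto
  ultimately show ?thesis by simp
qed

text \<open>Three elements have to survive, but the normalisation compensates only two survivals;
  one factor \<open>1 - \<epsilon>\<close> is left.\<close>

lemma Avg_rest: "(1 - \<epsilon>) * sum w I \<le> Avg (\<lambda>p. sum (rest p) I)"
proof -
  have *: "(1 - \<epsilon>) * w i \<le> Avg (\<lambda>p. rest p i)" if i: "i \<in> I" for i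
  proof -
    have "(1 - \<epsilon>) ^ 3 \<le> g (ed i)" using g_bounds[of "ed i"] i finite_ed ed_sub card_ed by auto
    then have "w i / (1 - \<epsilon>)\<^sup>2 * (1 - \<epsilon>) ^ 3 \<le> w i / (1 - \<epsilon>)\<^sup>2 * g (ed i)"
      using w_nonneg[OF i] by (intro mult_left_mono) auto
    moreover have "w i / (1 - \<epsilon>)\<^sup>2 * (1 - \<epsilon>) ^ 3 = (1 - \<epsilon>) * w i"
      using \<epsilon> by (simp add: power2_eq_square power3_eq_cube)
    moreover have "Avg (\<lambda>p. rest p i) = w i / (1 - \<epsilon>)\<^sup>2 * g (ed i)"
      unfolding g_def by (subst Avg_cmult[symmetric]) (simp add: rest_def)
    ultimately show ?thesis by simp
  qed
  show ?thesis unfolding Avg_sum sum_distrib_left by (rule sum_mono) (use * in auto)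
qed

lemma load_rest_le: "load (rest p) e \<le> half e p"
  unfolding load_cov half_def sum_divide_distrib
proof (rule sum_mono)
  fix i assume "i \<in> cov {e}"
  then have "0 \<le> w i" "alive (ed i) p \<Longrightarrow> alive (ed i - {e}) p"
    using w_nonneg by (auto simp: cov_def alive_def)
  then show "rest p i \<le> w i * of_bool (alive (ed i - {e}) p) / (1 - \<epsilon>)\<^sup>2"
    unfolding rest_def by (intro divide_right_mono mult_left_mono) auto
qed

definition err :: real where "err = 1 / (1 - \<eta>) ^ 16 - 1 + 16 * \<eta>"

text \<open>Two triples through \<open>e\<close> share no other element, so their four remaining
  elements survive together with probability close to \<open>(1 - \<epsilon>) ^ 4\<close>; the
  exponent 16 is the square of 4 in \<open>g_bounds\<close>. Off-diagonal terms thus almost match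
  the squared mean. The diagonal contributes at most \<open>16 * \<eta>\<close>, as weights are at
  most \<open>\<eta>\<close> and \<open>(1 - \<epsilon>) ^ 4 \<ge> 1 / 16\<close>.\<close>

lemma half_variance:
  assumes e: "e \<in> E"
  shows "Avg (\<lambda>p. (half e p - load w e)\<^sup>2) \<le> err"
proof -
  let ?l = "load w e" and ?C = "cov {e}" and ?q = "(1 - \<epsilon>)\<^sup>2"
  have C: "i \<in> I" "e \<in> ed i" if "i \<in> ?C" for i using that by (auto simp: cov_def)
  have q: "0 < ?q" "1/4 \<le> ?q" using \<epsilon> power_mono[of "1/2" "1 - \<epsilon>" 2] by (auto simp: power2_eq_square)
  have l: "0 \<le> ?l" "?l \<le> 1" using load_nonneg w_nonneg load_le e by auto
  have l_eq: "?l = sum w ?C" by (rule load_cov)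
  have sub: "ed i - {e} \<subseteq> E" "finite (ed i - {e})" "card (ed i - {e}) = 2" if "i \<in> ?C" for i
    using C[OF that] ed_sub finite_ed card_ed by auto
  have Avg1: "?l \<le> Avg (half e)"
  proof -
    have "Avg (half e) = (\<Sum>i\<in>?C. w i / ?q * g (ed i - {e}))"
    proof -
      have "half e = (\<lambda>p. \<Sum>i\<in>?C. w i / ?q * of_bool (alive (ed i - {e}) p))"
        by (rule ext) (simp only: half_def sum_divide_distrib times_divide_eq_left)
      then show ?thesis by (simp only: Avg_sum Avg_cmult g_def)
    qed
    also have "\<dots> \<ge> (\<Sum>i\<in>?C. w i / ?q * ?q)"
    proof (intro sum_mono mult_left_mono)
      fix i assume i: "i \<in> ?C"
      show "?q \<le> g (ed i - {e})" using g_bounds[OF sub(2,1)[OF i]] sub(3)[OF i] by simp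
      show "0 \<le> w i / ?q" using w_nonneg[OF C(1)[OF i]] q by simp
    qed
    finally show ?thesis using q by (simp add: l_eq)
  qed
  have pair: "w i * w j * g ((ed i - {e}) \<union> (ed j - {e}))
      \<le> w i * w j * (?q\<^sup>2 / (1 - \<eta>) ^ 16) + (if i = j then w i * \<eta> else 0)" if ij: "i \<in> ?C" "j \<in> ?C" for i j
  proof (cases "i = j")
    case True
    have "g (ed i - {e}) \<le> 1" "0 \<le> g (ed i - {e})" unfolding g_def
      using Avg_mono[of "\<lambda>p. of_bool (alive (ed i - {e}) p)" "\<lambda>_. 1"]
        Avg_mono[of "\<lambda>_. 0" "\<lambda>p. of_bool (alive (ed i - {e}) p)"] by simp_all
    moreover have "w i * w i \<le> w i * \<eta>"
      using w_nonneg[OF C(1)[OF ij(1)]] w_le[OF C(1)[OF ij(1)]] by (intro mult_left_mono) auto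
    ultimately have "w i * w i * g (ed i - {e}) \<le> w i * \<eta> * 1"
      using w_nonneg[OF C(1)[OF ij(1)]] \<eta> by (rule_tac mult_mono) auto
    moreover have "0 \<le> w i * w i * (?q\<^sup>2 / (1 - \<eta>) ^ 16)" using \<eta> by simp
    ultimately have "w i * w i * g (ed i - {e}) \<le> w i * w i * (?q\<^sup>2 / (1 - \<eta>) ^ 16) + w i * \<eta>" by linarith
    then show ?thesis unfolding True[symmetric] by (simp only: Un_absorb if_True refl)
  next
    case False
    have "(ed i - {e}) \<inter> (ed j - {e}) = {}"
    proof (rule ccontr)
      assume "\<not> ?thesis"
      then obtain f where "f \<in> ed i" "f \<in> ed j" "f \<noteq> e" by auto
      then have "card {e, f} \<le> card (ed i \<inter> ed j)" using C ij finite_ed by (intro card_mono) auto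
      then show False using linear[of i j] C ij False \<open>f \<noteq> e\<close> by simp
    qed
    then have c4: "card ((ed i - {e}) \<union> (ed j - {e})) = 4" using sub ij by (simp add: card_Un_disjoint)
    have "g ((ed i - {e}) \<union> (ed j - {e})) \<le> (1 - \<epsilon>) ^ 4 / (1 - \<eta>) ^ 16"
      using g_bounds[of "(ed i - {e}) \<union> (ed j - {e})"] sub[OF ij(1)] sub[OF ij(2)] unfolding c4 by simp
    then have "w i * w j * g ((ed i - {e}) \<union> (ed j - {e})) \<le> w i * w j * ((1 - \<epsilon>) ^ 4 / (1 - \<eta>) ^ 16)"
      using w_nonneg[OF C(1)[OF ij(1)]] w_nonneg[OF C(1)[OF ij(2)]] by (intro mult_left_mono) auto
    then show ?thesis using False by simp
  qed
  have "Avg (\<lambda>p. (half e p)\<^sup>2) \<le> ?l\<^sup>2 / (1 - \<eta>) ^ 16 + 16 * \<eta>"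
  proof -
    have "(half e p)\<^sup>2 = (\<Sum>i\<in>?C. \<Sum>j\<in>?C. w i * w j / ?q\<^sup>2 * of_bool (alive ((ed i - {e}) \<union> (ed j - {e})) p))" for p
      unfolding half_def power_divide power2_eq_square[of "sum _ _"] sum_product sum_divide_distrib alive_Un
      by (intro sum.cong refl) simp
    then have "Avg (\<lambda>p. (half e p)\<^sup>2) = (\<Sum>i\<in>?C. \<Sum>j\<in>?C. w i * w j / ?q\<^sup>2 * g ((ed i - {e}) \<union> (ed j - {e})))"
      by (simp only: Avg_sum Avg_cmult g_def)
    also have "\<dots> = (\<Sum>i\<in>?C. \<Sum>j\<in>?C. w i * w j * g ((ed i - {e}) \<union> (ed j - {e}))) / ?q\<^sup>2"
      by (simp add: sum_divide_distrib)
    also have "\<dots> \<le> (\<Sum>i\<in>?C. \<Sum>j\<in>?C. w i * w j * (?q\<^sup>2 / (1 - \<eta>) ^ 16) + (if i = j then w i * \<eta> else 0)) / ?q\<^sup>2"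
      by (intro divide_right_mono sum_mono pair) auto
    also have "\<dots> = (?l\<^sup>2 * (?q\<^sup>2 / (1 - \<eta>) ^ 16) + ?l * \<eta>) / ?q\<^sup>2"
    proof -
      have "(\<Sum>i\<in>?C. \<Sum>j\<in>?C. w i * w j * K + (if i = j then w i * \<eta> else 0)) = ?l\<^sup>2 * K + ?l * \<eta>" for K
      proof -
        have "(\<Sum>i\<in>?C. \<Sum>j\<in>?C. w i * w j * K) = ?l\<^sup>2 * K"
        proof -
          have "?l\<^sup>2 = (\<Sum>i\<in>?C. \<Sum>j\<in>?C. w i * w j)"
            by (simp only: l_eq power2_eq_square sum_product)
          then show ?thesis by (simp only: sum_distrib_right)
        qed
        then show ?thesis by (simp add: sum.distrib l_eq sum_distrib_right)
      qed
      then show ?thesis by (simp only:)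
    qed
    also have "\<dots> = ?l\<^sup>2 / (1 - \<eta>) ^ 16 + ?l * \<eta> / ?q\<^sup>2"
    proof -
      have "(a * (b / c) + d) / b = a / c + d / b" if "b \<noteq> 0" for a b c d :: real
        using that by (simp add: add_divide_distrib)
      then show ?thesis using q by simp
    qed
    also have "?l * \<eta> / ?q\<^sup>2 \<le> 1 * \<eta> / (1/4)\<^sup>2"
      using l \<eta> q by (intro frac_le mult_right_mono power_mono) auto
    finally show ?thesis by (simp add: power2_eq_square)
  qed
  moreover have "?l\<^sup>2 / (1 - \<eta>) ^ 16 - ?l\<^sup>2 \<le> 1 / (1 - \<eta>) ^ 16 - 1"
  proof -
    have "?l\<^sup>2 * (1 / (1 - \<eta>) ^ 16 - 1) \<le> 1 * (1 / (1 - \<eta>) ^ 16 - 1)"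
      using l \<eta> by (intro mult_right_mono) (auto simp: power_le_one)
    then show ?thesis by (simp add: algebra_simps)
  qed
  moreover have "Avg (\<lambda>p. (half e p - ?l)\<^sup>2) = Avg (\<lambda>p. (half e p)\<^sup>2) - 2 * ?l * Avg (half e) + ?l\<^sup>2"
  proof -
    have "(\<lambda>p. (half e p - ?l)\<^sup>2) = (\<lambda>p. ((half e p)\<^sup>2 - 2 * ?l * half e p) + ?l\<^sup>2)"
      by (rule ext) (simp add: power2_eq_square algebra_simps)
    then show ?thesis by (simp add: Avg_add Avg_diff Avg_cmult)
  qed
  moreover have "?l * ?l \<le> ?l * Avg (half e)" using Avg1 l by (intro mult_left_mono)
  ultimately show ?thesis unfolding err_def by (simp add: power2_eq_square)
qed

text \<open>Chebyshev in averaged form: \<open>d \<le> \<zeta> + d ^ 2 / \<zeta>\<close> turns the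
  variance into a bound on the mean excess.\<close>

lemma Avg_overload:
  assumes e: "e \<in> E" and "0 < \<zeta>"
  shows "Avg (\<lambda>p. max 0 (load (rest p) e - 1)) \<le> \<zeta> + err / \<zeta>"
proof -
  have "max 0 (load (rest p) e - 1) \<le> \<zeta> + 1/\<zeta> * (half e p - load w e)\<^sup>2" for p
  proof -
    define d where "d = half e p - load w e"
    have "d \<le> \<zeta> + d\<^sup>2 / \<zeta>"
    proof (cases "d \<le> \<zeta>")
      case True then show ?thesis using assms by (simp add: add_increasing2)
    next
      case False
      then have "d * \<zeta> \<le> d\<^sup>2" unfolding power2_eq_square using assms by (intro mult_left_mono) auto
      then have "d \<le> d\<^sup>2 / \<zeta>" using assms by (simp add: pos_le_divide_eq)
      then show ?thesis using assms by simp
    qed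
    moreover have "load (rest p) e - 1 \<le> d" using load_rest_le[of p e] load_le[OF e] by (simp add: d_def)
    moreover have "0 \<le> \<zeta> + d\<^sup>2 / \<zeta>" using assms by simp
    ultimately show ?thesis by (simp add: d_def)
  qed
  then have "Avg (\<lambda>p. max 0 (load (rest p) e - 1)) \<le> Avg (\<lambda>p. \<zeta> + 1/\<zeta> * (half e p - load w e)\<^sup>2)"
    by (rule Avg_mono)
  also have "\<dots> \<le> \<zeta> + 1/\<zeta> * err"
    unfolding Avg_add Avg_cmult Avg_const using half_variance[OF e] assms
    by (intro add_left_mono mult_left_mono) auto
  finally show ?thesis by simp
qed

text \<open>One outcome must be good for the selected triples and for the residual weight at once.
  Averaging their sum, with the residual weight multiplied by the ratio \<open>\<theta>\<close> that
  will later be extracted from it, yields such an outcome.\<close>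

lemma nibble_step:
  fixes \<zeta> \<theta> :: real
  assumes "0 < \<zeta>" "0 \<le> \<theta>" "\<theta> \<le> 1"
  obtains J w' where "packing J" "\<And>i. i \<in> I \<Longrightarrow> 0 \<le> w' i" "\<And>i. i \<in> I \<Longrightarrow> w' i \<le> 4 * \<eta>"
    "\<And>e. e \<in> E \<Longrightarrow> load w' e \<le> 1"
    "\<And>i j. i \<in> I \<Longrightarrow> w' i \<noteq> 0 \<Longrightarrow> j \<in> J \<Longrightarrow> ed i \<inter> ed j = {}"
    "(\<epsilon> * (1 - 3 * \<epsilon>) + \<theta> * (1 - \<epsilon>)) * sum w I - (\<zeta> + err / \<zeta>) * card E \<le> card J + \<theta> * sum w' I"
proof -
  let ?X = "\<lambda>p. card (chosen p) + \<theta> * (sum (rest p) I - (\<Sum>e\<in>E. max 0 (load (rest p) e - 1)))"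
  obtain p where p: "Avg ?X \<le> ?X p" using Avg_attained by blast
  have q: "1/4 \<le> (1 - \<epsilon>)\<^sup>2" using \<epsilon> power_mono[of "1/2" "1 - \<epsilon>" 2] by (auto simp: power2_eq_square)
  have rest: "0 \<le> rest p i" "rest p i \<le> 4 * \<eta>" if "i \<in> I" for i
  proof -
    show "0 \<le> rest p i" using w_nonneg[OF that] by (simp add: rest_def)
    have "rest p i \<le> \<eta> / (1/4)" unfolding rest_def using w_nonneg[OF that] w_le[OF that] q \<eta>
      by (intro frac_le) (auto simp: of_bool_def)
    then show "rest p i \<le> 4 * \<eta>" by simp
  qed
  obtain w' where w': "\<And>i. i \<in> I \<Longrightarrow> 0 \<le> w' i" "\<And>i. i \<in> I \<Longrightarrow> w' i \<le> rest p i"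
    "\<And>e. e \<in> E \<Longrightarrow> load w' e \<le> 1"
    "sum w' I \<ge> sum (rest p) I - (\<Sum>e\<in>E. max 0 (load (rest p) e - 1))"
    using trim[of "rest p", OF rest(1)] by blast
  have "(\<Sum>e\<in>E. Avg (\<lambda>p. max 0 (load (rest p) e - 1))) \<le> (\<Sum>e\<in>E. \<zeta> + err / \<zeta>)"
    using Avg_overload assms by (intro sum_mono) auto
  then have over: "(\<Sum>e\<in>E. Avg (\<lambda>p. max 0 (load (rest p) e - 1))) \<le> (\<zeta> + err / \<zeta>) * card E" by (simp add: mult.commute)
  have err0: "0 \<le> (\<zeta> + err / \<zeta>) * card E"
    using order_trans[OF sum_nonneg over] Avg_mono[of "\<lambda>_. 0"] by force
  have "\<theta> * ((1 - \<epsilon>) * sum w I) - (\<zeta> + err / \<zeta>) * card E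
      \<le> \<theta> * ((1 - \<epsilon>) * sum w I - (\<zeta> + err / \<zeta>) * card E)"
    proof -
    have "\<theta> * ((\<zeta> + err / \<zeta>) * card E) \<le> (\<zeta> + err / \<zeta>) * card E"
      using assms err0 by (intro mult_left_le_one_le) auto
    then show ?thesis by (simp only: right_diff_distrib)
  qed
  also have "\<dots> \<le> \<theta> * (Avg (\<lambda>p. sum (rest p) I) - (\<Sum>e\<in>E. Avg (\<lambda>p. max 0 (load (rest p) e - 1))))"
    using Avg_rest over assms by (intro mult_left_mono diff_mono) auto
  finally have "(\<epsilon> * (1 - 3 * \<epsilon>) + \<theta> * (1 - \<epsilon>)) * sum w I - (\<zeta> + err / \<zeta>) * card E \<le> Avg ?X"
    using Avg_card_chosen unfolding Avg_add Avg_cmult Avg_diff Avg_sum by (simp add: algebra_simps)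
  also have "\<dots> \<le> card (chosen p) + \<theta> * sum w' I"
    using p mult_left_mono[OF w'(4) assms(2)] by linarith
  finally have fin: "(\<epsilon> * (1 - 3 * \<epsilon>) + \<theta> * (1 - \<epsilon>)) * sum w I - (\<zeta> + err / \<zeta>) * card E \<le> card (chosen p) + \<theta> * sum w' I" .
  show thesis
  proof (rule that[of "chosen p" w'])
    show "ed i \<inter> ed j = {}" if "i \<in> I" "w' i \<noteq> 0" "j \<in> chosen p" for i j
      using rest_disjoint[of i p j] that w'(1,2)[of i] by fastforce
    show "w' i \<le> 4 * \<eta>" if "i \<in> I" for i using w'(2) rest(2) that by force
  qed (use packing_chosen w' fin in auto)
qed

end

section \<open>Iterating the bite\<close>

lemma linear_triples_subset: "linear_triples E I ed \<Longrightarrow> I' \<subseteq> I \<Longrightarrow> linear_triples E I' ed"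
  unfolding linear_triples_def by (meson finite_subset subsetD)

text \<open>Uniformity of \<open>\<eta>\<close> over all systems is the point: it allows the
  property to be applied to the system left over after a bite. The type tokens only fix the types
  over which the sets range.\<close>

definition packs_ratio :: "'e itself \<Rightarrow> 'i itself \<Rightarrow> real \<Rightarrow> bool" where
  "packs_ratio _ _ \<theta> \<longleftrightarrow> (\<forall>\<delta>>0 :: real. \<exists>\<eta>>0 :: real. \<forall>(E :: 'e set) (I :: 'i set) ed w. linear_triples E I ed \<longrightarrow>
     (\<forall>i\<in>I. 0 \<le> w i \<and> w i \<le> \<eta>) \<longrightarrow> (\<forall>e\<in>E. linear_triples.load I ed w e \<le> 1) \<longrightarrow>
     (\<exists>J. linear_triples.packing I ed J \<and> \<theta> * sum w I - \<delta> * card E \<le> card J))"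

lemma packs_ratio_mono:
  assumes "packs_ratio TYPE('e) TYPE('i) \<theta>" "\<theta>' \<le> \<theta>"
  shows "packs_ratio TYPE('e) TYPE('i) \<theta>'"
  unfolding packs_ratio_def
proof (intro allI impI)
  fix \<delta> :: real assume "0 < \<delta>"
  then obtain \<eta> where \<eta>: "\<eta> > 0" "\<And>(E :: 'e set) (I :: 'i set) ed w. linear_triples E I ed \<Longrightarrow>
     (\<forall>i\<in>I. 0 \<le> w i \<and> w i \<le> \<eta>) \<Longrightarrow> (\<forall>e\<in>E. linear_triples.load I ed w e \<le> 1) \<Longrightarrow>
     (\<exists>J. linear_triples.packing I ed J \<and> \<theta> * sum w I - \<delta> * card E \<le> card J)"
    using assms(1) unfolding packs_ratio_def by metis
  have "\<exists>J. linear_triples.packing I ed J \<and> \<theta>' * sum w I - \<delta> * card E \<le> card J"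
    if a: "linear_triples E I ed" "\<forall>i\<in>I. 0 \<le> w i \<and> w i \<le> \<eta>" "\<forall>e\<in>E. linear_triples.load I ed w e \<le> 1"
    for E :: "'e set" and I :: "'i set" and ed w
  proof -
    have "\<theta>' * sum w I \<le> \<theta> * sum w I" using assms(2) a(2) by (intro mult_right_mono sum_nonneg) auto
    then show ?thesis using \<eta>(2)[OF a] by force
  qed
  with \<eta>(1) show "\<exists>\<eta>>0 :: real. \<forall>(E :: 'e set) (I :: 'i set) ed w. linear_triples E I ed \<longrightarrow>
     (\<forall>i\<in>I. 0 \<le> w i \<and> w i \<le> \<eta>) \<longrightarrow> (\<forall>e\<in>E. linear_triples.load I ed w e \<le> 1) \<longrightarrow>
     (\<exists>J. linear_triples.packing I ed J \<and> \<theta>' * sum w I - \<delta> * card E \<le> card J)" by blast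
qed

lemma packs_ratio_0: "packs_ratio TYPE('e) TYPE('i) 0"
  unfolding packs_ratio_def
proof (intro allI impI exI[of _ 1] conjI)
  fix \<delta> :: real and E :: "'e set" and I :: "'i set" and ed and w :: "'i \<Rightarrow> real"
  assume "0 < \<delta>" and lt: "linear_triples E I ed"
  then show "\<exists>J. linear_triples.packing I ed J \<and> 0 * sum w I - \<delta> * card E \<le> card J"
    by (intro exI[of _ "{}"]) (simp add: linear_triples.packing_def[OF lt])
qed simp

text \<open>Induction on the guaranteed ratio replaces bookkeeping over rounds: after one bite the
  hypothesis packs a fraction \<open>\<theta>\<close> of the residual weight. Dropping the triples
  of residual weight 0 makes everything it packs disjoint from the bite.\<close>

lemma packs_ratio_step:
  fixes \<epsilon> :: real
  assumes IH: "packs_ratio TYPE('e) TYPE('i) \<theta>" and \<theta>: "0 \<le> \<theta>" "\<theta> \<le> 1" and eps: "0 < \<epsilon>" "\<epsilon> \<le> 1/2"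
  shows "packs_ratio TYPE('e) TYPE('i) (\<epsilon> * (1 - 3 * \<epsilon>) + \<theta> * (1 - \<epsilon>))"
  unfolding packs_ratio_def
proof (intro allI impI)
  fix \<delta> :: real assume \<delta>: "0 < \<delta>"
  then obtain \<eta>1 where \<eta>1: "\<eta>1 > 0" "\<And>(E :: 'e set) (I :: 'i set) ed w. linear_triples E I ed \<Longrightarrow>
     (\<forall>i\<in>I. 0 \<le> w i \<and> w i \<le> \<eta>1) \<Longrightarrow> (\<forall>e\<in>E. linear_triples.load I ed w e \<le> 1) \<Longrightarrow>
     (\<exists>J. linear_triples.packing I ed J \<and> \<theta> * sum w I - \<delta> / 2 * card E \<le> card J)"
    using IH[unfolded packs_ratio_def, rule_format, of "\<delta> / 2"] by auto
  define \<zeta> where "\<zeta> = \<delta> / 4"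
  have \<zeta>: "0 < \<zeta>" using \<delta> by (simp add: \<zeta>_def)
  have "((\<lambda>\<eta>::real. 1 / (1 - \<eta>) ^ 16 - 1 + 16 * \<eta>) \<longlongrightarrow> 1 / (1 - 0) ^ 16 - 1 + 16 * 0) (at_right 0)"
    by (intro tendsto_intros) auto
  then have "\<forall>\<^sub>F \<eta> in at_right (0::real). 1 / (1 - \<eta>) ^ 16 - 1 + 16 * \<eta> < \<zeta> * \<zeta>"
    by (rule order_tendstoD) (use \<zeta> in simp)
  then obtain b :: real where b: "0 < b" "\<And>\<eta>. 0 < \<eta> \<Longrightarrow> \<eta> < b \<Longrightarrow> 1 / (1 - \<eta>) ^ 16 - 1 + 16 * \<eta> < \<zeta> * \<zeta>"
    unfolding eventually_at_right_field by blast
  \<comment> \<open>A bite may multiply the weights by 4, hence \<open>\<eta>1 / 4\<close>. Below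
    \<open>b\<close> the variance bound \<open>err\<close> is less than
    \<open>\<zeta> * \<zeta>\<close>, so the overload costs at most
    \<open>2 * \<zeta> = \<delta> / 2\<close> per element.\<close>
  define \<eta> where "\<eta> = Min {b / 2, \<eta>1 / 4, 1/2}"
  have eta: "0 < \<eta>" "\<eta> < b" "\<eta> \<le> \<eta>1 / 4" "\<eta> \<le> 1/2" using b(1) \<eta>1(1) by (auto simp: \<eta>_def)
  have "\<exists>J. linear_triples.packing I ed J \<and> (\<epsilon> * (1 - 3 * \<epsilon>) + \<theta> * (1 - \<epsilon>)) * sum w I - \<delta> * card E \<le> card J"
    if a: "linear_triples E I ed" "\<forall>i\<in>I. 0 \<le> w i \<and> w i \<le> \<eta>" "\<forall>e\<in>E. linear_triples.load I ed w e \<le> 1"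
    for E :: "'e set" and I :: "'i set" and ed w
  proof -
    interpret linear_triples E I ed by (rule a(1))
    interpret nibble E I ed w \<eta> \<epsilon>
      by unfold_locales (use a(2,3) eta eps in auto)
    obtain J w' where J: "packing J" "\<And>i. i \<in> I \<Longrightarrow> 0 \<le> w' i" "\<And>i. i \<in> I \<Longrightarrow> w' i \<le> 4 * \<eta>"
      "\<And>e. e \<in> E \<Longrightarrow> load w' e \<le> 1"
      "\<And>i j. i \<in> I \<Longrightarrow> w' i \<noteq> 0 \<Longrightarrow> j \<in> J \<Longrightarrow> ed i \<inter> ed j = {}"
      "(\<epsilon> * (1 - 3 * \<epsilon>) + \<theta> * (1 - \<epsilon>)) * sum w I - (\<zeta> + err / \<zeta>) * card E \<le> card J + \<theta> * sum w' I"
      using nibble_step[OF \<zeta> \<theta>] by metis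
    define I' where "I' = {i\<in>I. w' i \<noteq> 0}"
    have sub: "I' \<subseteq> I" by (auto simp: I'_def)
    have lt': "linear_triples E I' ed" by (rule linear_triples_subset[OF a(1) sub])
    have load': "linear_triples.load I' ed w' e = load w' e" for e
      unfolding load_def linear_triples.load_def[OF lt'] unfolding I'_def
      by (rule sum.mono_neutral_left) (auto simp: finite_I)
    have sum': "sum w' I' = sum w' I" unfolding I'_def by (rule sum.mono_neutral_left) (auto simp: finite_I)
    have "\<exists>J'. linear_triples.packing I' ed J' \<and> \<theta> * sum w' I' - \<delta> / 2 * card E \<le> card J'"
      using J(2-4) sub eta(3) by (intro \<eta>1(2) lt') (force simp: load')+
    then obtain J' where J': "linear_triples.packing I' ed J'" "\<theta> * sum w' I - \<delta> / 2 * card E \<le> card J'"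
      by (auto simp: sum')
    have J'sub: "J' \<subseteq> I'" using J'(1) by (simp add: linear_triples.packing_def[OF lt'])
    have J'I: "i \<in> I" "w' i \<noteq> 0" if "i \<in> J'" for i using that J'sub by (auto simp: I'_def)
    have "ed i \<inter> ed j = {}" if ij: "i \<in> J \<union> J'" "j \<in> J \<union> J'" "i \<noteq> j" for i j
    proof -
      consider "i \<in> J" "j \<in> J" | "i \<in> J'" "j \<in> J'" | "i \<in> J'" "j \<in> J" | "i \<in> J" "j \<in> J'"
        using ij by blast
      then show ?thesis
      proof cases
        case 1 then show ?thesis using J(1) ij(3) by (simp add: packing_def)
      next
        case 2 then show ?thesis using J'(1) ij(3) by (simp add: linear_triples.packing_def[OF lt'])
      next
        case 3 then show ?thesis using J(5) J'I by blast
      next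
        case 4 then show ?thesis using J(5)[of j i] J'I[of j] by blast
      qed
    qed
    moreover have "J \<union> J' \<subseteq> I" using J(1) J'I(1) by (auto simp: packing_def)
    ultimately have "packing (J \<union> J')" unfolding packing_def by blast
    moreover have "J \<inter> J' = {}"
    proof (rule ccontr)
      assume "J \<inter> J' \<noteq> {}"
      then obtain i where "i \<in> J" "i \<in> I" "w' i \<noteq> 0" using J'sub by (auto simp: I'_def)
      then show False using J(5)[of i i] card_ed[of i] by auto
    qed
    then have "card (J \<union> J') = card J + card J'"
      using J(1) J'sub sub finite_I by (intro card_Un_disjoint) (auto simp: packing_def intro: finite_subset)
    moreover have "(\<zeta> + err / \<zeta>) * card E \<le> \<delta> / 2 * card E"
    proof (rule mult_right_mono)
      have "err < \<zeta> * \<zeta>" using b(2) eta by (simp add: err_def)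
      then have "err / \<zeta> < \<zeta>" using \<zeta> by (simp add: divide_less_eq)
      then show "\<zeta> + err / \<zeta> \<le> \<delta> / 2" by (simp add: \<zeta>_def)
    qed simp
    ultimately show ?thesis using J(6) J'(2) by (intro exI[of _ "J \<union> J'"]) auto
  qed
  then show "\<exists>\<eta>>0 :: real. \<forall>(E :: 'e set) (I :: 'i set) ed w. linear_triples E I ed \<longrightarrow>
     (\<forall>i\<in>I. 0 \<le> w i \<and> w i \<le> \<eta>) \<longrightarrow> (\<forall>e\<in>E. linear_triples.load I ed w e \<le> 1) \<longrightarrow>
     (\<exists>J. linear_triples.packing I ed J \<and> (\<epsilon> * (1 - 3 * \<epsilon>) + \<theta> * (1 - \<epsilon>)) * sum w I - \<delta> * card E \<le> card J)"
    using eta(1) by blast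
qed

text \<open>The new ratio in \<open>packs_ratio_step\<close> is affine in \<open>\<theta>\<close>,
  with slope \<open>1 - \<epsilon>\<close> and fixed point \<open>1 - 3 * \<epsilon>\<close>; this
  gives the closed form of the iterates started at 0.\<close>

lemma packs_ratio_near_1:
  assumes \<epsilon>: "0 < \<epsilon>" "\<epsilon> \<le> 1/3"
  shows "packs_ratio TYPE('e) TYPE('i) (1 - 4 * \<epsilon>)"
proof -
  have "packs_ratio TYPE('e) TYPE('i) ((1 - 3 * \<epsilon>) * (1 - (1 - \<epsilon>) ^ k))" for k
  proof (induction k)
    case 0 show ?case using packs_ratio_0 by simp
  next
    case (Suc k)
    have "0 \<le> (1 - 3 * \<epsilon>) * (1 - (1 - \<epsilon>) ^ k)" using \<epsilon> by (intro mult_nonneg_nonneg) (auto simp: power_le_one)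
    moreover have "(1 - 3 * \<epsilon>) * (1 - (1 - \<epsilon>) ^ k) \<le> 1" using \<epsilon> by (intro mult_le_one) (auto simp: power_le_one)
    ultimately have "packs_ratio TYPE('e) TYPE('i) (\<epsilon> * (1 - 3 * \<epsilon>) + (1 - 3 * \<epsilon>) * (1 - (1 - \<epsilon>) ^ k) * (1 - \<epsilon>))"
      using Suc \<epsilon> by (intro packs_ratio_step) auto
    then show ?case by (simp add: algebra_simps)
  qed
  moreover obtain k where k: "(1 - \<epsilon>) ^ k < \<epsilon>" using real_arch_pow_inv[of \<epsilon> "1 - \<epsilon>"] \<epsilon> by auto
  moreover have "1 - 4 * \<epsilon> \<le> (1 - 3 * \<epsilon>) * (1 - (1 - \<epsilon>) ^ k)"
  proof -
    have "(1 - 3 * \<epsilon>) * (1 - \<epsilon>) \<le> (1 - 3 * \<epsilon>) * (1 - (1 - \<epsilon>) ^ k)"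
      using k \<epsilon> by (intro mult_left_mono) auto
    moreover have "1 - 4 * \<epsilon> \<le> (1 - 3 * \<epsilon>) * (1 - \<epsilon>)" by (simp add: algebra_simps)
    ultimately show ?thesis by linarith
  qed
  ultimately show ?thesis using packs_ratio_mono by blast
qed

theorem linear_triples_packing:
  fixes \<delta> :: real
  assumes \<delta>: "0 < \<delta>"
  shows "\<exists>\<eta>>0 :: real. \<forall>(E :: 'e set) (I :: 'i set) ed w. linear_triples E I ed \<longrightarrow>
     (\<forall>i\<in>I. 0 \<le> w i \<and> w i \<le> \<eta>) \<longrightarrow>
     (\<exists>J. linear_triples.packing I ed J \<and>
       sum w I - (\<Sum>e\<in>E. max 0 (linear_triples.load I ed w e - 1)) - \<delta> * card E \<le> card J)"
proof -
  define \<epsilon> where "\<epsilon> = min (1/3) (\<delta> / 4)"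
  have \<epsilon>: "0 < \<epsilon>" "\<epsilon> \<le> 1/3" "\<epsilon> \<le> \<delta> / 4" using \<delta> by (auto simp: \<epsilon>_def)
  obtain \<eta> where \<eta>: "\<eta> > 0" "\<And>(E :: 'e set) (I :: 'i set) ed w. linear_triples E I ed \<Longrightarrow>
     (\<forall>i\<in>I. 0 \<le> w i \<and> w i \<le> \<eta>) \<Longrightarrow> (\<forall>e\<in>E. linear_triples.load I ed w e \<le> 1) \<Longrightarrow>
     (\<exists>J. linear_triples.packing I ed J \<and> (1 - 4 * \<epsilon>) * sum w I - \<delta> / 2 * card E \<le> card J)"
    using packs_ratio_near_1[OF \<epsilon>(1,2), where ?'e = 'e and ?'i = 'i, unfolded packs_ratio_def, rule_format, of "\<delta> / 2"] \<delta> by auto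
  have "\<exists>J. linear_triples.packing I ed J \<and>
       sum w I - (\<Sum>e\<in>E. max 0 (linear_triples.load I ed w e - 1)) - \<delta> * card E \<le> card J"
    if lt: "linear_triples E I ed" and w: "\<forall>i\<in>I. 0 \<le> w i \<and> w i \<le> \<eta>"
    for E :: "'e set" and I :: "'i set" and ed w
  proof -
    interpret linear_triples E I ed by (rule lt)
    obtain w' where w': "\<And>i. i \<in> I \<Longrightarrow> 0 \<le> w' i" "\<And>i. i \<in> I \<Longrightarrow> w' i \<le> w i"
      "\<And>e. e \<in> E \<Longrightarrow> load w' e \<le> 1"
      "sum w' I \<ge> sum w I - (\<Sum>e\<in>E. max 0 (load w e - 1))"
      using trim[of w] w by blast
    have "\<exists>J. packing J \<and> (1 - 4 * \<epsilon>) * sum w' I - \<delta> / 2 * card E \<le> card J"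
      using w w' by (intro \<eta>(2) lt) force+
    then obtain J where J: "packing J" "(1 - 4 * \<epsilon>) * sum w' I - \<delta> / 2 * card E \<le> card J" by blast
    \<comment> \<open>The total weight is at most \<open>card E / 3\<close>, so the lost fraction
      \<open>4 * \<epsilon>\<close> disappears in the additive error.\<close>
    have "3 * sum w' I \<le> (\<Sum>e\<in>E. 1)" unfolding sum_load[symmetric] using w'(3) by (rule sum_mono)
    then have "4 * \<epsilon> * sum w' I \<le> \<delta> * (card E / 3)"
      using \<epsilon> w'(1) by (intro mult_mono) (auto intro: sum_nonneg)
    moreover have "\<delta> * (card E / 3) \<le> \<delta> / 2 * card E" using \<delta> by simp
    ultimately show ?thesis using J w'(4) by (intro exI[of _ J]) (auto simp: algebra_simps)
  qed
  then show ?thesis using \<eta>(1) by blast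
qed

section \<open>Graphs as parities of triples\<close>

definition par :: "'a set list \<Rightarrow> 'a \<Rightarrow> 'a \<Rightarrow> bool" where
  "par Ys u v \<longleftrightarrow> odd (length (filter (\<lambda>X. u \<in> X \<and> v \<in> X) Ys))"

lemma par_Nil [simp]: "\<not> par [] u v"
  and par_append [simp]: "par (Ys @ Zs) u v \<longleftrightarrow> par Ys u v \<noteq> par Zs u v"
  by (auto simp: par_def)

text \<open>Lists with repetitions make symmetric differences into concatenations. Diagonal pairs
  are left free because no arc is a loop, and the cost is real because halves occur.\<close>

definition realizes :: "'a set \<Rightarrow> ('a \<Rightarrow> 'a \<Rightarrow> bool) \<Rightarrow> real \<Rightarrow> bool" where
  "realizes V G k \<longleftrightarrow> (\<exists>Ys. real (length Ys) \<le> k \<and> (\<forall>X\<in>set Ys. X \<subseteq> V \<and> card X \<le> 3) \<and>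
     (\<forall>u v. u \<noteq> v \<longrightarrow> par Ys u v = G u v))"

lemma realizes_empty: "realizes V (\<lambda>u v. False) 0"
  unfolding realizes_def by (intro exI[of _ "[]"]) simp

lemma realizes_single:
  "X \<subseteq> V \<Longrightarrow> card X \<le> 3 \<Longrightarrow> realizes V (\<lambda>u v. u \<in> X \<and> v \<in> X) 1"
  unfolding realizes_def by (intro exI[of _ "[X]"]) (auto simp: par_def)

lemma realizes_xor:
  assumes "realizes V G k" "realizes V H l"
  shows "realizes V (\<lambda>u v. G u v \<noteq> H u v) (k + l)"
proof -
  obtain Ys Zs where
    "real (length Ys) \<le> k" "\<forall>X\<in>set Ys. X \<subseteq> V \<and> card X \<le> 3" "\<forall>u v. u \<noteq> v \<longrightarrow> par Ys u v = G u v"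
    "real (length Zs) \<le> l" "\<forall>X\<in>set Zs. X \<subseteq> V \<and> card X \<le> 3" "\<forall>u v. u \<noteq> v \<longrightarrow> par Zs u v = H u v"
    using assms unfolding realizes_def by metis
  then show ?thesis unfolding realizes_def by (intro exI[of _ "Ys @ Zs"]) auto
qed

lemma realizes_cong:
  assumes "realizes V G k" "\<And>u v. u \<noteq> v \<Longrightarrow> G u v = H u v" "k \<le> l"
  shows "realizes V H l"
  using assms unfolding realizes_def by (smt (verit))

lemma realizes_sum:
  assumes "finite I" "\<And>i. i \<in> I \<Longrightarrow> realizes V (G i) (k i)"
  shows "realizes V (\<lambda>u v. odd (card {i\<in>I. G i u v})) (\<Sum>i\<in>I. k i)"
  using assms
proof (induction I rule: finite_induct)
  case empty
  then show ?case using realizes_empty by simp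
next
  case (insert i I)
  have "odd (card {j\<in>insert i I. G j u v}) \<longleftrightarrow> G i u v \<noteq> odd (card {j\<in>I. G j u v})" for u v
  proof (cases "G i u v")
    case True
    then have "{j\<in>insert i I. G j u v} = insert i {j\<in>I. G j u v}" by auto
    then show ?thesis using True insert.hyps by simp
  next
    case False
    then have "{j\<in>insert i I. G j u v} = {j\<in>I. G j u v}" by auto
    then show ?thesis using False by simp
  qed
  then show ?case
    using realizes_xor[of V "G i" "k i" "\<lambda>u v. odd (card {j\<in>I. G j u v})" "\<Sum>i\<in>I. k i"] insert
    by simp
qed

text \<open>The leaves are paired off and each pair is joined with \<open>x\<close> to a triple; an
  odd leaf gets a two-element set. The edges this creates between leaves are not controlled, so
  \<open>G\<close> is not prescribed inside \<open>N\<close>.\<close>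

lemma realizes_star:
  assumes "finite N" "N \<subseteq> V" "x \<in> V" "x \<notin> N"
  shows "\<exists>G. realizes V G ((card N + 1) / 2) \<and> (\<forall>u v. G u v = G v u) \<and>
    (\<forall>u v. u \<noteq> v \<longrightarrow> \<not> (u \<in> N \<and> v \<in> N) \<longrightarrow> G u v = (u = x \<and> v \<in> N \<or> v = x \<and> u \<in> N))"
  using assms
proof (induction "card N" arbitrary: N rule: less_induct)
  case less
  consider "N = {}" | y where "N = {y}" | y z N' where "N = insert y (insert z N')" "y \<noteq> z" "y \<notin> N'" "z \<notin> N'"
    by (metis insertCI mk_disjoint_insert equals0I)
  then show ?case
  proof cases
    case 1
    then show ?thesis
      using realizes_cong[OF realizes_empty, of "\<lambda>u v. False" "1/2" V] by (intro exI[of _ "\<lambda>u v. False"]) auto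
  next
    case 2
    have "realizes V (\<lambda>u v. u \<in> {x, y} \<and> v \<in> {x, y}) 1"
      using less 2 by (intro realizes_single) (auto simp: card_insert_if)
    then show ?thesis using 2 less by (intro exI[of _ "\<lambda>u v. u \<in> {x, y} \<and> v \<in> {x, y}"]) auto
  next
    case 3
    have fin: "finite N'" and card: "card N = card N' + 2" using less 3 by auto
    obtain G where G: "realizes V G ((card N' + 1) / 2)" "\<And>u v. G u v = G v u"
      "\<And>u v. u \<noteq> v \<Longrightarrow> \<not> (u \<in> N' \<and> v \<in> N') \<Longrightarrow> G u v = (u = x \<and> v \<in> N' \<or> v = x \<and> u \<in> N')"
      using less.hyps[of N'] less.prems 3 card fin by auto
    have T: "realizes V (\<lambda>u v. u \<in> {x, y, z} \<and> v \<in> {x, y, z}) 1"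
      using less.prems 3 by (intro realizes_single) (auto simp: card_insert_if)
    have "realizes V (\<lambda>u v. G u v \<noteq> (u \<in> {x, y, z} \<and> v \<in> {x, y, z})) ((card N + 1) / 2)"
      using realizes_xor[OF G(1) T] card by (simp add: field_simps)
    moreover have "(G u v \<noteq> (u \<in> {x, y, z} \<and> v \<in> {x, y, z})) = (u = x \<and> v \<in> N \<or> v = x \<and> u \<in> N)"
      if uv: "u \<noteq> v" "\<not> (u \<in> N \<and> v \<in> N)" for u v
    proof -
      have "\<not> (u \<in> N' \<and> v \<in> N')" using uv 3 by auto
      from G(3)[OF uv(1) this] show ?thesis using uv 3 less.prems by auto
    qed
    ultimately show ?thesis using G(2)
      by (intro exI[of _ "\<lambda>u v. G u v \<noteq> (u \<in> {x, y, z} \<and> v \<in> {x, y, z})"]) auto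
  qed
qed

text \<open>Cherries \<open>v - u - v'\<close> with \<open>v, v'\<close> in the same class of \<open>h\<close> cost one triple for two edges;
  the third edges all lie inside the classes and are repaired one by one.\<close>

lemma realizes_by_classes:
  fixes V :: "'a :: linorder set"
  assumes fin: "finite V" and B: "B \<subseteq> V \<times> V" and irr: "\<And>u. (u, u) \<notin> B"
    and asym: "\<And>u v. (u, v) \<in> B \<Longrightarrow> (v, u) \<notin> B"
    and cls: "\<And>u. u \<in> V \<Longrightarrow> card {v\<in>V. h v = h u} \<le> m"
  shows "realizes V (\<lambda>u v. (u, v) \<in> B \<or> (v, u) \<in> B) (card B / 2 + card V * card (h ` V) / 2 + card V * m)"
proof -
  define N where "N = (\<lambda>(x, g). {v. (x, v) \<in> B \<and> h v = g \<and> h x \<noteq> g})"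
  have finB: "finite B" using finite_subset[OF B] fin by simp
  have N: "N p \<subseteq> V" "finite (N p)" "fst p \<notin> N p" for p
  proof -
    show "N p \<subseteq> V" using B by (auto simp: N_def split: prod.splits)
    then show "finite (N p)" using fin finite_subset by blast
    show "fst p \<notin> N p" using irr by (auto simp: N_def split: prod.splits)
  qed
  define I where "I = V \<times> h ` V"
  have finI: "finite I" using fin by (simp add: I_def)
  have "\<exists>G. realizes V G ((card (N p) + 1) / 2) \<and> (\<forall>u v. G u v = G v u) \<and>
    (\<forall>u v. u \<noteq> v \<longrightarrow> \<not> (u \<in> N p \<and> v \<in> N p) \<longrightarrow> G u v = (u = fst p \<and> v \<in> N p \<or> v = fst p \<and> u \<in> N p))"
    if "p \<in> I" for p
    using that N by (intro realizes_star) (auto simp: I_def)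
  then obtain G where G: "\<And>p. p \<in> I \<Longrightarrow> realizes V (G p) ((card (N p) + 1) / 2)"
    "\<And>p u v. p \<in> I \<Longrightarrow> G p u v = G p v u"
    "\<And>p u v. p \<in> I \<Longrightarrow> u \<noteq> v \<Longrightarrow> \<not> (u \<in> N p \<and> v \<in> N p) \<Longrightarrow>
       G p u v = (u = fst p \<and> v \<in> N p \<or> v = fst p \<and> u \<in> N p)"
    by metis
  define H where "H u v \<longleftrightarrow> odd (card {p\<in>I. G p u v})" for u v
  have H: "realizes V H (\<Sum>p\<in>I. (card (N p) + 1) / 2)"
    unfolding H_def using realizes_sum[OF finI G(1)] .
  have Hsym: "H u v = H v u" for u v
  proof -
    have "{p\<in>I. G p u v} = {p\<in>I. G p v u}" using G(2) by blast
    then show ?thesis by (simp add: H_def)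
  qed
  have Hcross: "H u v = ((u, v) \<in> B \<or> (v, u) \<in> B)" if "h u \<noteq> h v" for u v
  proof -
    have "\<not> (u \<in> N p \<and> v \<in> N p)" for p using that by (auto simp: N_def split: prod.splits)
    then have "G p u v = (u = fst p \<and> v \<in> N p \<or> v = fst p \<and> u \<in> N p)" if "p \<in> I" for p
      using G(3)[OF that, of u v] \<open>h u \<noteq> h v\<close> by auto
    then have "{p\<in>I. G p u v} = {p\<in>I. u = fst p \<and> v \<in> N p \<or> v = fst p \<and> u \<in> N p}" by blast
    also have "\<dots> = (if (u, v) \<in> B then {(u, h v)} else if (v, u) \<in> B then {(v, h u)} else {})"
      using that B asym[of u v] by (auto simp: N_def I_def)
    finally show ?thesis by (simp add: H_def)
  qed
  \<comment> \<open>Besides undoing stray third edges, \<open>M\<close> supplies the edges of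
    \<open>B\<close> inside a class, which \<open>N\<close> leaves out.\<close>
  define M where "M u v \<longleftrightarrow> u \<in> V \<and> v \<in> V \<and> h u = h v \<and> H u v \<noteq> ((u, v) \<in> B \<or> (v, u) \<in> B)" for u v
  define E where "E = {(u, v) \<in> V \<times> V. u < v \<and> M u v}"
  have finE: "finite E" unfolding E_def using fin by (auto intro: finite_subset[of _ "V \<times> V"])
  have Msym: "M u v = M v u" for u v using Hsym[of u v] by (auto simp: M_def)
  have "realizes V (\<lambda>u v. odd (card {p\<in>E. u \<in> {fst p, snd p} \<and> v \<in> {fst p, snd p}})) (\<Sum>p\<in>E. 1)"
    by (intro realizes_sum finE realizes_single) (auto simp: E_def card_insert_if)
  then have M: "realizes V M (card E)"
  proof (rule realizes_cong)
    fix u v :: 'a assume "u \<noteq> v"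
    then have "{p\<in>E. u \<in> {fst p, snd p} \<and> v \<in> {fst p, snd p}} = {p\<in>E. p = (min u v, max u v)}"
      by (auto simp: E_def min_def max_def)
    also have "\<dots> = (if M u v then {(min u v, max u v)} else {})"
      using \<open>u \<noteq> v\<close> Msym[of u v] by (auto simp: E_def M_def min_def max_def)
    finally show "odd (card {p\<in>E. u \<in> {fst p, snd p} \<and> v \<in> {fst p, snd p}}) = M u v" by simp
  qed simp
  have "card E \<le> card (SIGMA u:V. {v\<in>V. h v = h u})"
    using fin by (intro card_mono) (auto simp: E_def M_def)
  also have "\<dots> = (\<Sum>u\<in>V. card {v\<in>V. h v = h u})" using fin by simp
  also have "\<dots> \<le> (\<Sum>u\<in>V. m)" by (intro sum_mono cls)
  finally have cardE: "real (card E) \<le> card V * m" by (simp flip: of_nat_mult)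
  have "(\<Sum>p\<in>I. card (N p)) \<le> card B"
  proof -
    have "(\<Sum>p\<in>I. card (N p)) = card (SIGMA p:I. N p)" using finI N(2) by simp
    also have "\<dots> = card ((\<lambda>(p, v). (fst p, v)) ` (SIGMA p:I. N p))"
      by (intro card_image[symmetric]) (auto simp: inj_on_def N_def I_def)
    also have "\<dots> \<le> card B" by (intro card_mono finB) (auto simp: N_def)
    finally show ?thesis .
  qed
  then have "(\<Sum>p\<in>I. (real (card (N p)) + 1) / 2) \<le> card B / 2 + card V * card (h ` V) / 2"
    by (simp add: I_def card_cartesian_product add_divide_distrib sum.distrib flip: sum_divide_distrib of_nat_sum)
  then have tot: "(\<Sum>p\<in>I. real (card (N p) + 1) / 2) + card E \<le> card B / 2 + card V * card (h ` V) / 2 + card V * m"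
    using cardE by (simp add: add.commute)
  show ?thesis
  proof (rule realizes_cong[OF realizes_xor[OF H M] _ tot])
    fix u v :: 'a assume "u \<noteq> v"
    show "(H u v \<noteq> M u v) = ((u, v) \<in> B \<or> (v, u) \<in> B)"
    proof (cases "h u = h v \<and> u \<in> V \<and> v \<in> V")
      case True then show ?thesis by (auto simp: M_def)
    next
      case False
      have "\<not> H u v" if "u \<notin> V \<or> v \<notin> V"
      proof -
        have "\<not> G p u v" if p: "p \<in> I" for p
        proof -
          have nin: "\<not> (u \<in> N p \<and> v \<in> N p)" "fst p \<in> V" using \<open>u \<notin> V \<or> v \<notin> V\<close> N(1)[of p] p by (auto simp: I_def)
          show ?thesis using G(3)[OF p \<open>u \<noteq> v\<close> nin(1)] nin(2) \<open>u \<notin> V \<or> v \<notin> V\<close> N(1)[of p] by auto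
        qed
        then have "{p\<in>I. G p u v} = {}" by blast
        then show ?thesis unfolding H_def by (metis card.empty even_zero)
      qed
      then show ?thesis using False Hcross[of u v] B by (auto simp: M_def)
    qed
  qed
qed

text \<open>Classes of constant size \<open>m \<ge> 1 / \<delta>\<close>: the rounding in the stars
  costs about \<open>n^2 / (2 m)\<close>, at most half of the allowance, and the repairs inside the
  classes are linear in \<open>n\<close>; \<open>n0\<close> makes the linear terms fit into the
  other half.\<close>

lemma realizes_half:
  fixes \<delta> :: real
  assumes "0 < \<delta>"
  shows "\<exists>n0. \<forall>(V :: 'a :: linorder set) B. finite V \<longrightarrow> n0 \<le> card V \<longrightarrow> B \<subseteq> V \<times> V \<longrightarrow>
    (\<forall>u. (u, u) \<notin> B) \<longrightarrow> (\<forall>u v. (u, v) \<in> B \<longrightarrow> (v, u) \<notin> B) \<longrightarrow>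
    realizes V (\<lambda>u v. (u, v) \<in> B \<or> (v, u) \<in> B) (card B / 2 + \<delta> * (card V)\<^sup>2)"
proof -
  define m where "m = nat \<lceil>1 / \<delta>\<rceil> + 1"
  define n0 where "n0 = nat \<lceil>(real m + 1/2) * 2 / \<delta>\<rceil>"
  have m: "0 < m" "1 / \<delta> \<le> m" by (auto simp: m_def) linarith
  have "realizes V (\<lambda>u v. (u, v) \<in> B \<or> (v, u) \<in> B) (card B / 2 + \<delta> * (card V)\<^sup>2)"
    if V: "finite V" "n0 \<le> card V" and B: "B \<subseteq> V \<times> V" "\<forall>u. (u, u) \<notin> B" "\<forall>u v. (u, v) \<in> B \<longrightarrow> (v, u) \<notin> B"
    for V :: "'a set" and B
  proof -
    define n where "n = card V"
    obtain f where f: "bij_betw f V {..<n}"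
      using V(1) by (metis atLeast0LessThan ex_bij_betw_finite_nat n_def)
    define h where "h v = f v div m" for v
    have cls: "card {v\<in>V. h v = h u} \<le> m" for u
    proof -
      have "card {v\<in>V. h v = h u} = card (f ` {v\<in>V. h v = h u})"
        using f by (intro card_image[symmetric]) (auto simp: bij_betw_def inj_on_def)
      also have "\<dots> \<le> card {h u * m ..< h u * m + m}"
      proof (intro card_mono image_subsetI)
        fix v assume "v \<in> {v\<in>V. h v = h u}"
        then have "f v div m = h u" by (simp add: h_def)
        then have "f v = h u * m + f v mod m" by (metis div_mult_mod_eq)
        moreover have "f v mod m < m" using m(1) by simp
        ultimately show "f v \<in> {h u * m ..< h u * m + m}" unfolding atLeastLessThan_iff by linarith
      qed simp
      finally show ?thesis by simp
    qed
    have "h ` V \<subseteq> {..n div m}"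
    proof (rule image_subsetI)
      fix v assume "v \<in> V"
      then have "f v < n" using bij_betwE[OF f] by blast
      then show "h v \<in> {..n div m}" by (simp add: h_def div_le_mono)
    qed
    then have "card (h ` V) \<le> n div m + 1" using card_mono[of "{..n div m}" "h ` V"] by simp
    moreover have "real (n div m) \<le> real n / m"
    proof -
      have "real (n div m) * real m \<le> real n"
        using div_times_less_eq_dividend[of n m] by (simp flip: of_nat_mult)
      then show ?thesis using m(1) by (simp add: pos_le_divide_eq)
    qed
    ultimately have "real (card (h ` V)) \<le> real n / m + 1" by linarith
    also have "\<dots> \<le> \<delta> * n + 1"
    proof -
      have "1 / real m \<le> \<delta>" using m assms by (simp add: field_simps)
      then have "real n * (1 / m) \<le> real n * \<delta>" by (intro mult_left_mono) auto
      then show ?thesis by (simp add: mult.commute)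
    qed
    finally have "real n * card (h ` V) \<le> n * (\<delta> * n + 1)" by (intro mult_left_mono) auto
    moreover have "(real m + 1/2) * n \<le> \<delta> / 2 * n * n"
    proof -
      have "(real m + 1/2) * 2 / \<delta> \<le> n" using V(2) unfolding n0_def n_def by linarith
      then have "real m + 1/2 \<le> \<delta> / 2 * n" using assms by (simp add: field_simps)
      then show ?thesis by (intro mult_right_mono) auto
    qed
    ultimately have "real (card B) / 2 + real n * card (h ` V) / 2 + n * m \<le> card B / 2 + \<delta> * n\<^sup>2"
      by (simp add: power2_eq_square algebra_simps)
    then have le: "real (card B) / 2 + real (card V * card (h ` V)) / 2 + real (card V * m) \<le> card B / 2 + \<delta> * (card V)\<^sup>2"
      by (simp add: n_def)
    have "realizes V (\<lambda>u v. (u, v) \<in> B \<or> (v, u) \<in> B)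
        (real (card B) / 2 + real (card V * card (h ` V)) / 2 + real (card V * m))"
      using B(2,3) by (intro realizes_by_classes V(1) B(1) cls) auto
    then show ?thesis using le by (rule realizes_cong[OF _ refl])
  qed
  then show ?thesis by blast
qed

definition arcs3 :: "'a \<times> 'a \<times> 'a \<Rightarrow> ('a \<times> 'a) set" where
  "arcs3 = (\<lambda>(x, y, z). {(x, y), (y, z), (x, z)})"

text \<open>A packed triangle settles three edges with one triple and the other edges cost a half
  each, which gives \<open>card J + (card B - 3 * card J) / 2\<close>.\<close>

lemma realizes_packing:
  fixes \<delta> :: real
  assumes "0 < \<delta>"
  shows "\<exists>n0. \<forall>(V :: 'a :: linorder set) B J. finite V \<longrightarrow> n0 \<le> card V \<longrightarrow> B \<subseteq> V \<times> V \<longrightarrow>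
    (\<forall>u. (u, u) \<notin> B) \<longrightarrow> (\<forall>u v. (u, v) \<in> B \<longrightarrow> (v, u) \<notin> B) \<longrightarrow>
    (\<forall>t\<in>J. arcs3 t \<subseteq> B) \<longrightarrow> (\<forall>t\<in>J. \<forall>t'\<in>J. t \<noteq> t' \<longrightarrow> arcs3 t \<inter> arcs3 t' = {}) \<longrightarrow>
    realizes V (\<lambda>u v. (u, v) \<in> B \<or> (v, u) \<in> B) ((real (card B) - card J) / 2 + \<delta> * (card V)\<^sup>2)"
proof -
  obtain n0 where n0: "\<forall>(V :: 'a set) B. finite V \<longrightarrow> n0 \<le> card V \<longrightarrow> B \<subseteq> V \<times> V \<longrightarrow>
    (\<forall>u. (u, u) \<notin> B) \<longrightarrow> (\<forall>u v. (u, v) \<in> B \<longrightarrow> (v, u) \<notin> B) \<longrightarrow>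
    realizes V (\<lambda>u v. (u, v) \<in> B \<or> (v, u) \<in> B) (card B / 2 + \<delta> * (card V)\<^sup>2)"
    using realizes_half[OF assms] ..
  have "realizes V (\<lambda>u v. (u, v) \<in> B \<or> (v, u) \<in> B) ((real (card B) - card J) / 2 + \<delta> * (card V)\<^sup>2)"
    if V: "finite V" "n0 \<le> card V" and B: "B \<subseteq> V \<times> V" "\<forall>u. (u, u) \<notin> B" "\<forall>u v. (u, v) \<in> B \<longrightarrow> (v, u) \<notin> B"
      and J: "\<forall>t\<in>J. arcs3 t \<subseteq> B" "\<forall>t\<in>J. \<forall>t'\<in>J. t \<noteq> t' \<longrightarrow> arcs3 t \<inter> arcs3 t' = {}"
    for V :: "'a set" and B J
  proof -
    define U where "U = (\<Union>t\<in>J. arcs3 t)"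
    have UB: "U \<subseteq> B" using J(1) by (auto simp: U_def)
    have finB: "finite B" using finite_subset[OF B(1)] V(1) by simp
    define tri :: "'a \<times> 'a \<times> 'a \<Rightarrow> 'a set" where "tri = (\<lambda>(x, y, z). {x, y, z})"
    have "J \<subseteq> V \<times> V \<times> V" using J(1) B(1) by (fastforce simp: arcs3_def)
    then have finJ: "finite J" using V(1) by (meson finite_SigmaI finite_subset)
    have card3: "card (arcs3 t) = 3" if "t \<in> J" for t
    proof -
      obtain x y z where t: "t = (x, y, z)" by (cases t)
      have "x \<noteq> y" "y \<noteq> z" using that J(1) B(2) t by (auto simp: arcs3_def)
      then show ?thesis by (auto simp: t arcs3_def card_insert_if)
    qed
    have "card U = (\<Sum>t\<in>J. card (arcs3 t))"
      unfolding U_def using finJ J(2) by (intro card_UN_disjoint) (auto simp: arcs3_def split: prod.splits)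
    then have cardU: "card U = 3 * card J" using card3 by simp
    have cardBU: "card (B - U) = card B - 3 * card J" "3 * card J \<le> card B"
      using card_Diff_subset[OF _ UB] card_mono[OF finB UB] finite_subset[OF UB finB] by (simp_all add: cardU)
    have rest: "realizes V (\<lambda>u v. (u, v) \<in> B - U \<or> (v, u) \<in> B - U) (card (B - U) / 2 + \<delta> * (card V)\<^sup>2)"
      by (rule n0[rule_format]) (use V B in auto)
    have "realizes V (\<lambda>u v. odd (card {t\<in>J. u \<in> tri t \<and> v \<in> tri t})) (\<Sum>t\<in>J. 1)"
    proof (intro realizes_sum finJ realizes_single)
      fix t assume "t \<in> J"
      then show "tri t \<subseteq> V" "card (tri t) \<le> 3"
        using \<open>J \<subseteq> V \<times> V \<times> V\<close> by (auto simp: tri_def card_insert_if split: prod.splits)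
    qed
    then have J3: "realizes V (\<lambda>u v. (u, v) \<in> U \<or> (v, u) \<in> U) (card J)"
    proof (rule realizes_cong)
      fix u v :: 'a assume uv: "u \<noteq> v"
      have tri: "u \<in> tri t \<and> v \<in> tri t \<longleftrightarrow> (u, v) \<in> arcs3 t \<or> (v, u) \<in> arcs3 t" for t
        using uv by (auto simp: tri_def arcs3_def split: prod.splits)
      have uniq: "t = t'" if "t \<in> J" "t' \<in> J" "(u, v) \<in> arcs3 t \<or> (v, u) \<in> arcs3 t" "(u, v) \<in> arcs3 t' \<or> (v, u) \<in> arcs3 t'" for t t'
      proof (rule ccontr)
        assume "t \<noteq> t'"
        then have "arcs3 t \<inter> arcs3 t' = {}" "arcs3 t \<subseteq> B" "arcs3 t' \<subseteq> B" using J that by auto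
        then show False using that(3,4) B(3) by blast
      qed
      show "odd (card {t\<in>J. u \<in> tri t \<and> v \<in> tri t}) = ((u, v) \<in> U \<or> (v, u) \<in> U)"
      proof (cases "\<exists>t\<in>J. (u, v) \<in> arcs3 t \<or> (v, u) \<in> arcs3 t")
        case True
        then obtain t where "t \<in> J" "(u, v) \<in> arcs3 t \<or> (v, u) \<in> arcs3 t" by blast
        then have "{t\<in>J. u \<in> tri t \<and> v \<in> tri t} = {t}" unfolding tri using uniq by blast
        then show ?thesis using True by (auto simp: U_def)
      next
        case False
        then have e: "{t\<in>J. u \<in> tri t \<and> v \<in> tri t} = {}" unfolding tri by blast
        show ?thesis unfolding e using False by (auto simp: U_def)
      qed
    qed simp
    show ?thesis
      by (rule realizes_cong[OF realizes_xor[OF rest J3]])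
        (use UB B(3) cardBU in \<open>auto simp: of_nat_diff field_simps\<close>)
  qed
  then show ?thesis by blast
qed

section \<open>Tournaments and the block recursion\<close>

definition flip :: "'a set list \<Rightarrow> ('a \<times> 'a) set \<Rightarrow> ('a \<times> 'a) set" where
  "flip Ys E = {(u, v). if par Ys u v then (v, u) \<in> E else (u, v) \<in> E}"

definition tournament :: "'a set \<Rightarrow> ('a \<times> 'a) set \<Rightarrow> bool" where
  "tournament V E \<longleftrightarrow> finite V \<and> E \<subseteq> V \<times> V \<and> E \<inter> E\<inverse> = {} \<and>
     (\<forall>u\<in>V. \<forall>v\<in>V. u \<noteq> v \<longrightarrow> (u, v) \<in> E \<union> E\<inverse>)"

definition solvable :: "'a set \<Rightarrow> ('a \<times> 'a) set \<Rightarrow> real \<Rightarrow> bool" where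
  "solvable V E k \<longleftrightarrow> (\<exists>Ys. real (length Ys) \<le> k \<and> (\<forall>X\<in>set Ys. X \<subseteq> V \<and> card X \<le> 3) \<and> acyclic (flip Ys E))"

lemma tournament_asym: "tournament V E \<Longrightarrow> (u, v) \<in> E \<Longrightarrow> (v, u) \<notin> E"
  unfolding tournament_def by blast

lemma tournament_irrefl: "tournament V E \<Longrightarrow> (u, u) \<notin> E"
  unfolding tournament_def by blast

lemma tournament_total: "tournament V E \<Longrightarrow> u \<in> V \<Longrightarrow> v \<in> V \<Longrightarrow> u \<noteq> v \<Longrightarrow> (u, v) \<in> E \<or> (v, u) \<in> E"
  unfolding tournament_def by blast

lemma tournament_arc: "tournament V E \<Longrightarrow> (u, v) \<in> E \<Longrightarrow> u \<in> V \<and> v \<in> V \<and> u \<noteq> v"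
  unfolding tournament_def by blast

lemma tournament_subset:
  assumes "tournament V E" "W \<subseteq> V"
  shows "tournament W (E \<inter> W \<times> W)"
  unfolding tournament_def
proof (intro conjI ballI impI)
  show "finite W" using assms finite_subset by (auto simp: tournament_def)
  show "(E \<inter> W \<times> W) \<inter> (E \<inter> W \<times> W)\<inverse> = {}" using tournament_asym[OF assms(1)] by blast
  show "(u, v) \<in> E \<inter> W \<times> W \<union> (E \<inter> W \<times> W)\<inverse>" if "u \<in> W" "v \<in> W" "u \<noteq> v" for u v
    using tournament_total[OF assms(1), of u v] that assms(2) by blast
qed simp

lemma inv_max_ge:
  assumes "oriented_graph (D :: nat pair_pre_digraph)"
  shows "inv_graph 3 D \<le> inv_max 3 (card (pverts D))"
  unfolding inv_max_def using assms
  by (intro Max_ge finite_inv_values) (auto simp: inv_values_def)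

lemma tournament_oriented:
  assumes "tournament V E"
  shows "oriented_graph \<lparr>pverts = V, parcs = E\<rparr>"
proof -
  have "finite E" using assms finite_subset[of E "V \<times> V"] by (simp add: tournament_def)
  then show ?thesis
    unfolding oriented_graph_def
    using assms tournament_asym[OF assms] tournament_irrefl[OF assms] tournament_arc[OF assms]
    by (intro conjI antisymI; (unfold_locales)?) (auto simp: tournament_def)
qed

lemma solvable_inv_max:
  fixes V :: "nat set"
  assumes "tournament V E"
  shows "solvable V E (inv_max 3 (card V))"
proof -
  let ?D = "\<lparr>pverts = V, parcs = E\<rparr> :: nat pair_pre_digraph"
  have D: "oriented_graph ?D" using assms by (rule tournament_oriented)
  obtain F where F: "decycling 3 ?D F" "card F = inv_graph 3 ?D"
    using inv_graph_attained[OF D] by (metis numeral_le_iff semiring_norm(69,72,73) one_le_numeral order_refl)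
  have finF: "finite F" using F(1) by (simp add: decycling_def)
  obtain Ys where Ys: "set Ys = F" "distinct Ys" using finite_distinct_list[OF finF] by blast
  have "par Ys u v = odd (card {X\<in>F. u \<in> X \<and> v \<in> X})" for u v
    using distinct_card[of "filter (\<lambda>X. u \<in> X \<and> v \<in> X) Ys"] Ys by (simp add: par_def)
  then have "flip Ys E = parcs (invert_all F ?D)"
    by (auto simp: flip_def parcs_invert_all_iff[OF finF] split: if_splits)
  then show ?thesis
    unfolding solvable_def using F inv_max_ge[OF D] Ys distinct_card[OF Ys(2)]
    by (intro exI[of _ Ys]) (auto simp: decycling_def)
qed

text \<open>Inverting the same set twice has no effect, so a list acts like the set of its members
  of odd multiplicity. This turns a solution by a list into a genuine decycling set.\<close>

lemma odd_count_filter: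
  "odd (card {X. odd (count_list Ys X) \<and> P X}) \<longleftrightarrow> odd (length (filter P Ys))"
proof (induction Ys)
  case (Cons Y Ys)
  let ?F = "{X. odd (count_list Ys X) \<and> P X}"
  have fin: "finite ?F"
    by (rule finite_subset[of _ "set Ys"]) (auto intro: ccontr simp: count_notin)
  show ?case
  proof (cases "P Y")
    case False
    then have "{X. odd (count_list (Y # Ys) X) \<and> P X} = ?F" by (auto split: if_splits)
    then show ?thesis using Cons False by simp
  next
    case True
    show ?thesis
    proof (cases "Y \<in> ?F")
      case True
      then have "{X. odd (count_list (Y # Ys) X) \<and> P X} = ?F - {Y}" by (auto split: if_splits)
      moreover have "card ?F = Suc (card (?F - {Y}))" using True fin by (metis card_Suc_Diff1)
      ultimately show ?thesis using Cons \<open>P Y\<close> by auto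
    next
      case False
      then have "{X. odd (count_list (Y # Ys) X) \<and> P X} = insert Y ?F" using \<open>P Y\<close> by (auto split: if_splits)
      then show ?thesis using Cons \<open>P Y\<close> False fin by simp
    qed
  qed
qed simp

lemma ex_worst_tournament:
  obtains V and E :: "(nat \<times> nat) set"
  where "tournament V E" "card V = n" "\<And>k. solvable V E k \<Longrightarrow> real (inv_max 3 n) \<le> k"
proof -
  have "inv_max 3 n \<in> inv_values 3 n"
    unfolding inv_max_def by (intro Max_in finite_inv_values inv_values_nonempty) simp
  then obtain D :: "nat pair_pre_digraph" where
    D: "oriented_graph D" "card (pverts D) = n" "inv_graph 3 D = inv_max 3 n"
    by (auto simp: inv_values_def)
  interpret pair_digraph D using D(1) by (simp add: oriented_graph_def)
  have as: "antisym (parcs D)" using D(1) by (simp add: oriented_graph_def)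
  define V where "V = pverts D"
  \<comment> \<open>Non-adjacent pairs are completed arbitrarily, here by the order of
    \<open>nat\<close>. This can only make the task harder, since the inverted \<open>D\<close>
    stays a subgraph of the inverted \<open>E\<close>.\<close>
  define E where "E = parcs D \<union> {(u, v) \<in> V \<times> V. u < v \<and> (u, v) \<notin> parcs D \<and> (v, u) \<notin> parcs D}"
  have "tournament V E"
    unfolding tournament_def
  proof (intro conjI ballI impI)
    show "finite V" using pair_finite_verts by (simp add: V_def)
    show "E \<subseteq> V \<times> V" by (auto simp: E_def V_def dest: in_arcsD1 in_arcsD2)
    show "E \<inter> E\<inverse> = {}"
      using antisymD[OF as] pair_no_loops by (fastforce simp: E_def)
    show "(u, v) \<in> E \<union> E\<inverse>" if "u \<in> V" "v \<in> V" "u \<noteq> v" for u v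
      using that by (cases u v rule: linorder_cases) (auto simp: E_def)
  qed
  moreover have "real (inv_max 3 n) \<le> k" if "solvable V E k" for k
  proof -
    obtain Ys where Ys: "real (length Ys) \<le> k" "\<And>X. X \<in> set Ys \<Longrightarrow> X \<subseteq> V \<and> card X \<le> 3" "acyclic (flip Ys E)"
      using \<open>solvable V E k\<close> by (auto simp: solvable_def)
    define F where "F = {X. odd (count_list Ys X)}"
    have sub: "F \<subseteq> set Ys" by (auto simp: F_def intro: ccontr simp: count_notin)
    then have fin: "finite F" using finite_subset by blast
    have "{X\<in>F. u \<in> X \<and> v \<in> X} = {X. odd (count_list Ys X) \<and> u \<in> X \<and> v \<in> X}" for u v
      by (auto simp: F_def)
    then have par: "par Ys u v = odd (card {X\<in>F. u \<in> X \<and> v \<in> X})" for u v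
      using odd_count_filter[of Ys "\<lambda>X. u \<in> X \<and> v \<in> X"] by (simp add: par_def)
    have "parcs (invert_all F D) \<subseteq> flip Ys E"
      by (auto simp: flip_def parcs_invert_all_iff[OF fin] par E_def split: if_splits)
    then have "acyclic (parcs (invert_all F D))" using Ys(3) acyclic_subset by blast
    then have "decycling 3 D F" using fin sub Ys(2) by (auto simp: decycling_def V_def)
    then have "inv_graph 3 D \<le> card F" by (rule inv_graph_le)
    also have "\<dots> \<le> length Ys" using card_mono[OF _ sub] card_length[of Ys] by fastforce
    finally show ?thesis using Ys(1) D(3) by linarith
  qed
  ultimately show thesis using that D(2) V_def by blast
qed

lemma inv_max_le_square: "inv_max 3 n \<le> n * n"
proof -
  have "inv_max 3 n \<in> inv_values 3 n"
    unfolding inv_max_def by (intro Max_in finite_inv_values inv_values_nonempty) simp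
  then obtain D :: "nat pair_pre_digraph" where
    D: "oriented_graph D" "card (pverts D) = n" "inv_graph 3 D = inv_max 3 n"
    by (auto simp: inv_values_def)
  obtain F where "decycling 3 D F" "card F \<le> card (pverts D) * card (pverts D)"
    using ex_decycling[OF D(1), of 3] by auto
  then show ?thesis using inv_graph_le[of 3 D F] D by simp
qed

text \<open>Sets inside one block change no arc elsewhere, so the solutions of the blocks can be
  concatenated without disturbing each other.\<close>

lemma solvable_blocks:
  fixes V :: "nat set" and p :: "nat \<Rightarrow> nat"
  assumes T: "tournament V E"
  shows "\<exists>Zs. real (length Zs) \<le> (\<Sum>i<r. real (inv_max 3 (card {v\<in>V. p v = i}))) \<and>
    (\<forall>X\<in>set Zs. X \<subseteq> V \<and> card X \<le> 3) \<and> (\<forall>u v. par Zs u v \<longrightarrow> p u = p v \<and> p u < r) \<and>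
    (\<forall>i<r. acyclic {(u, v) \<in> flip Zs E. p u = i \<and> p v = i})"
proof (induction r)
  case 0
  show ?case by (intro exI[of _ "[]"]) simp
next
  case (Suc r)
  then obtain Zs where Z: "real (length Zs) \<le> (\<Sum>i<r. real (inv_max 3 (card {v\<in>V. p v = i}))) \<and>
    (\<forall>X\<in>set Zs. X \<subseteq> V \<and> card X \<le> 3) \<and> (\<forall>u v. par Zs u v \<longrightarrow> p u = p v \<and> p u < r) \<and>
    (\<forall>i<r. acyclic {(u, v) \<in> flip Zs E. p u = i \<and> p v = i})"
    ..
  note Zs = Z[THEN conjunct1] Z[THEN conjunct2, THEN conjunct1]
    Z[THEN conjunct2, THEN conjunct2, THEN conjunct1] Z[THEN conjunct2, THEN conjunct2, THEN conjunct2]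
  define W where "W = {v\<in>V. p v = r}"
  have "tournament W (E \<inter> W \<times> W)" by (rule tournament_subset[OF T]) (simp add: W_def)
  then obtain Ys where Ys: "real (length Ys) \<le> inv_max 3 (card W)"
    "\<forall>X\<in>set Ys. X \<subseteq> W \<and> card X \<le> 3" "acyclic (flip Ys (E \<inter> W \<times> W))"
    using solvable_inv_max[of W] unfolding solvable_def by meson
  have parYs: "u \<in> W \<and> v \<in> W" if "par Ys u v" for u v
  proof -
    have "filter (\<lambda>X. u \<in> X \<and> v \<in> X) Ys \<noteq> []" using that by (auto simp: par_def)
    then show ?thesis using Ys(2) by (auto simp: filter_empty_conv)
  qed
  have "acyclic {(u, v) \<in> flip (Zs @ Ys) E. p u = i \<and> p v = i}" if "i < Suc r" for i
  proof (cases "i = r")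
    case True
    have "{(u, v) \<in> flip (Zs @ Ys) E. p u = i \<and> p v = i} \<subseteq> flip Ys (E \<inter> W \<times> W)"
    proof (rule subrelI)
      fix u v assume uv: "(u, v) \<in> {(u, v) \<in> flip (Zs @ Ys) E. p u = i \<and> p v = i}"
      then have "\<not> par Zs u v" using Zs(3) True by auto
      then show "(u, v) \<in> flip Ys (E \<inter> W \<times> W)"
        using uv True tournament_arc[OF T] by (auto simp: flip_def W_def split: if_splits)
    qed
    then show ?thesis using Ys(3) acyclic_subset by blast
  next
    case False
    have "{(u, v) \<in> flip (Zs @ Ys) E. p u = i \<and> p v = i} \<subseteq> {(u, v) \<in> flip Zs E. p u = i \<and> p v = i}"
      using parYs False by (fastforce simp: flip_def W_def split: if_splits)
    moreover have "i < r" using False \<open>i < Suc r\<close> by simp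
    ultimately show ?thesis using Zs(4) acyclic_subset by meson
  qed
  moreover have "p u = p v \<and> p u < Suc r" if "par (Zs @ Ys) u v" for u v
    using that Zs(3)[rule_format, of u v] parYs[of u v] by (auto simp: W_def)
  moreover have "real (length (Zs @ Ys)) \<le> (\<Sum>i<Suc r. real (inv_max 3 (card {v\<in>V. p v = i})))"
    using Zs(1) Ys(1) by (simp add: W_def)
  moreover have "\<forall>X\<in>set (Zs @ Ys). X \<subseteq> V \<and> card X \<le> 3" using Zs(2) Ys(2) by (auto simp: W_def)
  ultimately show ?case by blast
qed

text \<open>Reversing exactly the backward arcs makes every arc between blocks ascend. A cycle would
  therefore stay inside one block, where the solution of that block excludes it.\<close>

lemma solvable_recursion:
  fixes V :: "nat set" and p :: "nat \<Rightarrow> nat"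
  assumes T: "tournament V E" and p: "\<And>v. v \<in> V \<Longrightarrow> p v < r"
    and B: "B = {(u, v) \<in> E. p v < p u}"
    and G: "realizes V (\<lambda>u v. (u, v) \<in> B \<or> (v, u) \<in> B) k"
  shows "solvable V E (k + (\<Sum>i<r. real (inv_max 3 (card {v\<in>V. p v = i}))))"
proof -
  obtain Ys where Ys: "real (length Ys) \<le> k" "\<forall>X\<in>set Ys. X \<subseteq> V \<and> card X \<le> 3"
    "\<And>u v. u \<noteq> v \<Longrightarrow> par Ys u v = ((u, v) \<in> B \<or> (v, u) \<in> B)"
    using G unfolding realizes_def by meson
  obtain Zs where Z: "real (length Zs) \<le> (\<Sum>i<r. real (inv_max 3 (card {v\<in>V. p v = i}))) \<and>
    (\<forall>X\<in>set Zs. X \<subseteq> V \<and> card X \<le> 3) \<and> (\<forall>u v. par Zs u v \<longrightarrow> p u = p v \<and> p u < r) \<and>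
    (\<forall>i<r. acyclic {(u, v) \<in> flip Zs E. p u = i \<and> p v = i})"
    using solvable_blocks[OF T, where r = r and p = p] ..
  note Zs = Z[THEN conjunct1] Z[THEN conjunct2, THEN conjunct1]
    Z[THEN conjunct2, THEN conjunct2, THEN conjunct1] Z[THEN conjunct2, THEN conjunct2, THEN conjunct2]
  define R where "R = flip (Ys @ Zs) E"
  have R: "p u < p v \<or> p u = p v \<and> (u, v) \<in> flip Zs E" if "(u, v) \<in> R" for u v
  proof -
    have uv: "u \<in> V" "v \<in> V" "u \<noteq> v" using that tournament_arc[OF T] by (auto simp: R_def flip_def split: if_splits)
    show ?thesis
      using that Ys(3)[OF uv(3)] Zs(3)[rule_format, of u v] tournament_total[OF T uv] tournament_asym[OF T, of u v]
      by (cases "p u = p v") (auto simp: R_def flip_def B split: if_splits)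
  qed
  have Rp: "p u < r" if "(u, v) \<in> R" for u v
    using that tournament_arc[OF T] p by (auto simp: R_def flip_def split: if_splits)
  have path: "p u < p v \<or> p u = p v \<and> (u, v) \<in> {(u, v) \<in> flip Zs E. p u = i \<and> p v = i}\<^sup>+"
    if "(u, v) \<in> R\<^sup>+" "p u = i" for u v i
    using that
  proof (induction rule: trancl_induct)
    case (base y)
    then show ?case using R[OF base(1)] by (auto intro: r_into_trancl)
  next
    case (step y z)
    from R[OF step.hyps(2)] step.IH[OF step.prems] step.prems show ?case
      by (auto intro: trancl_into_trancl)
  qed
  have "acyclic R"
  proof (rule acyclicI, intro allI notI)
    fix u assume u: "(u, u) \<in> R\<^sup>+"
    then obtain v where "(u, v) \<in> R" by (meson tranclD)
    then have "p u < r" by (rule Rp)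
    then show False using path[OF u refl] Zs(4)[rule_format, of "p u"] by (auto simp: acyclic_def)
  qed
  then show ?thesis
    unfolding solvable_def R_def using Ys(1,2) Zs(1,2) by (intro exI[of _ "Ys @ Zs"]) auto
qed

section \<open>Sums over the arcs of a tournament\<close>

text \<open>If all variables are 1 or -1, the three summands have product -1, hence are not all 1
  and add up to 1 or -3; the expression is affine in each variable, so its maximum is attained
  there. In \<open>sum_D_sq\<close> the variables are products over the three perfect matchings of
  four vertices, and each 4-cycle is the product of two of them.\<close>

lemma three_products_le_1:
  fixes p q s :: real
  assumes "\<bar>p\<bar> \<le> 1" "\<bar>q\<bar> \<le> 1" "\<bar>s\<bar> \<le> 1"
  shows "p * q - p * s + q * s \<le> 1"
proof (cases "p \<le> q")
  case True
  have "s * (q - p) \<le> 1 * (q - p)" using True assms by (intro mult_right_mono) auto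
  moreover have "0 \<le> (1 - q) * (1 + p)" using assms by (intro mult_nonneg_nonneg) auto
  ultimately show ?thesis by (simp add: algebra_simps)
next
  case False
  have "(- s) * (p - q) \<le> 1 * (p - q)" using False assms by (intro mult_right_mono) auto
  moreover have "0 \<le> (1 - p) * (1 + q)" using assms by (intro mult_nonneg_nonneg) auto
  ultimately show ?thesis by (simp add: algebra_simps)
qed

locale tourn =
  fixes V :: "'a set" and E :: "('a \<times> 'a) set"
  assumes T: "tournament V E" and nonempty: "V \<noteq> {}"
begin

definition n :: real where "n = card V"

definition A :: "'a \<Rightarrow> 'a \<Rightarrow> real" where
  "A u v = of_bool ((u, v) \<in> E) - of_bool ((v, u) \<in> E)"

definition R :: "'a \<Rightarrow> real" where "R u = (\<Sum>v\<in>V. A u v)"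

text \<open>The normalised Gram matrix of the rows of the skew matrix \<open>A\<close>: close to 1
  if \<open>u\<close> and \<open>v\<close> beat the same vertices, close to -1 if they beat opposite
  ones.\<close>

definition D :: "'a \<Rightarrow> 'a \<Rightarrow> real" where "D u v = (\<Sum>x\<in>V. A u x * A v x) / n"

lemma finV: "finite V" and E_sub: "E \<subseteq> V \<times> V" using T by (auto simp: tournament_def)

lemma finE: "finite E" using finite_subset[OF E_sub] finV by simp

lemma n_pos: "0 < n" using finV nonempty by (simp add: n_def card_gt_0_iff)

lemma A_skew: "A v u = - A u v" and A_diag [simp]: "A u u = 0" by (auto simp: A_def)

lemma A_arc: "(u, v) \<in> E \<Longrightarrow> A u v = 1" using tournament_asym[OF T] by (auto simp: A_def)

lemma A_sq: "u \<in> V \<Longrightarrow> v \<in> V \<Longrightarrow> A u v * A u v = of_bool (u \<noteq> v)"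
  using tournament_total[OF T, of u v] tournament_asym[OF T, of u v] by (auto simp: A_def)

lemma A_abs: "\<bar>A u v\<bar> \<le> 1" by (auto simp: A_def)

lemma E_ind: "u \<in> V \<Longrightarrow> v \<in> V \<Longrightarrow> of_bool ((u, v) \<in> E) = (of_bool (u \<noteq> v) + A u v) / 2"
  using tournament_total[OF T, of u v] tournament_asym[OF T, of u v] tournament_irrefl[OF T, of u]
  by (auto simp: A_def)

lemma sum_skew: "(\<Sum>u\<in>V. \<Sum>v\<in>V. A u v * F u v) = 0" if "\<And>u v. F u v = F v u" for F :: "'a \<Rightarrow> 'a \<Rightarrow> real"
proof -
  have "(\<Sum>u\<in>V. \<Sum>v\<in>V. A u v * F u v) = (\<Sum>u\<in>V. \<Sum>v\<in>V. A v u * F v u)" by (rule sum.swap)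
  also have "\<dots> = (\<Sum>u\<in>V. \<Sum>v\<in>V. - (A u v * F u v))"
  proof (intro sum.cong refl)
    fix u v show "A v u * F v u = - (A u v * F u v)" using A_skew[of u v] that[of u v] by simp
  qed
  finally show ?thesis by (simp add: sum_negf)
qed

text \<open>Off the diagonal the indicator of an arc is \<open>(1 + A u v) / 2\<close>. For
  symmetric \<open>F\<close> the part with \<open>A\<close> vanishes, for skew \<open>F\<close> the
  part without it.\<close>

lemma sum_arcs:
  fixes F :: "'a \<Rightarrow> 'a \<Rightarrow> real"
  shows "(\<Sum>(u, v)\<in>E. F u v)
    = ((\<Sum>u\<in>V. \<Sum>v\<in>V. F u v) - (\<Sum>u\<in>V. F u u) + (\<Sum>u\<in>V. \<Sum>v\<in>V. A u v * F u v)) / 2"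
proof -
  have "(\<Sum>(u, v)\<in>E. F u v) = (\<Sum>(u, v)\<in>V \<times> V. of_bool ((u, v) \<in> E) * F u v)"
    by (rule sum.mono_neutral_cong_left) (use finV E_sub in auto)
  also have "\<dots> = (\<Sum>u\<in>V. \<Sum>v\<in>V. of_bool ((u, v) \<in> E) * F u v)"
    by (simp add: sum.cartesian_product)
  also have "\<dots> = (\<Sum>u\<in>V. \<Sum>v\<in>V. (F u v - of_bool (u = v) * F u v + A u v * F u v) / 2)"
    by (intro sum.cong refl) (simp add: E_ind field_simps)
  also have "\<dots> = (\<Sum>u\<in>V. (\<Sum>v\<in>V. F u v) - F u u + (\<Sum>v\<in>V. A u v * F u v)) / 2"
    using finV by (simp add: sum.distrib sum_subtractf flip: sum_divide_distrib)
  finally show ?thesis by (simp add: sum.distrib sum_subtractf)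
qed

lemma sum_arcs_sym:
  fixes F :: "'a \<Rightarrow> 'a \<Rightarrow> real"
  assumes "\<And>u v. F u v = F v u"
  shows "(\<Sum>(u, v)\<in>E. F u v) = ((\<Sum>u\<in>V. \<Sum>v\<in>V. F u v) - (\<Sum>u\<in>V. F u u)) / 2"
  using sum_skew[of F] assms by (simp add: sum_arcs)

lemma sum_skew_zero:
  fixes F :: "'a \<Rightarrow> 'a \<Rightarrow> real"
  assumes "\<And>u v. F u v = - F v u"
  shows "(\<Sum>u\<in>V. \<Sum>v\<in>V. F u v) = (0::real)" "F u u = 0"
proof -
  have "(\<Sum>u\<in>V. \<Sum>v\<in>V. F u v) = (\<Sum>u\<in>V. \<Sum>v\<in>V. F v u)" by (rule sum.swap)
  also have "\<dots> = (\<Sum>u\<in>V. \<Sum>v\<in>V. - F u v)" by (intro sum.cong refl) (rule assms)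
  finally show "(\<Sum>u\<in>V. \<Sum>v\<in>V. F u v) = 0" by (simp add: sum_negf)
  from assms[of u u] show "F u u = 0" by linarith
qed

lemma sum_arcs_skew:
  fixes F :: "'a \<Rightarrow> 'a \<Rightarrow> real"
  assumes "\<And>u v. F u v = - F v u"
  shows "(\<Sum>(u, v)\<in>E. F u v) = (\<Sum>u\<in>V. \<Sum>v\<in>V. A u v * F u v) / 2"
proof -
  have "(\<Sum>u\<in>V. \<Sum>v\<in>V. F u v) = 0" "F u u = 0" for u
    by (rule sum_skew_zero, rule assms)+
  then show ?thesis by (simp add: sum_arcs)
qed

lemma card_E: "card E = n * (n - 1) / 2"
  using sum_arcs_sym[of "\<lambda>_ _. 1 :: real"] by (simp add: n_def algebra_simps)

definition R2 :: real where "R2 = (\<Sum>u\<in>V. (R u)\<^sup>2)"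

text \<open>The scaling by \<open>4 * n\<close> is the one in which the scores enter the relative
  number of common neighbours, see \<open>mean_load\<close>.\<close>

definition P :: "'a \<Rightarrow> 'a \<Rightarrow> real" where "P u v = (R u + R v) / (4 * n)"
definition Q :: "'a \<Rightarrow> 'a \<Rightarrow> real" where "Q u v = (R u - R v) / (4 * n)"

lemma sum_R: "(\<Sum>u\<in>V. R u) = 0"
  using sum_skew[of "\<lambda>_ _. 1 :: real"] by (simp add: R_def)

lemma sum_A_right: "(\<Sum>u\<in>V. A u x) = - R x"
  unfolding R_def by (subst sum_negf[symmetric], rule sum.cong[OF refl], rule A_skew)

lemma R_abs: "\<bar>R u\<bar> \<le> n"
proof -
  have "\<bar>R u\<bar> \<le> (\<Sum>v\<in>V. 1)" unfolding R_def
    by (rule order_trans[OF sum_abs]) (intro sum_mono A_abs)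
  then show ?thesis by (simp add: n_def)
qed

lemma R2_nonneg: "0 \<le> R2" unfolding R2_def by (simp add: sum_nonneg)

lemma D_commute: "D u v = D v u" by (simp add: D_def mult.commute)

lemma D_abs: "\<bar>D u v\<bar> \<le> 1"
proof -
  have "\<bar>\<Sum>x\<in>V. A u x * A v x\<bar> \<le> (\<Sum>x\<in>V. 1)"
    by (rule order_trans[OF sum_abs]) (intro sum_mono, simp add: abs_mult mult_le_one A_abs)
  then show ?thesis using n_pos by (simp add: D_def n_def divide_le_eq)
qed

lemma D_diag: "u \<in> V \<Longrightarrow> D u u = (n - 1) / n"
proof -
  assume u: "u \<in> V"
  have "(\<Sum>x\<in>V. A u x * A u x) = (\<Sum>x\<in>V. 1 - of_bool (x = u))"
    using u by (intro sum.cong refl) (auto simp: A_sq)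
  also have "\<dots> = n - 1" using u finV by (simp add: sum_subtractf n_def)
  finally show ?thesis by (simp add: D_def)
qed

lemma sum_D_right: "(\<Sum>v\<in>V. D u v) = - (\<Sum>x\<in>V. A u x * R x) / n"
proof -
  have "(\<Sum>v\<in>V. D u v) = (\<Sum>x\<in>V. A u x * (\<Sum>v\<in>V. A v x)) / n"
    unfolding D_def sum_divide_distrib[symmetric] by (subst sum.swap) (simp add: sum_distrib_left)
  then show ?thesis by (simp add: sum_A_right sum_negf)
qed

lemma sum_RAR: "(\<Sum>u\<in>V. R u * (\<Sum>x\<in>V. A u x * R x)) = 0"
proof -
  have "(\<Sum>u\<in>V. R u * (\<Sum>x\<in>V. A u x * R x)) = (\<Sum>u\<in>V. \<Sum>x\<in>V. A u x * (R u * R x))"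
    by (simp add: sum_distrib_left mult_ac)
  then show ?thesis using sum_skew[of "\<lambda>u x. R u * R x"] by (simp add: mult.commute)
qed

lemma sum_D: "(\<Sum>u\<in>V. \<Sum>v\<in>V. D u v) = R2 / n"
proof -
  have "(\<Sum>u\<in>V. \<Sum>v\<in>V. D u v) = - (\<Sum>u\<in>V. \<Sum>x\<in>V. A u x * R x) / n"
    by (simp add: sum_D_right sum_negf flip: sum_divide_distrib)
  also have "(\<Sum>u\<in>V. \<Sum>x\<in>V. A u x * R x) = (\<Sum>x\<in>V. (\<Sum>u\<in>V. A u x) * R x)"
    by (subst sum.swap) (simp add: sum_distrib_right)
  finally show ?thesis by (simp add: sum_A_right R2_def power2_eq_square sum_negf)
qed

lemma arcs_D: "(\<Sum>(u, v)\<in>E. D u v) = (R2 / n - (n - 1)) / 2"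
proof -
  have "(\<Sum>u\<in>V. D u u) = n - 1" using n_pos by (simp add: D_diag n_def)
  then show ?thesis using sum_arcs_sym[of D] D_commute by (simp add: sum_D)
qed

text \<open>Summing over the three 4-cycles on the same four vertices gains a factor 3
  over the trivial bound.\<close>

lemma sum_D_sq: "(\<Sum>u\<in>V. \<Sum>v\<in>V. (D u v)\<^sup>2) \<le> n\<^sup>2 / 3"
proof -
  let ?q = "\<lambda>u v x y. A u x * A v x * A u y * A v y"
  let ?S = "\<Sum>u\<in>V. \<Sum>v\<in>V. \<Sum>x\<in>V. \<Sum>y\<in>V. ?q u v x y"
  have D2: "(\<Sum>u\<in>V. \<Sum>v\<in>V. (D u v)\<^sup>2) = ?S / n\<^sup>2"
    by (simp add: D_def power_divide power2_eq_square[of "sum _ _"] sum_product mult.assoc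
        flip: sum_divide_distrib)
  have S2: "?S = (\<Sum>u\<in>V. \<Sum>v\<in>V. \<Sum>x\<in>V. \<Sum>y\<in>V. ?q u x v y)"
    by (rule sum.cong[OF refl], rule sum.swap)
  have S3: "?S = (\<Sum>u\<in>V. \<Sum>v\<in>V. \<Sum>x\<in>V. \<Sum>y\<in>V. ?q u y x v)"
  proof (rule sum.cong[OF refl])
    fix u
    have "(\<Sum>v\<in>V. \<Sum>x\<in>V. \<Sum>y\<in>V. ?q u v x y) = (\<Sum>v\<in>V. \<Sum>y\<in>V. \<Sum>x\<in>V. ?q u v x y)"
      by (intro sum.cong refl sum.swap)
    also have "\<dots> = (\<Sum>y\<in>V. \<Sum>v\<in>V. \<Sum>x\<in>V. ?q u v x y)" by (rule sum.swap)
    also have "\<dots> = (\<Sum>y\<in>V. \<Sum>x\<in>V. \<Sum>v\<in>V. ?q u v x y)" by (intro sum.cong refl sum.swap)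
    finally show "(\<Sum>v\<in>V. \<Sum>x\<in>V. \<Sum>y\<in>V. ?q u v x y) = (\<Sum>v\<in>V. \<Sum>x\<in>V. \<Sum>y\<in>V. ?q u y x v)" .
  qed
  have "?q u v x y + ?q u x v y + ?q u y x v \<le> 1" for u v x y
  proof -
    have "?q u v x y + ?q u x v y + ?q u y x v
        = (A v x * A u y) * (A u x * A v y) - (A v x * A u y) * (A u v * A x y) + (A u x * A v y) * (A u v * A x y)"
      using A_skew[of v x] A_skew[of x y] A_skew[of v y] by simp
    also have "\<dots> \<le> 1"
      by (intro three_products_le_1) (auto simp: abs_mult intro!: mult_le_one A_abs)
    finally show ?thesis .
  qed
  then have "(\<Sum>u\<in>V. \<Sum>v\<in>V. \<Sum>x\<in>V. \<Sum>y\<in>V. ?q u v x y + ?q u x v y + ?q u y x v)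
      \<le> (\<Sum>u\<in>V. \<Sum>v\<in>V. \<Sum>x\<in>V. \<Sum>y\<in>V. 1)" by (intro sum_mono)
  moreover have "(\<Sum>u\<in>V. \<Sum>v\<in>V. \<Sum>x\<in>V. \<Sum>y\<in>V. ?q u v x y + ?q u x v y + ?q u y x v) = 3 * ?S"
    unfolding sum.distrib S2[symmetric] S3[symmetric] by simp
  ultimately have "3 * ?S \<le> n ^ 4" by (simp add: n_def eval_nat_numeral)
  then show ?thesis unfolding D2 using n_pos
    by (simp add: divide_le_eq eval_nat_numeral)
qed

lemma arcs_D_sq: "(\<Sum>(u, v)\<in>E. (D u v)\<^sup>2) \<le> n\<^sup>2 / 6"
proof -
  have "0 \<le> (\<Sum>u\<in>V. (D u u)\<^sup>2)" by (simp add: sum_nonneg)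
  then show ?thesis using sum_arcs_sym[of "\<lambda>u v. (D u v)\<^sup>2"] D_commute sum_D_sq by simp
qed

lemma arcs_P: "(\<Sum>(u, v)\<in>E. P u v) = 0"
proof -
  have "(\<Sum>u\<in>V. \<Sum>v\<in>V. P u v) = 0" "(\<Sum>u\<in>V. P u u) = 0"
    by (simp_all add: P_def sum.distrib sum_R flip: sum_divide_distrib sum_distrib_left)
  then show ?thesis using sum_arcs_sym[of P] by (simp add: P_def add.commute)
qed

lemma sum_A_diff:
  "(\<Sum>u\<in>V. \<Sum>v\<in>V. A u v * (f u - f v)) = 2 * (\<Sum>u\<in>V. R u * f u)"
proof -
  have "(\<Sum>u\<in>V. \<Sum>v\<in>V. A u v * f v) = (\<Sum>v\<in>V. (\<Sum>u\<in>V. A u v) * f v)"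
    by (subst sum.swap) (simp add: sum_distrib_right)
  then show ?thesis
    by (simp add: right_diff_distrib sum_subtractf sum_A_right sum_negf R_def flip: sum_distrib_right)
qed

lemma arcs_Q: "(\<Sum>(u, v)\<in>E. Q u v) = R2 / (4 * n)"
proof -
  have "(\<Sum>u\<in>V. \<Sum>v\<in>V. A u v * Q u v) = (\<Sum>u\<in>V. \<Sum>v\<in>V. A u v * (R u - R v)) / (4 * n)"
    by (simp add: Q_def sum_divide_distrib)
  also have "\<dots> = 2 * R2 / (4 * n)" by (simp add: sum_A_diff R2_def power2_eq_square)
  finally show ?thesis using sum_arcs_skew[of Q] by (simp add: Q_def minus_divide_left)
qed

lemma sum_sq_pm:
  "(\<Sum>u\<in>V. \<Sum>v\<in>V. (R u + R v)\<^sup>2) = 2 * n * R2" "(\<Sum>u\<in>V. \<Sum>v\<in>V. (R u - R v)\<^sup>2) = 2 * n * R2"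
proof -
  have *: "(\<Sum>u\<in>V. \<Sum>v\<in>V. 2 * R u * R v) = 0"
    by (simp add: sum_R mult.assoc flip: sum_distrib_left)
  show "(\<Sum>u\<in>V. \<Sum>v\<in>V. (R u + R v)\<^sup>2) = 2 * n * R2"
    unfolding power2_sum sum.distrib * by (simp add: R2_def n_def flip: sum_distrib_left)
  show "(\<Sum>u\<in>V. \<Sum>v\<in>V. (R u - R v)\<^sup>2) = 2 * n * R2"
    unfolding power2_diff sum.distrib sum_subtractf * by (simp add: R2_def n_def flip: sum_distrib_left)
qed

lemma arcs_P_sq: "(\<Sum>(u, v)\<in>E. (P u v)\<^sup>2) \<le> R2 / (16 * n)"
proof -
  have "(\<Sum>u\<in>V. \<Sum>v\<in>V. (P u v)\<^sup>2) = 2 * n * R2 / (4 * n)\<^sup>2"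
    unfolding sum_sq_pm(1)[symmetric] by (simp add: P_def power_divide sum_divide_distrib)
  then have "(\<Sum>u\<in>V. \<Sum>v\<in>V. (P u v)\<^sup>2) / 2 = R2 / (16 * n)" using n_pos by (simp add: power2_eq_square)
  moreover have "0 \<le> (\<Sum>u\<in>V. (P u u)\<^sup>2)" by (simp add: sum_nonneg)
  ultimately show ?thesis using sum_arcs_sym[of "\<lambda>u v. (P u v)\<^sup>2"] by (simp add: P_def add.commute)
qed

lemma arcs_Q_sq: "(\<Sum>(u, v)\<in>E. (Q u v)\<^sup>2) \<le> R2 / (16 * n)"
proof -
  have "(\<Sum>u\<in>V. \<Sum>v\<in>V. (Q u v)\<^sup>2) = 2 * n * R2 / (4 * n)\<^sup>2"
    unfolding sum_sq_pm(2)[symmetric] by (simp add: Q_def power_divide sum_divide_distrib)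
  then have "(\<Sum>u\<in>V. \<Sum>v\<in>V. (Q u v)\<^sup>2) / 2 = R2 / (16 * n)" using n_pos by (simp add: power2_eq_square)
  moreover have "0 \<le> (\<Sum>u\<in>V. (Q u u)\<^sup>2)" by (simp add: sum_nonneg)
  ultimately show ?thesis using sum_arcs_sym[of "\<lambda>u v. (Q u v)\<^sup>2"] by (simp add: Q_def power_divide power2_commute)
qed

text \<open>Summing \<open>D\<close> over one argument gives \<open>- A R / n\<close>, and the
  quadratic form of the skew matrix \<open>A\<close> at \<open>R\<close> is 0.\<close>

lemma arcs_DP: "(\<Sum>(u, v)\<in>E. D u v * P u v) = 0"
proof -
  have 1: "(\<Sum>u\<in>V. \<Sum>v\<in>V. D u v * R u) = 0"
  proof -
    have "(\<Sum>u\<in>V. \<Sum>v\<in>V. D u v * R u) = (\<Sum>u\<in>V. (\<Sum>v\<in>V. D u v) * R u)" by (simp add: sum_distrib_right)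
    also have "\<dots> = - (\<Sum>u\<in>V. R u * (\<Sum>x\<in>V. A u x * R x)) / n"
      by (simp add: sum_D_right sum_negf mult.commute flip: sum_divide_distrib)
    finally show ?thesis by (simp add: sum_RAR)
  qed
  moreover have "(\<Sum>u\<in>V. \<Sum>v\<in>V. D u v * R v) = 0"
    using 1 by (subst sum.swap) (simp add: D_commute)
  ultimately have "(\<Sum>u\<in>V. \<Sum>v\<in>V. D u v * P u v) = 0"
    by (simp add: P_def distrib_left sum.distrib flip: sum_divide_distrib)
  moreover have "(\<Sum>u\<in>V. D u u * P u u) = (n - 1) / n * (\<Sum>u\<in>V. P u u)"
    by (simp add: D_diag sum_distrib_left)
  moreover have "(\<Sum>u\<in>V. P u u) = 0" by (simp add: P_def sum_R flip: sum_divide_distrib sum_distrib_left)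
  ultimately show ?thesis using sum_arcs_sym[of "\<lambda>u v. D u v * P u v"]
    by (simp add: D_commute P_def add.commute)
qed

text \<open>For fixed \<open>u\<close> the product \<open>A u v * A u x\<close> is symmetric in
  \<open>v\<close> and \<open>x\<close>, while \<open>A v x\<close> is skew.\<close>

lemma sum_AD: "(\<Sum>v\<in>V. A u v * D u v) = 0"
proof -
  have "(\<Sum>v\<in>V. A u v * D u v) = (\<Sum>v\<in>V. \<Sum>x\<in>V. A v x * (A u v * A u x)) / n"
    by (simp add: D_def sum_distrib_left sum_divide_distrib mult_ac)
  then show ?thesis using sum_skew[of "\<lambda>v x. A u v * A u x"] by (simp add: mult.commute)
qed

lemma arcs_DQ: "(\<Sum>(u, v)\<in>E. D u v * Q u v) = 0"
proof -
  have 1: "(\<Sum>u\<in>V. \<Sum>v\<in>V. A u v * D u v * R u) = 0"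
    by (simp add: sum_AD flip: sum_distrib_right)
  have "(\<Sum>u\<in>V. \<Sum>v\<in>V. A u v * D u v * R v) = (\<Sum>u\<in>V. \<Sum>v\<in>V. A v u * D v u * R u)" by (rule sum.swap)
  also have "\<dots> = (\<Sum>u\<in>V. \<Sum>v\<in>V. - (A u v * D u v * R u))"
  proof (intro sum.cong refl)
    fix u v show "A v u * D v u * R u = - (A u v * D u v * R u)" using A_skew[of u v] D_commute[of u v] by simp
  qed
  finally have 2: "(\<Sum>u\<in>V. \<Sum>v\<in>V. A u v * D u v * R v) = 0" using 1 by (simp add: sum_negf)
  have "(\<Sum>u\<in>V. \<Sum>v\<in>V. A u v * (D u v * Q u v))
      = ((\<Sum>u\<in>V. \<Sum>v\<in>V. A u v * D u v * R u) - (\<Sum>u\<in>V. \<Sum>v\<in>V. A u v * D u v * R v)) / (4 * n)"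
    by (simp add: Q_def algebra_simps diff_divide_distrib sum_subtractf sum_divide_distrib)
  then have "(\<Sum>u\<in>V. \<Sum>v\<in>V. A u v * (D u v * Q u v)) = 0" by (simp add: 1 2)
  then show ?thesis using sum_arcs_skew[of "\<lambda>u v. D u v * Q u v"]
    by (simp add: D_commute Q_def minus_divide_left flip: mult_minus_right)
qed

end

section \<open>Triangle weights on 24 blocks\<close>

text \<open>A numerically found certificate. A triangle of backward arcs whose consecutive blocks are \<open>p\<close> and \<open>q\<close>
  apart gets weight \<open>wt p q / n\<close>, and \<open>kernel_table\<close> lists \<open>wt p q\<close> for \<open>p \<le> q\<close> by rows \<open>p\<close> and columns \<open>q - p\<close>.
  The other two tables, in units of 1/96, are the parameters \<open>s\<close> and \<open>m\<close> of the quadratic bound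
  \<open>overload_le\<close> for arcs that span \<open>d\<close> blocks. The polynomials \<open>term0\<close> and \<open>term1\<close> are the
  constant and the linear coefficient in \<open>X\<close> of the resulting saving, cleared of denominators
  (see \<open>gain_scaled\<close>).\<close>

definition kernel_table :: "int list list" where
  "kernel_table =
  [[0, 0, 0, 0, 1, 7, 3, 6, 7, 7, 7, 7, 7, 7, 6, 3, 7, 1, 0, 0, 0, 0],
   [0, 0, 2, 6, 6, 5, 5, 5, 5, 5, 5, 5, 5, 5, 6, 6, 2, 0, 0, 0],
   [0, 4, 6, 5, 6, 5, 5, 5, 5, 5, 5, 6, 4, 6, 4, 0, 0, 0],
   [8, 4, 2, 3, 2, 2, 2, 2, 2, 3, 2, 4, 8, 4, 2, 0],
   [2, 1, 2, 2, 2, 2, 2, 2, 1, 2, 4, 6, 6, 1],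
   [1, 2, 1, 1, 1, 2, 2, 1, 2, 4, 6, 7],
   [2, 2, 2, 2, 2, 2, 3, 6, 5, 3],
   [2, 2, 1, 2, 2, 5, 5, 6],
   [1, 2, 2, 5, 5, 7],
   [2, 5, 5, 7],
   [5, 7]]"

definition slope_table :: "int list" where
  "slope_table = [76, 73, 71, 27, 16, 13, 15, 10, 8, 4, 4, 1, -4, -4, -10, -10, -16, -20, -22, -32, -70, -73, -76]"

definition margin_table :: "int list" where
  "margin_table = [49, 48, 48, 20, 13, 11, 15, 13, 11, 11, 11, 11, 11, 11, 14, 14, 17, 19, 20, 26, 49, 49, 49]"

definition wt :: "nat \<Rightarrow> nat \<Rightarrow> int" where
  "wt p q = (if 0 < p \<and> 0 < q \<and> p + q < 24 then kernel_table ! (min p q - 1) ! (max p q - min p q) else 0)"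

definition sl :: "nat \<Rightarrow> int" where "sl d = slope_table ! (d - 1)"
definition mg :: "nat \<Rightarrow> int" where "mg d = margin_table ! (d - 1)"

definition outer :: "nat \<Rightarrow> nat \<Rightarrow> int" where "outer d k = sum_list (map (wt d) [1..<Suc k])"
definition inner :: "nat \<Rightarrow> int" where "inner d = sum_list (map (\<lambda>p. wt p (d - p)) [1..<d])"

definition qt :: "int \<Rightarrow> int \<Rightarrow> int \<Rightarrow> int \<Rightarrow> int \<Rightarrow> int" where
  "qt a b c s m = max (2 * (a + b) - 96 - s) (2 * c - 96 + s) + m"

definition term0 :: "int \<Rightarrow> int \<Rightarrow> int \<Rightarrow> int \<Rightarrow> int \<Rightarrow> int" where
  "term0 a b c s m = 4 * m * (a + b + c) - s * s - 3 * (qt a b c s m * qt a b c s m)"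

definition term1 :: "int \<Rightarrow> int \<Rightarrow> int \<Rightarrow> int \<Rightarrow> int \<Rightarrow> int" where
  "term1 a b c s m = 32 * m * (a + b + c) - 48 * ((a - b) * (a - b) + c * c)
     - 48 * s * qt a b c s m - 96 * qt a b c s m * c"

definition row_sum :: "(int \<Rightarrow> int \<Rightarrow> int \<Rightarrow> int \<Rightarrow> int \<Rightarrow> int) \<Rightarrow> nat \<Rightarrow> int" where
  "row_sum f d = sum_list (map (\<lambda>i. f (outer d (23 - i - d)) (outer d i) (inner d) (sl d) (mg d)) [0..<24 - d])"

lemma row_sum_term0: "map (row_sum term0) [1..<24] = [151731, 149864, 146220, 70160, 45087, 41142, 81039, 69520, 56715, 53606, 49777, 45780, 42119, 38290, 42012, 37344, 37667, 23142, 17840, 18000, 21699, 13902, 6597]"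
  by code_simp

lemma row_sum_term1: "map (row_sum term1) [1..<24] = [-3879488, -2671680, -2273616, -715712, -436480, -263424, -1158144, -1193600, -1298304, -1298944, -1232192, -1121856, -1198144, -1112192, -1031424, -990080, -816768, -664224, -600640, -569344, -608160, -464864, -263872]"
  by code_simp

lemma row_sum_skew: "\<forall>d\<in>set [1..<24]. row_sum (\<lambda>a b c s m. (b - a) * c) d = 0"
  by code_simp

lemma mg_pos: "\<forall>d\<in>set [1..<24]. 0 < mg d"
  by code_simp

lemma wt_range: "\<forall>p\<in>set [0..<24]. \<forall>q\<in>set [0..<24]. 0 \<le> wt p q \<and> wt p q \<le> 8"
  by code_simp

section \<open>Nearly balanced scores and the cost of an arc\<close>

text \<open>Summation by parts; because \<open>c\<close> decreases, upper bounds on the prefix sums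
  of \<open>f\<close> are enough.\<close>

lemma abel_bound:
  fixes f c :: "nat \<Rightarrow> real"
  assumes "\<And>k. k \<le> N \<Longrightarrow> (\<Sum>i<k. f i) \<le> t" "\<And>i. Suc i < N \<Longrightarrow> c (Suc i) \<le> c i" "0 < N"
  shows "(\<Sum>i<N. f i * c i) \<le> (\<Sum>i<N. f i) * c (N - 1) + t * (c 0 - c (N - 1))"
  using assms
proof (induction N)
  case (Suc N)
  show ?case
  proof (cases "N = 0")
    case False
    have "(\<Sum>i<N. f i * c i) \<le> (\<Sum>i<N. f i) * c (N - 1) + t * (c 0 - c (N - 1))"
      using Suc False by (intro Suc.IH) auto
    moreover have "(\<Sum>i<N. f i) * (c (N - 1) - c N) \<le> t * (c (N - 1) - c N)"
      using Suc.prems(1)[of N] Suc.prems(2)[of "N - 1"] False by (intro mult_right_mono) auto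
    ultimately show ?thesis by (simp add: algebra_simps)
  qed simp
qed simp

lemma sum_arith_squares: "(\<Sum>i<N. (real N - 1 - 2 * real i)\<^sup>2) = real N * ((real N)\<^sup>2 - 1) / 3"
proof -
  have "(\<Sum>i<k. (x - 2 * real i)\<^sup>2) = k * x\<^sup>2 - 2 * x * (k * (real k - 1)) + 2 * real k * (real k - 1) * (2 * real k - 1) / 3" for k x
    by (induction k) (auto simp: power2_eq_square field_simps)
  from this[of "real N - 1" N] show ?thesis by (simp add: power2_eq_square field_simps)
qed

lemma sum_arith: "(\<Sum>i<k. real N - 1 - 2 * real i) = real k * (real N - real k)"
  by (induction k) (auto simp: algebra_simps)

text \<open>Prefix sums of the sorted values are compared with those of the arithmetic progression
  \<open>\<kappa> (n - 1 - 2 i)\<close>, for which the hypothesis holds with equality.\<close>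

lemma sum_squares_of_cut_bound:
  fixes R :: "'a \<Rightarrow> real" and \<kappa> t :: real
  assumes fin: "finite V" and ne: "V \<noteq> {}" and \<kappa>: "0 \<le> \<kappa>" and t: "0 \<le> t"
    and cut: "\<And>P. P \<subseteq> V \<Longrightarrow> sum R P \<le> \<kappa> * card P * (real (card V) - card P) + t"
    and zero: "sum R V = 0" and bound: "\<And>v. v \<in> V \<Longrightarrow> \<bar>R v\<bar> \<le> card V"
  shows "(\<Sum>v\<in>V. (R v)\<^sup>2) \<le> \<kappa>\<^sup>2 * (card V) ^ 3 / 3 + 2 * t * (1 + \<kappa>) * card V"
proof -
  define N where "N = card V"
  have N: "0 < N" using fin ne by (simp add: N_def card_gt_0_iff)
  obtain ys where ys: "set ys = V" "distinct ys" using finite_distinct_list[OF fin] by blast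
  define xs where "xs = sort_key (\<lambda>v. - R v) ys"
  have xs: "set xs = V" "distinct xs" "length xs = N" "sorted (map (\<lambda>v. - R v) xs)"
    using ys distinct_card[OF ys(2)] by (auto simp: xs_def N_def)
  define a where "a i = R (xs ! i)" for i
  have inj: "inj_on ((!) xs) {..<k}" if "k \<le> N" for k
    using xs that by (auto simp: inj_on_def nth_eq_iff_index_eq)
  have img: "(!) xs ` {..<N} = V" using xs by (auto simp: set_conv_nth)
  have sum_xs: "(\<Sum>i<N. g (xs ! i)) = (\<Sum>v\<in>V. g v)" for g :: "'a \<Rightarrow> real"
    using sum.reindex[OF inj[OF order_refl], of g] img by simp
  define b where "b i = \<kappa> * (real N - 1 - 2 * real i)" for i
  have sb: "(\<Sum>i<k. b i) = \<kappa> * k * (real N - k)" for k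
    by (simp add: b_def sum_arith flip: sum_distrib_left)
  have pre: "(\<Sum>i<k. a i - b i) \<le> t" if "k \<le> N" for k
  proof -
    have "sum R ((!) xs ` {..<k}) = (\<Sum>i<k. a i)" using inj[OF that] by (simp add: sum.reindex a_def)
    moreover have "card ((!) xs ` {..<k}) = k" using inj[OF that] by (simp add: card_image)
    moreover have "(!) xs ` {..<k} \<subseteq> V" using img that by auto
    ultimately show ?thesis using cut[of "(!) xs ` {..<k}"] by (simp add: sum_subtractf sb N_def)
  qed
  have dec_a: "a (Suc i) \<le> a i" if "Suc i < N" for i
    using sorted_nth_mono[OF xs(4), of i "Suc i"] that xs(3) by (simp add: a_def)
  have dec_b: "b (Suc i) \<le> b i" for i using \<kappa> by (simp add: b_def mult_left_mono)
  have tot: "(\<Sum>i<N. a i - b i) = 0"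
    using sum_xs[of R] zero sb[of N] by (simp add: sum_subtractf a_def)
  have "(\<Sum>i<N. (a i - b i) * a i) \<le> t * (a 0 - a (N - 1))"
    using abel_bound[of N "\<lambda>i. a i - b i" t a] pre dec_a N tot by simp
  also have "\<dots> \<le> t * (2 * N)"
    using bound[of "xs ! 0"] bound[of "xs ! (N - 1)"] xs N t
    by (intro mult_left_mono) (auto simp: a_def N_def[symmetric] abs_le_iff)
  finally have 1: "(\<Sum>i<N. (a i - b i) * a i) \<le> t * (2 * N)" .
  have "(\<Sum>i<N. (a i - b i) * b i) \<le> t * (b 0 - b (N - 1))"
    using abel_bound[of N "\<lambda>i. a i - b i" t b] pre dec_b N tot by simp
  also have "\<dots> \<le> t * (2 * \<kappa> * N)"
    using t \<kappa> N by (intro mult_left_mono) (auto simp: b_def algebra_simps of_nat_diff)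
  finally have 2: "(\<Sum>i<N. (a i - b i) * b i) \<le> t * (2 * \<kappa> * N)" .
  have "(\<Sum>v\<in>V. (R v)\<^sup>2) = (\<Sum>i<N. (a i)\<^sup>2)" using sum_xs[of "\<lambda>v. (R v)\<^sup>2"] by (simp add: a_def)
  \<comment> \<open>The identity is \<open>a^2 = b^2 + (a - b) a + (a - b) b\<close>. Both sequences
    decrease, so \<open>abel_bound\<close> handles each correction.\<close>
  also have "\<dots> = (\<Sum>i<N. (b i)\<^sup>2) + (\<Sum>i<N. (a i - b i) * a i) + (\<Sum>i<N. (a i - b i) * b i)"
    unfolding sum.distrib[symmetric] by (intro sum.cong refl) (simp add: power2_eq_square algebra_simps)
  also have "(\<Sum>i<N. (b i)\<^sup>2) = \<kappa>\<^sup>2 * (N * ((real N)\<^sup>2 - 1) / 3)"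
    by (simp only: b_def power_mult_distrib sum_distrib_left[symmetric] sum_arith_squares)
  also have "\<kappa>\<^sup>2 * (N * ((real N)\<^sup>2 - 1) / 3) \<le> \<kappa>\<^sup>2 * N ^ 3 / 3"
  proof -
    have "N * ((real N)\<^sup>2 - 1) / 3 \<le> N ^ 3 / 3" by (simp add: power2_eq_square power3_eq_cube algebra_simps)
    from mult_left_mono[OF this, of "\<kappa>\<^sup>2"] show ?thesis by simp
  qed
  finally show ?thesis using 1 2 by (simp add: N_def algebra_simps)
qed

lemma positive_part_le:
  fixes x m :: real
  assumes "0 < m"
  shows "max 0 x \<le> (x + m)\<^sup>2 / (4 * m)"
proof -
  have "x * (4 * m) \<le> (x + m)\<^sup>2" using zero_le_power2[of "x - m"] by (simp add: power2_eq_square algebra_simps)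
  then show ?thesis using assms by (simp add: pos_le_divide_eq)
qed

section \<open>A quadratic majorant for the cost of the arcs\<close>

context tourn begin

lemma arcs_linear:
  "(\<Sum>(u, v)\<in>E. a + b * D u v + c * P u v + d * Q u v)
    = a * (n * (n - 1) / 2) + b * ((R2 / n - (n - 1)) / 2) + d * (R2 / (4 * n))"
proof -
  have "(\<Sum>(u, v)\<in>E. a + b * D u v + c * P u v + d * Q u v)
      = a * card E + b * (\<Sum>(u, v)\<in>E. D u v) + c * (\<Sum>(u, v)\<in>E. P u v) + d * (\<Sum>(u, v)\<in>E. Q u v)"
    by (simp add: case_prod_unfold sum.distrib sum_distrib_left)
  then show ?thesis by (simp add: arcs_D arcs_P arcs_Q card_E)
qed

text \<open>The mixed moments of \<open>D\<close> with \<open>P\<close> and \<open>Q\<close> vanish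
  and the others are controlled by \<open>n\<close> and \<open>R2\<close>. Only the sum of
  \<open>P * Q\<close>, in essence the third moment of the scores, stays open. The last term absorbs
  a lower-order term of unknown sign.\<close>

lemma arcs_square:
  "(\<Sum>(u, v)\<in>E. (s * D u v + q + (d * P u v + g * Q u v))\<^sup>2)
    \<le> s\<^sup>2 * n\<^sup>2 / 6 + q\<^sup>2 * n\<^sup>2 / 2 + (d\<^sup>2 + g\<^sup>2) * R2 / (16 * n) + s * q * R2 / n + q * g * R2 / (2 * n)
      + 2 * d * g * (\<Sum>(u, v)\<in>E. P u v * Q u v) + \<bar>s * q\<bar> * n"
proof -
  have "(\<Sum>(u, v)\<in>E. (s * D u v + q + (d * P u v + g * Q u v))\<^sup>2)
    = s\<^sup>2 * (\<Sum>(u, v)\<in>E. (D u v)\<^sup>2) + d\<^sup>2 * (\<Sum>(u, v)\<in>E. (P u v)\<^sup>2) + g\<^sup>2 * (\<Sum>(u, v)\<in>E. (Q u v)\<^sup>2)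
      + (\<Sum>(u, v)\<in>E. q\<^sup>2 + 2 * s * q * D u v + 2 * q * d * P u v + 2 * q * g * Q u v)
      + 2 * s * d * (\<Sum>(u, v)\<in>E. D u v * P u v) + 2 * s * g * (\<Sum>(u, v)\<in>E. D u v * Q u v)
      + 2 * d * g * (\<Sum>(u, v)\<in>E. P u v * Q u v)"
    unfolding sum_distrib_left sum.distrib[symmetric]
    by (intro sum.cong refl) (auto simp: power2_eq_square algebra_simps)
  also have "\<dots> = s\<^sup>2 * (\<Sum>(u, v)\<in>E. (D u v)\<^sup>2) + d\<^sup>2 * (\<Sum>(u, v)\<in>E. (P u v)\<^sup>2) + g\<^sup>2 * (\<Sum>(u, v)\<in>E. (Q u v)\<^sup>2)
      + (q\<^sup>2 * (n * (n - 1) / 2) + 2 * s * q * ((R2 / n - (n - 1)) / 2) + 2 * q * g * (R2 / (4 * n)))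
      + 2 * d * g * (\<Sum>(u, v)\<in>E. P u v * Q u v)"
    unfolding arcs_linear arcs_DP arcs_DQ by simp
  also have "\<dots> \<le> s\<^sup>2 * (n\<^sup>2 / 6) + d\<^sup>2 * (R2 / (16 * n)) + g\<^sup>2 * (R2 / (16 * n))
      + (q\<^sup>2 * (n\<^sup>2 / 2) + (s * q * (R2 / n) + \<bar>s * q\<bar> * n) + 2 * q * g * (R2 / (4 * n)))
      + 2 * d * g * (\<Sum>(u, v)\<in>E. P u v * Q u v)"
  proof -
    have "n * (n - 1) / 2 \<le> n\<^sup>2 / 2" using n_pos by (simp add: power2_eq_square)
    then have "q\<^sup>2 * (n * (n - 1) / 2) \<le> q\<^sup>2 * (n\<^sup>2 / 2)" by (intro mult_left_mono) auto
    moreover have n1: "0 \<le> n - 1" using n_pos by (simp add: n_def)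
    have "- (s * q) * (n - 1) \<le> \<bar>s * q\<bar> * n" using n1 by (intro mult_mono) auto
    then have "2 * s * q * ((R2 / n - (n - 1)) / 2) \<le> s * q * (R2 / n) + \<bar>s * q\<bar> * n"
      by (simp add: algebra_simps)
    moreover have "s\<^sup>2 * (\<Sum>(u, v)\<in>E. (D u v)\<^sup>2) \<le> s\<^sup>2 * (n\<^sup>2 / 6)"
      "d\<^sup>2 * (\<Sum>(u, v)\<in>E. (P u v)\<^sup>2) \<le> d\<^sup>2 * (R2 / (16 * n))"
      "g\<^sup>2 * (\<Sum>(u, v)\<in>E. (Q u v)\<^sup>2) \<le> g\<^sup>2 * (R2 / (16 * n))"
      by (intro mult_left_mono arcs_D_sq arcs_P_sq arcs_Q_sq; simp)+
    ultimately show ?thesis by linarith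
  qed
  finally show ?thesis by (simp add: algebra_simps add_divide_distrib)
qed

text \<open>The expected load of an arc, up to \<open>O(1/n)\<close>; see \<open>mean_load\<close>.\<close>

definition L :: "real \<Rightarrow> real \<Rightarrow> real \<Rightarrow> 'a \<Rightarrow> 'a \<Rightarrow> real" where
  "L \<alpha> \<beta> \<gamma> u v = (\<alpha> + \<beta> + \<gamma>) / 4 + (\<alpha> + \<beta> - \<gamma>) / 4 * D u v + ((\<beta> - \<alpha>) * P u v + \<gamma> * Q u v)"

text \<open>Apart from \<open>P\<close> and \<open>Q\<close>, the load interpolates linearly in
  \<open>D\<close> between \<open>\<gamma> / 2\<close> at \<open>D = -1\<close> and
  \<open>(\<alpha> + \<beta>) / 2\<close> at \<open>D = 1\<close>. The line \<open>t + s D\<close>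
  dominates the excess over 1 as soon as it does so at both ends. The square makes the sum over all
  arcs accessible to second moments.\<close>

lemma overload_le:
  assumes "0 < m" "t + s \<ge> (\<alpha> + \<beta>) / 2 - 1" "t - s \<ge> \<gamma> / 2 - 1"
  shows "max 0 (L \<alpha> \<beta> \<gamma> u v - 1) \<le> (s * D u v + (t + m) + ((\<beta> - \<alpha>) * P u v + \<gamma> * Q u v))\<^sup>2 / (4 * m)"
proof -
  let ?E = "(\<beta> - \<alpha>) * P u v + \<gamma> * Q u v"
  have D: "0 \<le> 1 + D u v" "0 \<le> 1 - D u v" using D_abs[of u v] by auto
  have "L \<alpha> \<beta> \<gamma> u v - 1 = (1 + D u v) / 2 * ((\<alpha> + \<beta>) / 2 - 1) + (1 - D u v) / 2 * (\<gamma> / 2 - 1) + ?E"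
    by (simp add: L_def field_simps)
  also have "\<dots> \<le> (1 + D u v) / 2 * (t + s) + (1 - D u v) / 2 * (t - s) + ?E"
  proof -
    have "(1 + D u v) / 2 * ((\<alpha> + \<beta>) / 2 - 1) \<le> (1 + D u v) / 2 * (t + s)"
      "(1 - D u v) / 2 * (\<gamma> / 2 - 1) \<le> (1 - D u v) / 2 * (t - s)"
      using D assms by (intro mult_left_mono; simp)+
    then show ?thesis by linarith
  qed
  also have "\<dots> = s * D u v + t + ?E" by (simp add: field_simps)
  finally have "max 0 (L \<alpha> \<beta> \<gamma> u v - 1) \<le> max 0 (s * D u v + t + ?E)" by simp
  also have "\<dots> \<le> (s * D u v + t + ?E + m)\<^sup>2 / (4 * m)" using assms(1) by (rule positive_part_le)
  finally show ?thesis by (simp add: add_ac)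
qed

text \<open>The triples spent on an arc of fractional load \<open>x\<close>: half a triple, minus a sixth per unit of
  load, where load above 1 is wasted and costs another half through the trimming.\<close>

definition H :: "real \<Rightarrow> real" where "H x = 1 / 2 - x / 6 + max 0 (x - 1) / 2"

text \<open>\<open>n^2 / 4\<close> is the cost at half a triple per arc, and the bracket is the
  relative saving, later called \<open>gain\<close>, with \<open>X = R2 / n ^ 3\<close> and
  \<open>q = t + m\<close>. The term with \<open>P * Q\<close> is carried along until the sum over
  all pairs of blocks removes it in \<open>kernel_skew\<close>.\<close>

lemma arcs_H:
  assumes m: "0 < m" "t + s \<ge> (\<alpha> + \<beta>) / 2 - 1" "t - s \<ge> \<gamma> / 2 - 1" and pos: "0 \<le> \<alpha>" "0 \<le> \<beta>" "0 \<le> \<gamma>"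
  shows "(\<Sum>(u, v)\<in>E. H (L \<alpha> \<beta> \<gamma> u v)) \<le> n\<^sup>2 / 4
    - n\<^sup>2 / 4 * ((1 + R2 / n ^ 3) * (\<alpha> + \<beta> + \<gamma>) / 12
       - (s\<^sup>2 / 3 + (t + m)\<^sup>2 + R2 / n ^ 3 * (((\<beta> - \<alpha>)\<^sup>2 + \<gamma>\<^sup>2) / 8 + 2 * s * (t + m) + (t + m) * \<gamma>)) / (4 * m))
    + (\<beta> - \<alpha>) * \<gamma> / m * ((\<Sum>(u, v)\<in>E. P u v * Q u v) / 4)
    + n * ((\<alpha> + \<beta> + \<gamma>) / 12 + \<bar>s * (t + m)\<bar> / (8 * m))"
proof -
  let ?q = "t + m" and ?d = "\<beta> - \<alpha>" and ?PQ = "\<Sum>(u, v)\<in>E. P u v * Q u v"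
  let ?c = "(\<alpha> + \<beta> - \<gamma>) / 4"
  have "(\<Sum>(u, v)\<in>E. H (L \<alpha> \<beta> \<gamma> u v))
      \<le> (\<Sum>(u, v)\<in>E. (1 / 2 - (\<alpha> + \<beta> + \<gamma>) / 24) + (- ?c / 6) * D u v + (- ?d / 6) * P u v + (- \<gamma> / 6) * Q u v
          + (s * D u v + ?q + (?d * P u v + \<gamma> * Q u v))\<^sup>2 / (8 * m))"
  proof (rule sum_mono)
    fix e assume "e \<in> E"
    obtain u v where e: "e = (u, v)" by (cases e)
    have "max 0 (L \<alpha> \<beta> \<gamma> u v - 1) / 2 \<le> (s * D u v + ?q + (?d * P u v + \<gamma> * Q u v))\<^sup>2 / (8 * m)"
      using overload_le[OF m, of u v] by simp
    moreover have eq: "1 / 2 - L \<alpha> \<beta> \<gamma> u v / 6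
        = (1 / 2 - (\<alpha> + \<beta> + \<gamma>) / 24) + (- ?c / 6) * D u v + (- ?d / 6) * P u v + (- \<gamma> / 6) * Q u v"
      by (simp add: L_def field_simps)
    ultimately show "(case e of (u, v) \<Rightarrow> H (L \<alpha> \<beta> \<gamma> u v))
      \<le> (case e of (u, v) \<Rightarrow> (1 / 2 - (\<alpha> + \<beta> + \<gamma>) / 24) + (- ?c / 6) * D u v + (- ?d / 6) * P u v + (- \<gamma> / 6) * Q u v
          + (s * D u v + ?q + (?d * P u v + \<gamma> * Q u v))\<^sup>2 / (8 * m))"
      unfolding e prod.case H_def eq[symmetric] by linarith
  qed
  also have "\<dots> = (1 / 2 - (\<alpha> + \<beta> + \<gamma>) / 24) * (n * (n - 1) / 2) + (- ?c / 6) * ((R2 / n - (n - 1)) / 2) + (- \<gamma> / 6) * (R2 / (4 * n))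
      + (\<Sum>(u, v)\<in>E. (s * D u v + ?q + (?d * P u v + \<gamma> * Q u v))\<^sup>2) / (8 * m)"
    unfolding arcs_linear[of "1 / 2 - (\<alpha> + \<beta> + \<gamma>) / 24" "- ?c / 6" "- ?d / 6" "- \<gamma> / 6", symmetric]
    by (simp only: case_prod_unfold sum.distrib sum_divide_distrib)
  also have "\<dots> \<le> (1 / 2 - (\<alpha> + \<beta> + \<gamma>) / 24) * (n * (n - 1) / 2) + (- ?c / 6) * ((R2 / n - (n - 1)) / 2) + (- \<gamma> / 6) * (R2 / (4 * n))
      + (s\<^sup>2 * n\<^sup>2 / 6 + ?q\<^sup>2 * n\<^sup>2 / 2 + (?d\<^sup>2 + \<gamma>\<^sup>2) * R2 / (16 * n) + s * ?q * R2 / n + ?q * \<gamma> * R2 / (2 * n)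
      + 2 * ?d * \<gamma> * ?PQ + \<bar>s * ?q\<bar> * n) / (8 * m)"
    using m(1) by (intro add_left_mono divide_right_mono arcs_square) auto
  also have "\<dots> = n\<^sup>2 / 4
    - n\<^sup>2 / 4 * ((1 + R2 / n ^ 3) * (\<alpha> + \<beta> + \<gamma>) / 12
       - (s\<^sup>2 / 3 + ?q\<^sup>2 + R2 / n ^ 3 * ((?d\<^sup>2 + \<gamma>\<^sup>2) / 8 + 2 * s * ?q + ?q * \<gamma>)) / (4 * m))
    + ?d * \<gamma> / m * (?PQ / 4) + \<bar>s * ?q\<bar> / (8 * m) * n
    + (- n / 4 + (\<alpha> + \<beta> + \<gamma>) * n / 48 + ?c * (n - 1) / 12)"
    using n_pos m(1) by (simp add: field_simps power2_eq_square power3_eq_cube)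
  also have "- n / 4 + (\<alpha> + \<beta> + \<gamma>) * n / 48 + ?c * (n - 1) / 12 \<le> n * ((\<alpha> + \<beta> + \<gamma>) / 12)"
  proof -
    have n1: "0 \<le> n - 1" using n_pos by (simp add: n_def)
    have "?c * (n - 1) \<le> (\<alpha> + \<beta> + \<gamma>) / 4 * n" using pos n1 by (intro mult_mono) auto
    then have "- n / 4 + (\<alpha> + \<beta> + \<gamma>) * n / 48 + ?c * (n - 1) / 12 \<le> (\<alpha> + \<beta> + \<gamma>) * n / 24"
      using n_pos by linarith
    also have "\<dots> \<le> (\<alpha> + \<beta> + \<gamma>) * n / 12"
      using mult_nonneg_nonneg[of "\<alpha> + \<beta> + \<gamma>" n] pos n_pos by simp
    finally show ?thesis by (simp add: mult.commute)
  qed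
  finally show ?thesis by (simp add: algebra_simps)
qed

end

section \<open>Random ordered blocks\<close>

lemma (in finite_product) Avg_sum_square:
  fixes h :: "'i \<Rightarrow> 'a \<Rightarrow> real" and c :: real
  assumes X: "X \<subseteq> I" and mean: "\<And>i. i \<in> X \<Longrightarrow> (\<Sum>a\<in>S. \<mu> i a * h i a) = 0"
    and bound: "\<And>i a. i \<in> X \<Longrightarrow> a \<in> S \<Longrightarrow> \<bar>h i a\<bar> \<le> c"
  shows "Avg (\<lambda>p. (\<Sum>i\<in>X. h i (p i))\<^sup>2) \<le> card X * c\<^sup>2"
proof -
  have fX: "finite X" using X finite_index finite_subset by blast
  have "Avg (\<lambda>p. (\<Sum>i\<in>X. h i (p i))\<^sup>2) = (\<Sum>i\<in>X. \<Sum>j\<in>X. Avg (\<lambda>p. h i (p i) * h j (p j)))"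
    by (simp only: power2_eq_square sum_product Avg_sum)
  also have "\<dots> \<le> (\<Sum>i\<in>X. \<Sum>j\<in>X. if i = j then c\<^sup>2 else 0)"
  proof (intro sum_mono)
    fix i j assume ij: "i \<in> X" "j \<in> X"
    show "Avg (\<lambda>p. h i (p i) * h j (p j)) \<le> (if i = j then c\<^sup>2 else 0)"
    proof (cases "i = j")
      case True
      have "Avg (\<lambda>p. h i (p i) * h i (p i)) \<le> Avg (\<lambda>p. c\<^sup>2)"
      proof (rule Avg_mono)
        fix p assume "p \<in> I \<rightarrow>\<^sub>E S"
        then have "\<bar>h i (p i)\<bar> \<le> c" using bound ij X by (auto simp: PiE_def)
        then have "\<bar>h i (p i)\<bar>\<^sup>2 \<le> c\<^sup>2" by (intro power_mono) auto
        then show "h i (p i) * h i (p i) \<le> c\<^sup>2" by (simp add: power2_eq_square)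
      qed
      then show ?thesis using True by simp
    next
      case False
      then show ?thesis using ij X mean[of i] by (subst Avg_two) auto
    qed
  qed
  also have "\<dots> = card X * c\<^sup>2" using fX by simp
  finally show ?thesis .
qed

text \<open>\<open>W\<close> takes blocks in ascending order, whereas a triangle
  \<open>(x, y, z)\<close> of backward arcs descends through them; hence the reversed arguments in
  \<open>wgt\<close>.\<close>

locale random_blocks = tourn V E for V :: "'a set" and E :: "('a \<times> 'a) set" +
  fixes r :: nat and W :: "nat \<Rightarrow> nat \<Rightarrow> nat \<Rightarrow> real" and C :: real
  assumes block_count: "0 < r" and W_nonneg: "\<And>i j k. 0 \<le> W i j k" and W_le: "\<And>i j k. W i j k \<le> C"
    and W_zero: "\<And>i j k. \<not> (i < j \<and> j < k) \<Longrightarrow> W i j k = 0"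
begin

sublocale finite_product V "{..<r}" "\<lambda>_ _. 1 / real r"
  by unfold_locales (use finV block_count in auto)

lemma W_pos: "W i j k \<noteq> 0 \<Longrightarrow> i < j \<and> j < k"
  using W_zero by blast

definition backward :: "('a \<Rightarrow> nat) \<Rightarrow> ('a \<times> 'a) set" where
  "backward p = {(u, v) \<in> E. p v < p u}"

definition tri :: "('a \<Rightarrow> nat) \<Rightarrow> ('a \<times> 'a \<times> 'a) set" where
  "tri p = {(x, y, z). (x, y) \<in> E \<and> (y, z) \<in> E \<and> (x, z) \<in> E \<and> p z < p y \<and> p y < p x}"

definition wgt :: "('a \<Rightarrow> nat) \<Rightarrow> 'a \<times> 'a \<times> 'a \<Rightarrow> real" where
  "wgt p = (\<lambda>(x, y, z). W (p z) (p y) (p x) / n)"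

text \<open>The share of a third vertex \<open>x\<close> of block \<open>k\<close> in the load of
  the arc \<open>(u, v)\<close> with \<open>v\<close> in block \<open>i\<close> and \<open>u\<close>
  in block \<open>j\<close>: \<open>x\<close> lies above both blocks, below both, or between them.
  Blocks are free arguments so that the average can run over \<open>k\<close> alone.\<close>

definition g :: "'a \<Rightarrow> 'a \<Rightarrow> nat \<Rightarrow> nat \<Rightarrow> 'a \<Rightarrow> nat \<Rightarrow> real" where
  "g u v i j x k = of_bool ((x, u) \<in> E \<and> (x, v) \<in> E) * W i j k
     + of_bool ((u, x) \<in> E \<and> (v, x) \<in> E) * W k i j + of_bool ((u, x) \<in> E \<and> (x, v) \<in> E) * W i k j"

definition \<alpha> :: "nat \<Rightarrow> nat \<Rightarrow> real" where "\<alpha> i j = (\<Sum>k<r. W i j k) / r"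
definition \<beta> :: "nat \<Rightarrow> nat \<Rightarrow> real" where "\<beta> i j = (\<Sum>k<r. W k i j) / r"
definition \<gamma> :: "nat \<Rightarrow> nat \<Rightarrow> real" where "\<gamma> i j = (\<Sum>k<r. W i k j) / r"

lemma arcE: "(u, v) \<in> E \<Longrightarrow> u \<in> V \<and> v \<in> V \<and> u \<noteq> v" by (rule tournament_arc[OF T])

text \<open>Any two arcs of a triangle contain all three vertices, and the blocks determine their
  order.\<close>

lemma linear_triples_tri: "linear_triples (backward p) (tri p) arcs3"
proof
  show "finite (backward p)" using finE by (auto simp: backward_def intro: finite_subset)
  have "tri p \<subseteq> V \<times> V \<times> V" using arcE by (auto simp: tri_def)
  then show "finite (tri p)" using finV by (meson finite_SigmaI finite_subset)
  show "arcs3 t \<subseteq> backward p" if "t \<in> tri p" for t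
    using that by (auto simp: tri_def arcs3_def backward_def)
  show "card (arcs3 t) = 3" if "t \<in> tri p" for t
  proof -
    obtain x y z where t: "t = (x, y, z)" by (cases t)
    have "x \<noteq> y" "y \<noteq> z" using that by (auto simp: t tri_def)
    then show ?thesis by (auto simp: t arcs3_def card_insert_if)
  qed
  show "card (arcs3 t \<inter> arcs3 t') \<le> 1" if "t \<in> tri p" "t' \<in> tri p" "t \<noteq> t'" for t t'
  proof -
    obtain x y z x' y' z' where t: "t = (x, y, z)" "t' = (x', y', z')" by (cases t, cases t')
    have o: "p z < p y" "p y < p x" "p z' < p y'" "p y' < p x'" using that by (auto simp: t tri_def)
    have "a = b" if "a \<in> arcs3 t \<inter> arcs3 t'" "b \<in> arcs3 t \<inter> arcs3 t'" for a b
      using that o \<open>t \<noteq> t'\<close> by (auto simp: t arcs3_def)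
    moreover have fin: "finite (arcs3 t \<inter> arcs3 t')" by (simp add: t arcs3_def)
    ultimately show ?thesis unfolding One_nat_def card_le_Suc0_iff_eq[OF fin] by blast
  qed
qed

lemma load_tri:
  assumes uv: "(u, v) \<in> backward p"
  shows "linear_triples.load (tri p) arcs3 (wgt p) (u, v) = (\<Sum>x\<in>V - {u, v}. g u v (p v) (p u) x (p x)) / n"
proof -
  let ?X = "V - {u, v}"
  have o: "(u, v) \<in> E" "p v < p u" "u \<noteq> v" using uv arcE by (auto simp: backward_def)
  define X1 where "X1 = {x\<in>?X. (x, u) \<in> E \<and> (x, v) \<in> E \<and> p u < p x}"
  define X2 where "X2 = {x\<in>?X. (u, x) \<in> E \<and> (v, x) \<in> E \<and> p x < p v}"
  define X3 where "X3 = {x\<in>?X. (u, x) \<in> E \<and> (x, v) \<in> E \<and> p v < p x \<and> p x < p u}"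
  have fin: "finite X1" "finite X2" "finite X3" using finV by (auto simp: X1_def X2_def X3_def)
  have set: "{t\<in>tri p. (u, v) \<in> arcs3 t} = (\<lambda>x. (x, u, v)) ` X1 \<union> ((\<lambda>x. (u, v, x)) ` X2 \<union> (\<lambda>x. (u, x, v)) ` X3)"
    using o arcE by (auto simp: tri_def arcs3_def X1_def X2_def X3_def)
  have "linear_triples.load (tri p) arcs3 (wgt p) (u, v)
      = sum (wgt p) ((\<lambda>x. (x, u, v)) ` X1) + (sum (wgt p) ((\<lambda>x. (u, v, x)) ` X2) + sum (wgt p) ((\<lambda>x. (u, x, v)) ` X3))"
    unfolding linear_triples.load_def[OF linear_triples_tri] set using fin o(3)
    by (subst sum.union_disjoint, auto simp: X1_def X2_def X3_def, subst sum.union_disjoint, auto)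
  also have "sum (wgt p) ((\<lambda>x. (x, u, v)) ` X1) = (\<Sum>x\<in>X1. W (p v) (p u) (p x) / n)"
    by (subst sum.reindex) (auto simp: inj_on_def wgt_def)
  also have "\<dots> = (\<Sum>x\<in>?X. of_bool ((x, u) \<in> E \<and> (x, v) \<in> E) * W (p v) (p u) (p x) / n)"
    using finV by (intro sum.mono_neutral_cong_left) (auto simp: X1_def dest: W_pos)
  also have "sum (wgt p) ((\<lambda>x. (u, v, x)) ` X2) = (\<Sum>x\<in>X2. W (p x) (p v) (p u) / n)"
    by (subst sum.reindex) (auto simp: inj_on_def wgt_def)
  also have "\<dots> = (\<Sum>x\<in>?X. of_bool ((u, x) \<in> E \<and> (v, x) \<in> E) * W (p x) (p v) (p u) / n)"
    using finV by (intro sum.mono_neutral_cong_left) (auto simp: X2_def dest: W_pos)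
  also have "sum (wgt p) ((\<lambda>x. (u, x, v)) ` X3) = (\<Sum>x\<in>X3. W (p v) (p x) (p u) / n)"
    by (subst sum.reindex) (auto simp: inj_on_def wgt_def)
  also have "\<dots> = (\<Sum>x\<in>?X. of_bool ((u, x) \<in> E \<and> (x, v) \<in> E) * W (p v) (p x) (p u) / n)"
    using finV by (intro sum.mono_neutral_cong_left) (auto simp: X3_def dest: W_pos)
  finally show ?thesis
    unfolding g_def sum_divide_distrib add_divide_distrib sum.distrib by linarith
qed

definition mean :: "'a \<Rightarrow> 'a \<Rightarrow> nat \<Rightarrow> nat \<Rightarrow> real" where
  "mean u v i j = (\<Sum>x\<in>V - {u, v}. (\<Sum>k<r. g u v i j x k) / r) / n"

text \<open>Writing arc indicators as \<open>(1 + A) / 2\<close> or \<open>(1 - A) / 2\<close>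
  expresses the three kinds of third vertices by \<open>n\<close>, the scores and \<open>D\<close>:
  common neighbours count with \<open>+ D\<close>, vertices between \<open>u\<close> and
  \<open>v\<close> with \<open>- D\<close>. The shift of order \<open>1 / n\<close> comes from
  excluding \<open>x = u\<close> and \<open>x = v\<close>.\<close>

lemma mean_load:
  assumes uv: "(u, v) \<in> E"
  shows "mean u v i j = L (\<alpha> i j) (\<beta> i j) (\<gamma> i j) u v - (\<alpha> i j / 2 + \<beta> i j / 2 + \<gamma> i j) / n"
proof -
  let ?X = "V - {u, v}"
  have V: "u \<in> V" "v \<in> V" "u \<noteq> v" using arcE[OF uv] by auto
  have split: "(\<Sum>x\<in>V. f x) = f u + f v + (\<Sum>x\<in>?X. f x)" for f :: "'a \<Rightarrow> real"
  proof -
    have "(\<Sum>x\<in>V. f x) = f u + (\<Sum>x\<in>V - {u}. f x)" using finV V by (simp add: sum.remove)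
    also have "(\<Sum>x\<in>V - {u}. f x) = f v + (\<Sum>x\<in>V - {u} - {v}. f x)" using finV V by (subst sum.remove[of _ v]) auto
    also have "V - {u} - {v} = ?X" by auto
    finally show ?thesis by simp
  qed
  have nD: "(\<Sum>x\<in>V. A u x * A v x) = n * D u v" using n_pos by (simp add: D_def)
  have Auv: "A u v = 1" "A v u = -1" using A_arc[OF uv] A_skew[of v u] by auto
  have prod: "(\<Sum>x\<in>?X. (1 + a * A u x) * (1 + b * A v x) / 4)
      = (n + a * R u + b * R v + a * b * (n * D u v)) / 4 - ((1 - b) / 4 + (1 + a) / 4)" for a b
  proof -
    have "(\<Sum>x\<in>V. (1 + a * A u x) * (1 + b * A v x) / 4) = (n + a * R u + b * R v + a * b * (n * D u v)) / 4"
      unfolding nD[symmetric] R_def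
      by (simp add: n_def algebra_simps sum.distrib sum_distrib_left flip: sum_divide_distrib)
    moreover have "(\<Sum>x\<in>V. (1 + a * A u x) * (1 + b * A v x) / 4)
        = (1 - b) / 4 + (1 + a) / 4 + (\<Sum>x\<in>?X. (1 + a * A u x) * (1 + b * A v x) / 4)"
      using split[of "\<lambda>x. (1 + a * A u x) * (1 + b * A v x) / 4"] by (simp add: Auv)
    ultimately show ?thesis by linarith
  qed
  have ind: "of_bool ((u, x) \<in> E) = (1 + A u x) / 2" "of_bool ((x, u) \<in> E) = (1 - A u x) / 2"
      "of_bool ((v, x) \<in> E) = (1 + A v x) / 2" "of_bool ((x, v) \<in> E) = (1 - A v x) / 2" if "x \<in> ?X" for x
    using that V E_ind[of u x] E_ind[of x u] E_ind[of v x] E_ind[of x v] A_skew[of x u] A_skew[of x v] by auto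
  have S: "(\<Sum>x\<in>?X. of_bool ((x, u) \<in> E \<and> (x, v) \<in> E)) = (n - R u - R v + n * D u v) / 4 - 1/2"
  proof -
    have "(\<Sum>x\<in>?X. of_bool ((x, u) \<in> E \<and> (x, v) \<in> E)) = (\<Sum>x\<in>?X. (1 + (-1) * A u x) * (1 + (-1) * A v x) / 4)"
      by (intro sum.cong refl) (simp add: of_bool_conj ind)
    also note prod
    finally show ?thesis by simp
  qed
  have K: "(\<Sum>x\<in>?X. of_bool ((u, x) \<in> E \<and> (v, x) \<in> E)) = (n + R u + R v + n * D u v) / 4 - 1/2"
  proof -
    have "(\<Sum>x\<in>?X. of_bool ((u, x) \<in> E \<and> (v, x) \<in> E)) = (\<Sum>x\<in>?X. (1 + 1 * A u x) * (1 + 1 * A v x) / 4)"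
      by (intro sum.cong refl) (simp add: of_bool_conj ind)
    also note prod
    finally show ?thesis by simp
  qed
  have M: "(\<Sum>x\<in>?X. of_bool ((u, x) \<in> E \<and> (x, v) \<in> E)) = (n + R u - R v - n * D u v) / 4 - 1"
  proof -
    have "(\<Sum>x\<in>?X. of_bool ((u, x) \<in> E \<and> (x, v) \<in> E)) = (\<Sum>x\<in>?X. (1 + 1 * A u x) * (1 + (-1) * A v x) / 4)"
      by (intro sum.cong refl) (simp add: of_bool_conj ind)
    also note prod
    finally show ?thesis by simp
  qed
  have "(\<Sum>k<r. g u v i j x k) / r = of_bool ((x, u) \<in> E \<and> (x, v) \<in> E) * \<alpha> i j
     + of_bool ((u, x) \<in> E \<and> (v, x) \<in> E) * \<beta> i j + of_bool ((u, x) \<in> E \<and> (x, v) \<in> E) * \<gamma> i j" for x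
    unfolding g_def \<alpha>_def \<beta>_def \<gamma>_def
    by (simp only: sum.distrib add_divide_distrib sum_distrib_left[symmetric] times_divide_eq_right)
  then have "mean u v i j = ((\<Sum>x\<in>?X. of_bool ((x, u) \<in> E \<and> (x, v) \<in> E)) * \<alpha> i j
     + (\<Sum>x\<in>?X. of_bool ((u, x) \<in> E \<and> (v, x) \<in> E)) * \<beta> i j + (\<Sum>x\<in>?X. of_bool ((u, x) \<in> E \<and> (x, v) \<in> E)) * \<gamma> i j) / n"
    unfolding mean_def by (simp only: sum.distrib sum_distrib_right[symmetric])
  also have "\<dots> = L (\<alpha> i j) (\<beta> i j) (\<gamma> i j) u v - (\<alpha> i j / 2 + \<beta> i j / 2 + \<gamma> i j) / n"
    unfolding S K M L_def P_def Q_def using n_pos by (simp add: field_simps)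
  finally show ?thesis .
qed

lemma H_shift:
  assumes "0 \<le> c"
  shows "H (x - c) \<le> H x + c / 6"
proof -
  have "a \<le> b \<Longrightarrow> 1 / 2 - (x - c) / 6 + a / 2 \<le> 1 / 2 - x / 6 + b / 2 + c / 6" for a b :: real
    by (simp add: field_simps)
  moreover have "max 0 (x - c - 1) \<le> max 0 (x - 1)" using assms by auto
  ultimately show ?thesis unfolding H_def by blast
qed

lemma H_lipschitz: "H x \<le> H y + \<bar>x - y\<bar>"
proof -
  have *: "a \<le> b + d \<Longrightarrow> y - x \<le> d \<Longrightarrow> 0 \<le> d \<Longrightarrow> 1 / 2 - x / 6 + a / 2 \<le> 1 / 2 - y / 6 + b / 2 + d" for a b d :: real
    by (simp add: field_simps)
  show ?thesis unfolding H_def by (rule *[OF _ _ abs_ge_zero]) auto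
qed

definition pairs :: "(nat \<times> nat) set" where "pairs = {(i, j). i < j \<and> j < r}"

lemma finite_pairs: "finite pairs"
  by (rule finite_subset[of _ "{..<r} \<times> {..<r}"]) (auto simp: pairs_def)

text \<open>The load is replaced by its mean for given blocks of \<open>u\<close> and
  \<open>v\<close>, using that \<open>H\<close> is Lipschitz. Independence of the other blocks
  bounds the mean square of the deviation by \<open>9 * C ^ 2 / n\<close>.\<close>

lemma Avg_cost:
  assumes \<zeta>: "0 < \<zeta>"
  shows "Avg (\<lambda>p. \<Sum>e\<in>backward p. H (linear_triples.load (tri p) arcs3 (wgt p) e))
    \<le> (\<Sum>(i, j)\<in>pairs. (\<Sum>(u, v)\<in>E. H (mean u v i j)) / r\<^sup>2) + card pairs * card E * (\<zeta> / 2 + 9 * C\<^sup>2 / (2 * n * \<zeta>))"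
proof -
  let ?I = "{..<r}"
  define Z where "Z u v i j p = (\<Sum>x\<in>V - {u, v}. g u v i j x (p x)) / n" for u v i j and p :: "'a \<Rightarrow> nat"
  let ?ind = "\<lambda>u v i j p. of_bool (p v = i) * of_bool (p u = j) :: real"
  have C: "0 \<le> C" using W_nonneg[of 0 0 0] W_le[of 0 0 0] by linarith
  have g_bounds: "0 \<le> g u v i j x k" "g u v i j x k \<le> 3 * C" for u v i j x k
  proof -
    have *: "0 \<le> of_bool b * w \<and> of_bool b * w \<le> C" if "0 \<le> w" "w \<le> C" for b and w :: real
      using that C by (cases b) auto
    have "0 \<le> of_bool b1 * W i j k + of_bool b2 * W k i j + of_bool b3 * W i k j \<and>
        of_bool b1 * W i j k + of_bool b2 * W k i j + of_bool b3 * W i k j \<le> 3 * C" for b1 b2 b3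
      using *[of "W i j k" b1] *[of "W k i j" b2] *[of "W i k j" b3] W_nonneg W_le by simp
    then show "0 \<le> g u v i j x k" "g u v i j x k \<le> 3 * C" unfolding g_def by blast+
  qed
  have dev: "Avg (\<lambda>p. \<bar>Z u v i j p - mean u v i j\<bar>) \<le> \<zeta> / 2 + 9 * C\<^sup>2 / (2 * n * \<zeta>)" for u v i j
  proof -
    let ?X = "V - {u, v}"
    let ?h = "\<lambda>x a. g u v i j x a - (\<Sum>k<r. g u v i j x k) / r"
    have avg: "0 \<le> (\<Sum>k<r. g u v i j x k) / r \<and> (\<Sum>k<r. g u v i j x k) / r \<le> 3 * C" for x
    proof -
      have "(\<Sum>k<r. g u v i j x k) \<le> (\<Sum>k<r. 3 * C)" by (intro sum_mono g_bounds)
      moreover have "0 \<le> (\<Sum>k<r. g u v i j x k)" by (intro sum_nonneg g_bounds)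
      ultimately show ?thesis using block_count by (simp add: divide_le_eq mult.commute)
    qed
    have sq: "Avg (\<lambda>p. (\<Sum>x\<in>?X. ?h x (p x))\<^sup>2) \<le> card ?X * (3 * C)\<^sup>2"
    proof (rule Avg_sum_square[where h = ?h])
      show "(\<Sum>a<r. 1 / real r * ?h x a) = 0" for x
        using block_count by (simp add: right_diff_distrib sum_subtractf flip: sum_divide_distrib)
      show "\<bar>?h x a\<bar> \<le> 3 * C" for x a using avg[of x] g_bounds[of u v i j x a] by (simp add: abs_le_iff)
    qed auto
    have Zm: "Z u v i j p - mean u v i j = (\<Sum>x\<in>?X. ?h x (p x)) / n" for p
      by (simp add: Z_def mean_def sum_subtractf diff_divide_distrib)
    \<comment> \<open>AM-GM in place of Cauchy-Schwarz, so that only a second moment has to be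
      averaged.\<close>
    have abs: "\<bar>z\<bar> \<le> \<zeta> / 2 + 1 / (2 * \<zeta>) * z\<^sup>2" for z :: real
    proof -
      have "\<bar>z\<bar> * (2 * \<zeta>) \<le> \<zeta>\<^sup>2 + z\<^sup>2"
        using zero_le_power2[of "\<bar>z\<bar> - \<zeta>"] by (simp add: power2_eq_square algebra_simps flip: abs_mult)
      then have "\<bar>z\<bar> \<le> (\<zeta>\<^sup>2 + z\<^sup>2) / (2 * \<zeta>)" using \<zeta> by (simp add: pos_le_divide_eq)
      also have "\<dots> = \<zeta> / 2 + 1 / (2 * \<zeta>) * z\<^sup>2" using \<zeta> by (simp add: add_divide_distrib power2_eq_square)
      finally show ?thesis .
    qed
    have "Avg (\<lambda>p. \<bar>Z u v i j p - mean u v i j\<bar>) \<le> Avg (\<lambda>p. \<zeta> / 2 + 1 / (2 * \<zeta>) * (1 / n\<^sup>2 * (\<Sum>x\<in>?X. ?h x (p x))\<^sup>2))"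
      by (rule Avg_mono) (rule order_trans[OF abs], simp add: Zm power_divide)
    also have "\<dots> = \<zeta> / 2 + 1 / (2 * \<zeta>) * (1 / n\<^sup>2 * Avg (\<lambda>p. (\<Sum>x\<in>?X. ?h x (p x))\<^sup>2))"
      by (simp only: Avg_add Avg_cmult Avg_const)
    also have "\<dots> \<le> \<zeta> / 2 + 1 / (2 * \<zeta>) * (1 / n\<^sup>2 * (n * (3 * C)\<^sup>2))"
    proof (intro add_left_mono mult_left_mono order_trans[OF sq] mult_right_mono)
      show "real (card ?X) \<le> n" unfolding n_def using finV by (simp add: card_mono)
    qed (use \<zeta> in auto)
    also have "\<dots> = \<zeta> / 2 + 9 * C\<^sup>2 / (2 * n * \<zeta>)" using n_pos \<zeta> by (simp add: power2_eq_square)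
    finally show ?thesis .
  qed
  have cost: "(\<Sum>e\<in>backward p. H (linear_triples.load (tri p) arcs3 (wgt p) e))
      = (\<Sum>(i, j)\<in>pairs. \<Sum>(u, v)\<in>E. ?ind u v i j p * H (Z u v i j p))" if p: "p \<in> V \<rightarrow>\<^sub>E ?I" for p
  proof -
    have "(\<Sum>e\<in>backward p. H (linear_triples.load (tri p) arcs3 (wgt p) e)) = (\<Sum>(u, v)\<in>backward p. H (Z u v (p v) (p u) p))"
      by (intro sum.cong refl) (auto simp: load_tri Z_def)
    also have "\<dots> = (\<Sum>(u, v)\<in>E. \<Sum>(i, j)\<in>pairs. ?ind u v i j p * H (Z u v i j p))"
    proof (rule sum.mono_neutral_cong_left[OF finE])
      show "backward p \<subseteq> E" by (auto simp: backward_def)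
      have one: "(\<Sum>(i, j)\<in>pairs. ?ind u v i j p * H (Z u v i j p)) = (if (p v, p u) \<in> pairs then H (Z u v (p v) (p u) p) else 0)" for u v
      proof -
        have "(\<Sum>(i, j)\<in>pairs. ?ind u v i j p * H (Z u v i j p)) = (\<Sum>ij\<in>pairs. if ij = (p v, p u) then H (Z u v (p v) (p u) p) else 0)"
          by (intro sum.cong refl) auto
        then show ?thesis using finite_pairs by simp
      qed
      have rng: "p u < r" if "(u, v) \<in> E" for u v using arcE[OF that] p by (auto simp: PiE_def)
      show "\<forall>e\<in>E - backward p. (case e of (u, v) \<Rightarrow> \<Sum>(i, j)\<in>pairs. ?ind u v i j p * H (Z u v i j p)) = 0"
      proof
        fix e assume e: "e \<in> E - backward p"
        obtain u v where uv: "e = (u, v)" by (cases e)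
        have "(p v, p u) \<notin> pairs" using e by (auto simp: uv backward_def pairs_def)
        then show "(case e of (u, v) \<Rightarrow> \<Sum>(i, j)\<in>pairs. ?ind u v i j p * H (Z u v i j p)) = 0"
          by (simp add: uv one)
      qed
      show "(case e of (u, v) \<Rightarrow> H (Z u v (p v) (p u) p)) = (case e of (u, v) \<Rightarrow> \<Sum>(i, j)\<in>pairs. ?ind u v i j p * H (Z u v i j p))"
        if "e \<in> backward p" for e
        using that rng by (cases e) (simp add: one, auto simp: backward_def pairs_def)
    qed
    also have "\<dots> = (\<Sum>(i, j)\<in>pairs. \<Sum>(u, v)\<in>E. ?ind u v i j p * H (Z u v i j p))"
      by (simp only: case_prod_unfold, rule sum.swap)
    finally show ?thesis .
  qed
  have "Avg (\<lambda>p. \<Sum>e\<in>backward p. H (linear_triples.load (tri p) arcs3 (wgt p) e))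
      \<le> Avg (\<lambda>p. \<Sum>(i, j)\<in>pairs. \<Sum>(u, v)\<in>E. H (mean u v i j) * ?ind u v i j p + \<bar>Z u v i j p - mean u v i j\<bar>)"
  proof (rule Avg_mono)
    fix p assume p: "p \<in> V \<rightarrow>\<^sub>E ?I"
    \<comment> \<open>The deviation is charged for every pair \<open>(i, j)\<close> and not only for
      the actual one. This costs a constant factor and avoids conditioning on the blocks of
      \<open>u\<close> and \<open>v\<close>.\<close>
    have "?ind u v i j p * H (Z u v i j p) \<le> H (mean u v i j) * ?ind u v i j p + \<bar>Z u v i j p - mean u v i j\<bar>" for u v i j
      using H_lipschitz[of "Z u v i j p" "mean u v i j"] by (cases "p v = i"; cases "p u = j") auto
    then show "(\<Sum>e\<in>backward p. H (linear_triples.load (tri p) arcs3 (wgt p) e))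
      \<le> (\<Sum>(i, j)\<in>pairs. \<Sum>(u, v)\<in>E. H (mean u v i j) * ?ind u v i j p + \<bar>Z u v i j p - mean u v i j\<bar>)"
      unfolding cost[OF p] case_prod_unfold by (intro sum_mono)
  qed
  also have "\<dots> = (\<Sum>(i, j)\<in>pairs. \<Sum>(u, v)\<in>E. H (mean u v i j) * Avg (?ind u v i j) + Avg (\<lambda>p. \<bar>Z u v i j p - mean u v i j\<bar>))"
    by (simp only: case_prod_unfold Avg_sum Avg_add Avg_cmult)
  also have "\<dots> \<le> (\<Sum>(i, j)\<in>pairs. \<Sum>(u, v)\<in>E. H (mean u v i j) / r\<^sup>2 + (\<zeta> / 2 + 9 * C\<^sup>2 / (2 * n * \<zeta>)))"
  proof (rule sum_mono, clarify, rule sum_mono, clarify)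
    fix i j u v assume ij: "(i, j) \<in> pairs" and uv: "(u, v) \<in> E"
    have "Avg (?ind u v i j) = (\<Sum>a<r. 1 / real r * of_bool (a = i)) * (\<Sum>a<r. 1 / real r * of_bool (a = j))"
      using arcE[OF uv] by (intro Avg_two) auto
    also have "\<dots> = 1 / r\<^sup>2"
    proof -
      have "(\<Sum>a<r. 1 / real r * of_bool (a = k)) = 1 / r" if "k < r" for k
        using that by (simp only: sum_distrib_left[symmetric]) (simp add: of_bool_def)
      then show ?thesis using ij by (simp add: pairs_def power2_eq_square)
    qed
    finally show "H (mean u v i j) * Avg (?ind u v i j) + Avg (\<lambda>p. \<bar>Z u v i j p - mean u v i j\<bar>)
      \<le> H (mean u v i j) / r\<^sup>2 + (\<zeta> / 2 + 9 * C\<^sup>2 / (2 * n * \<zeta>))"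
      using dev[of u v i j] by simp
  qed
  also have "\<dots> = (\<Sum>(i, j)\<in>pairs. (\<Sum>(u, v)\<in>E. H (mean u v i j)) / r\<^sup>2) + card pairs * card E * (\<zeta> / 2 + 9 * C\<^sup>2 / (2 * n * \<zeta>))"
    by (simp add: case_prod_unfold sum.distrib sum_divide_distrib)
  finally show ?thesis .
qed

end

section \<open>Exact evaluation of the 24-block certificate\<close>

definition kernel :: "nat \<Rightarrow> nat \<Rightarrow> nat \<Rightarrow> real" where
  "kernel i j k = (if i < j \<and> j < k \<and> k < 24 then real_of_int (wt (j - i) (k - j)) else 0)"

lemma kernel_range: "0 \<le> kernel i j k" "kernel i j k \<le> 8"
  using wt_range by (auto simp: kernel_def)

lemma wt_commute: "wt p q = wt q p"
  by (simp add: wt_def min.commute max.commute add.commute conj_commute)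

lemma outer_eq: "outer d k = (\<Sum>q\<in>{1..<Suc k}. wt d q)"
  by (simp add: outer_def interv_sum_list_conv_sum_set_nat del: upt_Suc)

lemma inner_eq: "inner d = (\<Sum>p\<in>{1..<d}. wt p (d - p))"
  by (simp add: inner_def interv_sum_list_conv_sum_set_nat)

lemma kernel_sums:
  assumes "i < j" "j < 24"
  shows "(\<Sum>k<24. kernel i j k) = outer (j - i) (23 - j)"
    and "(\<Sum>k<24. kernel k i j) = outer (j - i) i"
    and "(\<Sum>k<24. kernel i k j) = inner (j - i)"
proof -
  have "(\<Sum>k<24. kernel i j k) = (\<Sum>k\<in>{j<..<24}. real_of_int (wt (j - i) (k - j)))"
    using assms by (intro sum.mono_neutral_cong_right) (auto simp: kernel_def)
  also have "\<dots> = (\<Sum>q\<in>{1..<Suc (23 - j)}. real_of_int (wt (j - i) q))"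
    using assms by (intro sum.reindex_bij_witness[of _ "\<lambda>q. q + j" "\<lambda>k. k - j"]) auto
  finally show "(\<Sum>k<24. kernel i j k) = outer (j - i) (23 - j)" by (simp add: outer_eq)
  have "(\<Sum>k<24. kernel k i j) = (\<Sum>k\<in>{..<i}. real_of_int (wt (j - i) (i - k)))"
    using assms by (intro sum.mono_neutral_cong_right) (auto simp: kernel_def wt_commute)
  also have "\<dots> = (\<Sum>q\<in>{1..<Suc i}. real_of_int (wt (j - i) q))"
    using assms by (intro sum.reindex_bij_witness[of _ "\<lambda>q. i - q" "\<lambda>k. i - k"]) auto
  finally show "(\<Sum>k<24. kernel k i j) = outer (j - i) i" by (simp add: outer_eq)
  have "(\<Sum>k<24. kernel i k j) = (\<Sum>k\<in>{i<..<j}. real_of_int (wt (k - i) (j - k)))"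
    using assms by (intro sum.mono_neutral_cong_right) (auto simp: kernel_def)
  also have "\<dots> = (\<Sum>p\<in>{1..<j - i}. real_of_int (wt p (j - i - p)))"
    using assms by (intro sum.reindex_bij_witness[of _ "\<lambda>p. p + i" "\<lambda>k. k - i"]) (auto intro!: arg_cong2[where f = wt])
  finally show "(\<Sum>k<24. kernel i k j) = inner (j - i)" by (simp add: inner_eq)
qed

definition par_s :: "nat \<Rightarrow> nat \<Rightarrow> real" where "par_s i j = sl (j - i) / 96"
definition par_m :: "nat \<Rightarrow> nat \<Rightarrow> real" where "par_m i j = mg (j - i) / 96"
definition par_q :: "nat \<Rightarrow> nat \<Rightarrow> real" where
  "par_q i j = qt (outer (j - i) (23 - j)) (outer (j - i) i) (inner (j - i)) (sl (j - i)) (mg (j - i)) / 96"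

definition gain :: "real \<Rightarrow> real \<Rightarrow> real \<Rightarrow> real \<Rightarrow> real \<Rightarrow> real \<Rightarrow> real \<Rightarrow> real" where
  "gain X \<alpha> \<beta> \<gamma> s q m = (1 + X) * (\<alpha> + \<beta> + \<gamma>) / 12
     - (s\<^sup>2 / 3 + q\<^sup>2 + X * (((\<beta> - \<alpha>)\<^sup>2 + \<gamma>\<^sup>2) / 8 + 2 * s * q + q * \<gamma>)) / (4 * m)"

lemma gain_scaled:
  assumes "0 < m"
  shows "gain X (real_of_int a / 24) (real_of_int b / 24) (real_of_int c / 24) (real_of_int s / 96) (real_of_int (qt a b c s m) / 96) (real_of_int m / 96)
    = (real_of_int (term0 a b c s m) / (12 * real_of_int m) + X * (real_of_int (term1 a b c s m) / (96 * real_of_int m))) / 96"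
  using assms unfolding gain_def term0_def term1_def
  by (simp add: field_simps power2_eq_square)

lemma sum_pairs_24: "(\<Sum>(i, j)\<in>{(i, j). i < j \<and> j < 24}. F i j) = (\<Sum>d\<in>{1..<24}. \<Sum>i\<in>{0..<24 - d}. F i (i + d))"
  for F :: "nat \<Rightarrow> nat \<Rightarrow> real"
proof -
  have "(\<Sum>d\<in>{1..<24}. \<Sum>i\<in>{0..<24 - d}. F i (i + d)) = (\<Sum>(d, i)\<in>(SIGMA d:{1..<24}. {0..<24 - d}). F i (i + d))"
    by (rule sum.Sigma) auto
  also have "\<dots> = (\<Sum>(i, j)\<in>{(i, j). i < j \<and> j < 24}. F i j)"
    by (intro sum.reindex_bij_witness[of _ "\<lambda>(i, j). (j - i, i)" "\<lambda>(d, i). (i, i + d)"]) auto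
  finally show ?thesis ..
qed

lemma mg_pos': "1 \<le> d \<Longrightarrow> d < 24 \<Longrightarrow> 0 < mg d"
  using mg_pos by auto

lemma sum_row: "(\<Sum>i\<in>{0..<24 - d}. real_of_int (f (outer d (23 - i - d)) (outer d i) (inner d) (sl d) (mg d))) = row_sum f d"
  by (simp add: row_sum_def interv_sum_list_conv_sum_set_nat)

lemma mg_list: "map mg [1..<24] = margin_table" by code_simp

lemma sum_rows:
  "(\<Sum>d\<in>{1..<24}. real_of_int (row_sum f d) / (k * real_of_int (mg d)))
    = sum_list (map2 (\<lambda>x m. real_of_int x / (k * real_of_int m)) (map (row_sum f) [1..<24]) margin_table)"
  unfolding mg_list[symmetric] map2_map_map by (simp add: interv_sum_list_conv_sum_set_nat del: upt_rec_numeral)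

abbreviation "ka i j \<equiv> (\<Sum>k<24. kernel i j k) / 24"
abbreviation "kb i j \<equiv> (\<Sum>k<24. kernel k i j) / 24"
abbreviation "kc i j \<equiv> (\<Sum>k<24. kernel i k j) / 24"

lemma kernel_gain_eq:
  "(\<Sum>(i, j)\<in>{(i, j). i < j \<and> j < 24}. gain X (ka i j) (kb i j) (kc i j) (par_s i j) (par_q i j) (par_m i j))
    = ((\<Sum>d\<in>{1..<24}. real_of_int (row_sum term0 d) / (12 * real_of_int (mg d)))
       + X * (\<Sum>d\<in>{1..<24}. real_of_int (row_sum term1 d) / (96 * real_of_int (mg d)))) / 96"
proof -
  have "(\<Sum>(i, j)\<in>{(i, j). i < j \<and> j < 24}. gain X (ka i j) (kb i j) (kc i j) (par_s i j) (par_q i j) (par_m i j))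
    = (\<Sum>d\<in>{1..<24}. \<Sum>i\<in>{0..<24 - d}. (real_of_int (term0 (outer d (23 - i - d)) (outer d i) (inner d) (sl d) (mg d)) / (12 * real_of_int (mg d))
        + X * (real_of_int (term1 (outer d (23 - i - d)) (outer d i) (inner d) (sl d) (mg d)) / (96 * real_of_int (mg d)))) / 96)"
    unfolding sum_pairs_24
  proof (intro sum.cong refl)
    fix d i assume "d \<in> {1..<24::nat}" "i \<in> {0..<24 - d}"
    then have ij: "i < i + d" "i + d < 24" and d: "0 < mg d" using mg_pos' by auto
    have [simp]: "23 - (i + d) = 23 - i - d" by simp
    show "gain X (ka i (i + d)) (kb i (i + d)) (kc i (i + d)) (par_s i (i + d)) (par_q i (i + d)) (par_m i (i + d))
      = (real_of_int (term0 (outer d (23 - i - d)) (outer d i) (inner d) (sl d) (mg d)) / (12 * real_of_int (mg d))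
        + X * (real_of_int (term1 (outer d (23 - i - d)) (outer d i) (inner d) (sl d) (mg d)) / (96 * real_of_int (mg d)))) / 96"
      using gain_scaled[OF d] by (simp only: kernel_sums[OF ij] par_s_def par_q_def par_m_def diff_add_inverse \<open>23 - (i + d) = 23 - i - d\<close>)
  qed
  also have "\<dots> = (\<Sum>d\<in>{1..<24}. (real_of_int (row_sum term0 d) / (12 * real_of_int (mg d)) + X * (real_of_int (row_sum term1 d) / (96 * real_of_int (mg d)))) / 96)"
    unfolding sum_row[symmetric]
    by (simp only: sum_divide_distrib[symmetric] sum.distrib sum_distrib_left[symmetric])
  also have "\<dots> = ((\<Sum>d\<in>{1..<24}. real_of_int (row_sum term0 d) / (12 * real_of_int (mg d)))
       + X * (\<Sum>d\<in>{1..<24}. real_of_int (row_sum term1 d) / (96 * real_of_int (mg d)))) / 96"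
    by (simp only: sum_divide_distrib[symmetric] sum.distrib sum_distrib_left[symmetric])
  finally show ?thesis .
qed

text \<open>A saving of \<open>67/324 = 1 - 8 * 257/2592\<close> per pair of blocks is the break-even point, and
  \<open>713/50000\<close> slightly exceeds \<open>(67/324)\<^sup>2 / 3\<close>, the bound on \<open>R2 / n ^ 3\<close> that the cuts provide.\<close>

lemma kernel_gain:
  assumes "0 \<le> X" "X \<le> 713 / 50000"
  shows "276 * 67 / 324 + 3 / 100
    \<le> (\<Sum>(i, j)\<in>{(i, j). i < j \<and> j < 24}. gain X (ka i j) (kb i j) (kc i j) (par_s i j) (par_q i j) (par_m i j))"
proof -
  define c0 where "c0 = (\<Sum>d\<in>{1..<24}. real_of_int (row_sum term0 d) / (12 * real_of_int (mg d)))"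
  define c1 where "c1 = (\<Sum>d\<in>{1..<24}. real_of_int (row_sum term1 d) / (96 * real_of_int (mg d)))"
  \<comment> \<open>The total saving is affine in \<open>X\<close>, so the two ends of the interval
    suffice.\<close>
  have 0: "(276 * 67 / 324 + 3 / 100) * 96 \<le> c0"
    unfolding c0_def sum_rows row_sum_term0 margin_table_def by simp
  have 1: "(276 * 67 / 324 + 3 / 100) * 96 \<le> c0 + 713 / 50000 * c1"
    unfolding c0_def c1_def sum_rows row_sum_term0 row_sum_term1 margin_table_def by simp
  have "(276 * 67 / 324 + 3 / 100) * 96 \<le> c0 + X * c1"
  proof (cases "0 \<le> c1")
    case True then show ?thesis using 0 assms(1) mult_nonneg_nonneg[of X c1] by linarith
  next
    case False
    then have "713 / 50000 * c1 \<le> X * c1" using assms by (intro mult_right_mono_neg) auto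
    then show ?thesis using 1 by linarith
  qed
  then show ?thesis unfolding kernel_gain_eq c0_def[symmetric] c1_def[symmetric] by (simp only: pos_le_divide_eq zero_less_numeral)
qed

text \<open>For a fixed span \<open>d\<close>, reversing the block order maps \<open>i\<close> to
  \<open>23 - d - i\<close>. This swaps \<open>ka\<close> and \<open>kb\<close> by the symmetry of
  \<open>wt\<close> and fixes \<open>kc\<close> and the margin, so the terms cancel. The
  uncontrolled sum of \<open>P * Q\<close> thereby drops out.\<close>

lemma kernel_skew: "(\<Sum>(i, j)\<in>{(i, j). i < j \<and> j < 24}. (kb i j - ka i j) * kc i j / par_m i j) = 0"
proof -
  have "(\<Sum>(i, j)\<in>{(i, j). i < j \<and> j < 24}. (kb i j - ka i j) * kc i j / par_m i j)
    = (\<Sum>d\<in>{1..<24}. \<Sum>i\<in>{0..<24 - d}. real_of_int ((outer d i - outer d (23 - i - d)) * inner d) * (1 / (6 * real_of_int (mg d))))"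
    unfolding sum_pairs_24
  proof (intro sum.cong refl)
    fix d i assume "d \<in> {1..<24::nat}" "i \<in> {0..<24 - d}"
    then have ij: "i < i + d" "i + d < 24" by auto
    have "(real_of_int b / 24 - real_of_int a / 24) * (real_of_int c / 24) / (real_of_int m / 96)
      = real_of_int ((b - a) * c) * (1 / (6 * real_of_int m))" for a b c m by (cases "m = 0") (simp_all add: field_simps)
    then show "(kb i (i + d) - ka i (i + d)) * kc i (i + d) / par_m i (i + d)
      = real_of_int ((outer d i - outer d (23 - i - d)) * inner d) * (1 / (6 * real_of_int (mg d)))"
      by (simp only: kernel_sums[OF ij] par_m_def diff_add_inverse diff_diff_left)
  qed
  also have "\<dots> = (\<Sum>d\<in>{1..<24}. real_of_int (row_sum (\<lambda>a b c s m. (b - a) * c) d) * (1 / (6 * real_of_int (mg d))))"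
    unfolding sum_row[where f = "\<lambda>a b c s m. (b - a) * c", symmetric] by (simp only: sum_distrib_right)
  also have "\<dots> = 0" using row_sum_skew by simp
  finally show ?thesis .
qed

lemma par_conditions:
  assumes "i < j" "j < 24"
  shows "0 < par_m i j" "(par_q i j - par_m i j) + par_s i j \<ge> (ka i j + kb i j) / 2 - 1"
    "(par_q i j - par_m i j) - par_s i j \<ge> kc i j / 2 - 1"
proof -
  show "0 < par_m i j" using mg_pos'[of "j - i"] assms by (simp add: par_m_def)
  define a b c s m where d: "a = outer (j - i) (23 - j)" "b = outer (j - i) i" "c = inner (j - i)" "s = sl (j - i)" "m = mg (j - i)"
  have "2 * (a + b) - 96 - s \<le> qt a b c s m - m" "2 * c - 96 + s \<le> qt a b c s m - m" by (auto simp: qt_def)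
  then have "real_of_int (2 * (a + b) - 96 - s) \<le> real_of_int (qt a b c s m - m)" "real_of_int (2 * c - 96 + s) \<le> real_of_int (qt a b c s m - m)"
    by (simp_all only: of_int_le_iff)
  then show "(par_q i j - par_m i j) + par_s i j \<ge> (ka i j + kb i j) / 2 - 1" "(par_q i j - par_m i j) - par_s i j \<ge> kc i j / 2 - 1"
    unfolding kernel_sums[OF assms] par_q_def par_m_def par_s_def d[symmetric] by (simp_all add: field_simps)
qed

text \<open>Collects the terms of order \<open>n\<close> over the 276 pairs of blocks; the summand 2
  per pair comes from replacing \<open>mean\<close> by \<open>L\<close>. What matters is that it
  does not depend on the tournament.\<close>

definition err_const :: real where
  "err_const = (\<Sum>(i, j)\<in>{(i, j). i < j \<and> j < 24}.
     (ka i j + kb i j + kc i j) / 12 + \<bar>par_s i j * par_q i j\<bar> / (8 * par_m i j)) + 276 * 2"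

section \<open>The certificate applied to a tournament\<close>

locale kernel_blocks = tourn V E for V :: "nat set" and E :: "(nat \<times> nat) set"
begin

sublocale random_blocks V E 24 kernel 8
  by unfold_locales (auto simp: kernel_range, auto simp: kernel_def)

lemma abc_eq: "\<alpha> i j = ka i j" "\<beta> i j = kb i j" "\<gamma> i j = kc i j"
  by (simp_all add: \<alpha>_def \<beta>_def \<gamma>_def)

lemma k_range: "0 \<le> ka i j" "0 \<le> kb i j" "0 \<le> kc i j" "ka i j \<le> 8" "kb i j \<le> 8" "kc i j \<le> 8"
proof -
  have *: "0 \<le> (\<Sum>k<24. f k) / 24 \<and> (\<Sum>k<24. f k) / 24 \<le> 8" if "\<And>k. 0 \<le> f k \<and> f k \<le> 8" for f :: "nat \<Rightarrow> real"
    using sum_mono[of "{..<24}" f "\<lambda>_. 8"] sum_nonneg[of "{..<24}" f] that by simp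
  show "0 \<le> ka i j" "0 \<le> kb i j" "0 \<le> kc i j" "ka i j \<le> 8" "kb i j \<le> 8" "kc i j \<le> 8"
    using *[of "\<lambda>k. kernel i j k"] *[of "\<lambda>k. kernel k i j"] *[of "\<lambda>k. kernel i k j"] kernel_range by blast+
qed

lemma card_pairs: "card pairs = 276"
proof -
  have "real (card pairs) = (\<Sum>(i, j)\<in>pairs. 1)" by (simp add: case_prod_unfold)
  also have "\<dots> = (\<Sum>d\<in>{1..<24::nat}. \<Sum>i\<in>{0..<24 - d}. 1)" unfolding pairs_def by (rule sum_pairs_24)
  also have "\<dots> = sum_list (map (\<lambda>d. real (24 - d)) [1..<24])"
    by (simp add: interv_sum_list_conv_sum_set_nat del: upt_rec_numeral)
  also have "\<dots> = 276" by (simp add: upt_rec)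
  finally show ?thesis by simp
qed

lemma pair_H:
  assumes "i < j" "j < 24"
  shows "(\<Sum>(u, v)\<in>E. H (mean u v i j)) \<le> n\<^sup>2 / 4
    - n\<^sup>2 / 4 * gain (R2 / n ^ 3) (ka i j) (kb i j) (kc i j) (par_s i j) (par_q i j) (par_m i j)
    + (kb i j - ka i j) * kc i j / par_m i j * ((\<Sum>(u, v)\<in>E. P u v * Q u v) / 4)
    + n * ((ka i j + kb i j + kc i j) / 12 + \<bar>par_s i j * par_q i j\<bar> / (8 * par_m i j) + 2)"
proof -
  note k = k_range[of i j]
  have "(\<Sum>(u, v)\<in>E. H (mean u v i j)) \<le> (\<Sum>(u, v)\<in>E. H (L (ka i j) (kb i j) (kc i j) u v) + 3 / n)"
  proof (rule sum_mono, clarify)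
    fix u v assume uv: "(u, v) \<in> E"
    let ?c = "(ka i j / 2 + kb i j / 2 + kc i j) / n"
    have "H (mean u v i j) \<le> H (L (ka i j) (kb i j) (kc i j) u v) + ?c / 6"
      unfolding mean_load[OF uv] abc_eq using k n_pos by (intro H_shift divide_nonneg_pos) auto
    moreover have "?c / 6 \<le> 3 / n"
      using k n_pos by (simp add: divide_le_eq)
    ultimately show "H (mean u v i j) \<le> H (L (ka i j) (kb i j) (kc i j) u v) + 3 / n" by linarith
  qed
  also have "\<dots> = (\<Sum>(u, v)\<in>E. H (L (ka i j) (kb i j) (kc i j) u v)) + card E * (3 / n)"
    by (simp add: case_prod_unfold sum.distrib)
  also have "card E * (3 / n) \<le> n * 2"
    unfolding card_E using n_pos by (simp add: field_simps)
  finally show ?thesis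
    using arcs_H[OF par_conditions[OF assms] k(1-3)] by (simp only: gain_def diff_add_cancel) (simp add: distrib_left)
qed

lemma total_H:
  assumes X: "R2 / n ^ 3 \<le> 713 / 50000"
  shows "(\<Sum>(i, j)\<in>pairs. \<Sum>(u, v)\<in>E. H (mean u v i j)) \<le> n\<^sup>2 / 4 * (276 * 257 / 324 - 3 / 100) + n * err_const"
proof -
  let ?G = "\<lambda>i j. gain (R2 / n ^ 3) (ka i j) (kb i j) (kc i j) (par_s i j) (par_q i j) (par_m i j)"
  let ?K = "\<lambda>i j. (ka i j + kb i j + kc i j) / 12 + \<bar>par_s i j * par_q i j\<bar> / (8 * par_m i j) + 2"
  let ?Y = "(\<Sum>(u, v)\<in>E. P u v * Q u v) / 4"
  have pairs24: "pairs = {(i, j). i < j \<and> j < 24}" by (simp add: pairs_def)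
  have "(\<Sum>(i, j)\<in>pairs. \<Sum>(u, v)\<in>E. H (mean u v i j))
    \<le> (\<Sum>(i, j)\<in>pairs. n\<^sup>2 / 4 - n\<^sup>2 / 4 * ?G i j + (kb i j - ka i j) * kc i j / par_m i j * ?Y + n * ?K i j)"
    by (rule sum_mono, clarify, rule pair_H) (auto simp: pairs_def)
  also have "\<dots> = 276 * (n\<^sup>2 / 4) - n\<^sup>2 / 4 * (\<Sum>(i, j)\<in>pairs. ?G i j)
      + (\<Sum>(i, j)\<in>pairs. (kb i j - ka i j) * kc i j / par_m i j) * ?Y + n * (\<Sum>(i, j)\<in>pairs. ?K i j)"
    unfolding case_prod_unfold sum.distrib sum_subtractf sum_distrib_left[symmetric] sum_distrib_right[symmetric]
    by (simp add: card_pairs)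
  also have "\<dots> = 276 * (n\<^sup>2 / 4) - n\<^sup>2 / 4 * (\<Sum>(i, j)\<in>pairs. ?G i j) + n * err_const"
    unfolding pairs24 kernel_skew unfolding err_const_def pairs24[symmetric]
    by (simp add: case_prod_unfold sum.distrib card_pairs)
  also have "\<dots> \<le> 276 * (n\<^sup>2 / 4) - n\<^sup>2 / 4 * (276 * 67 / 324 + 3 / 100) + n * err_const"
  proof -
    have "0 \<le> R2 / n ^ 3" using R2_nonneg n_pos by simp
    then have "276 * 67 / 324 + 3 / 100 \<le> (\<Sum>(i, j)\<in>pairs. ?G i j)" unfolding pairs24 using X by (rule kernel_gain)
    then have "n\<^sup>2 / 4 * (276 * 67 / 324 + 3 / 100) \<le> n\<^sup>2 / 4 * (\<Sum>(i, j)\<in>pairs. ?G i j)" by (intro mult_left_mono) auto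
    then show ?thesis by linarith
  qed
  also have "\<dots> = n\<^sup>2 / 4 * (276 * 257 / 324 - 3 / 100) + n * err_const" by (simp add: algebra_simps)
  finally show ?thesis .
qed

lemma Avg_block_squares:
  "Avg (\<lambda>p. \<Sum>i<24. (real (card {v\<in>V. p v = i}))\<^sup>2) \<le> n\<^sup>2 / 24 + n"
proof -
  have card: "real (card {v\<in>V. p v = i}) = (\<Sum>v\<in>V. of_bool (p v = i))" for p :: "nat \<Rightarrow> nat" and i
    using finV by (simp add: Int_def)
  have one: "(\<Sum>a<24. 1 / 24 * of_bool (a = i) :: real) = 1 / 24" if "i < 24" for i :: nat
    using that by (simp only: sum_distrib_left[symmetric]) (simp add: of_bool_def)
  have "Avg (\<lambda>p. \<Sum>i<24. (real (card {v\<in>V. p v = i}))\<^sup>2)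
      = (\<Sum>i<24. \<Sum>u\<in>V. \<Sum>v\<in>V. Avg (\<lambda>p. of_bool (p u = i) * of_bool (p v = i)))"
    by (simp only: card power2_eq_square sum_product Avg_sum)
  also have "\<dots> \<le> (\<Sum>i<24::nat. \<Sum>u\<in>V. \<Sum>v\<in>V. 1 / 24 * (1 / 24) + (if u = v then 1 / 24 else 0))"
  proof (intro sum_mono)
    fix i u v assume i: "i \<in> {..<24::nat}" and uv: "u \<in> V" "v \<in> V"
    show "Avg (\<lambda>p. of_bool (p u = i) * of_bool (p v = i)) \<le> 1 / 24 * (1 / 24) + (if u = v then 1 / 24 else 0)"
    proof (cases "u = v")
      case True
      have "Avg (\<lambda>p. of_bool (p u = i) * of_bool (p v = i)) = Avg (\<lambda>p. of_bool (p u = i))"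
        unfolding True by (rule arg_cong[where f = Avg]) auto
      also have "\<dots> = 1 / 24" using Avg_one[OF uv(1), of "\<lambda>a. of_bool (a = i)"] one[of i] i by simp
      finally show ?thesis using True by simp
    next
      case False
      have i': "i < 24" using i by simp
      have "Avg (\<lambda>p. of_bool (p u = i) * of_bool (p v = i)) = 1 / 24 * (1 / 24)"
        using Avg_two[OF uv False, of "\<lambda>a. of_bool (a = i)" "\<lambda>a. of_bool (a = i)"]
        by (simp only: of_nat_numeral one[OF i'])
      then show ?thesis using False by simp
    qed
  qed
  also have "\<dots> = n\<^sup>2 / 24 + n"
    using finV
    by (simp add: sum.distrib n_def power2_eq_square flip: sum_divide_distrib) (simp add: algebra_simps)
  finally show ?thesis .
qed

text \<open>\<open>5911 / 62208\<close> is \<open>23 / 24 * 257 / 2592\<close>, the part of the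
  target left after the blocks take their share of about one 24th. The subtracted
  \<open>3 / 230400\<close> is the surplus 3/100 of \<open>kernel_gain\<close> divided by
  \<open>4 * 576\<close>.\<close>

lemma averaged_bound:
  assumes X: "R2 / n ^ 3 \<le> 713 / 50000" and c: "0 \<le> c" and \<zeta>: "0 < \<zeta>"
    and F: "\<And>p. p \<in> V \<rightarrow>\<^sub>E {..<24} \<Longrightarrow>
      F \<le> (\<Sum>e\<in>backward p. H (linear_triples.load (tri p) arcs3 (wgt p) e))
        + c * (\<Sum>i<24. (real (card {v\<in>V. p v = i}))\<^sup>2) + d"
  shows "F \<le> n\<^sup>2 * (5911 / 62208 - 3 / 230400) + n * err_const + 276 * n\<^sup>2 * (\<zeta> / 2 + 288 / (n * \<zeta>))
     + c * (n\<^sup>2 / 24 + n) + d"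
proof -
  have "F = Avg (\<lambda>p. F)" by (rule Avg_const[symmetric])
  also have "\<dots> \<le> Avg (\<lambda>p. (\<Sum>e\<in>backward p. H (linear_triples.load (tri p) arcs3 (wgt p) e))
        + c * (\<Sum>i<24. (real (card {v\<in>V. p v = i}))\<^sup>2) + d)"
    using F by (rule Avg_mono)
  also have "\<dots> = Avg (\<lambda>p. \<Sum>e\<in>backward p. H (linear_triples.load (tri p) arcs3 (wgt p) e))
        + c * Avg (\<lambda>p. \<Sum>i<24. (real (card {v\<in>V. p v = i}))\<^sup>2) + d"
    by (simp only: Avg_add Avg_cmult Avg_const)
  also have "\<dots> \<le> (n\<^sup>2 * (5911 / 62208 - 3 / 230400) + n * err_const + 276 * n\<^sup>2 * (\<zeta> / 2 + 288 / (n * \<zeta>)))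
        + c * (n\<^sup>2 / 24 + n) + d"
  proof (intro add_mono mult_left_mono Avg_block_squares c order_refl)
    have e: "0 \<le> err_const"
      unfolding err_const_def using k_range par_conditions(1)
      by (intro add_nonneg_nonneg sum_nonneg) (auto simp: less_imp_le)
    have "(\<Sum>(i, j)\<in>pairs. (\<Sum>(u, v)\<in>E. H (mean u v i j)) / (real 24)\<^sup>2)
        = (\<Sum>(i, j)\<in>pairs. \<Sum>(u, v)\<in>E. H (mean u v i j)) / 576"
      by (simp add: case_prod_unfold sum_divide_distrib)
    also have "\<dots> \<le> (n\<^sup>2 / 4 * (276 * 257 / 324 - 3 / 100) + n * err_const) / 576"
      using total_H[OF X] by (intro divide_right_mono) auto
    also have "\<dots> \<le> n\<^sup>2 * (5911 / 62208 - 3 / 230400) + n * err_const"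
      using mult_nonneg_nonneg[of n err_const] e n_pos by (simp add: field_simps)
    finally have 1: "(\<Sum>(i, j)\<in>pairs. (\<Sum>(u, v)\<in>E. H (mean u v i j)) / (real 24)\<^sup>2) \<le> n\<^sup>2 * (5911 / 62208 - 3 / 230400) + n * err_const" .
    have "real (card E) \<le> n\<^sup>2" unfolding card_E using n_pos zero_le_power2[of n] by (simp add: power2_eq_square field_simps)
    then have "276 * real (card E) * (\<zeta> / 2 + 288 / (n * \<zeta>)) \<le> 276 * n\<^sup>2 * (\<zeta> / 2 + 288 / (n * \<zeta>))"
      using \<zeta> n_pos by (intro mult_right_mono mult_left_mono) auto
    then have 2: "real (card pairs * card E) * (\<zeta> / 2 + 9 * 8\<^sup>2 / (2 * n * \<zeta>)) \<le> 276 * n\<^sup>2 * (\<zeta> / 2 + 288 / (n * \<zeta>))"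
    proof -
      have eq: "9 * 8\<^sup>2 / (2 * n * \<zeta>) = 288 / (n * \<zeta>)" by simp
      show ?thesis using \<open>276 * real (card E) * (\<zeta> / 2 + 288 / (n * \<zeta>)) \<le> _\<close>
        unfolding eq card_pairs of_nat_mult of_nat_numeral .
    qed
    show "Avg (\<lambda>p. \<Sum>e\<in>backward p. H (linear_triples.load (tri p) arcs3 (wgt p) e))
        \<le> n\<^sup>2 * (5911 / 62208 - 3 / 230400) + n * err_const + 276 * n\<^sup>2 * (\<zeta> / 2 + 288 / (n * \<zeta>))"
      using Avg_cost[OF \<zeta>] 1 2 by (simp only: of_nat_mult of_nat_power)
  qed
  finally show ?thesis .
qed

text \<open>Every weight appears in three loads, so a unit of load is worth a third of a triangle
  and saves a sixth of a triple. This is the origin of the coefficients of \<open>H\<close>.\<close>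

lemma sum_H_ge:
  fixes \<delta> :: real
  assumes J: "linear_triples.packing (tri p) arcs3 J"
    and big: "sum (wgt p) (tri p) - (\<Sum>e\<in>backward p. max 0 (linear_triples.load (tri p) arcs3 (wgt p) e - 1)) - \<delta> * card (backward p) \<le> card J"
  shows "(real (card (backward p)) - card J) / 2
    \<le> (\<Sum>e\<in>backward p. H (linear_triples.load (tri p) arcs3 (wgt p) e)) + \<delta> / 2 * card (backward p)"
proof -
  let ?l = "linear_triples.load (tri p) arcs3 (wgt p)"
  have "(\<Sum>e\<in>backward p. H (?l e)) = card (backward p) / 2 - (\<Sum>e\<in>backward p. ?l e) / 6 + (\<Sum>e\<in>backward p. max 0 (?l e - 1)) / 2"
    by (simp add: H_def sum.distrib sum_subtractf sum_divide_distrib)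
  also have "(\<Sum>e\<in>backward p. ?l e) = 3 * sum (wgt p) (tri p)"
    by (rule linear_triples.sum_load[OF linear_triples_tri])
  finally show ?thesis using big by (simp add: field_simps)
qed

end

section \<open>Improving the constant\<close>

text \<open>Arcs inside \<open>U\<close> cancel in the sum of the scores over \<open>U\<close>, so
  this sum sees only the arcs across the cut.\<close>

lemma (in tourn) card_cut:
  assumes U: "U \<subseteq> V"
  shows "real (card {(u, v) \<in> E. u \<notin> U \<and> v \<in> U}) = (card U * (n - card U) - sum R U) / 2"
proof -
  have finP: "finite U" using U finV finite_subset by blast
  have cardQ: "real (card (V - U)) = n - card U"
    using U finV finP by (simp add: n_def card_Diff_subset card_mono of_nat_diff)
  have eq: "{(u, v) \<in> E. u \<notin> U \<and> v \<in> U} = {(u, v) \<in> (V - U) \<times> U. (u, v) \<in> E}"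
    using E_sub by auto
  have "real (card {(u, v) \<in> E. u \<notin> U \<and> v \<in> U}) = (\<Sum>(u, v)\<in>(V - U) \<times> U. of_bool ((u, v) \<in> E))"
    unfolding eq using finV finP
    by (simp add: case_prod_unfold, intro arg_cong[where f = card]) auto
  also have "\<dots> = (\<Sum>v\<in>U. \<Sum>u\<in>V - U. of_bool ((u, v) \<in> E))"
    unfolding sum.cartesian_product[symmetric] by (rule sum.swap)
  also have "\<dots> = (\<Sum>v\<in>U. \<Sum>u\<in>V - U. (1 - A v u) / 2)"
  proof (intro sum.cong refl)
    fix v u assume "v \<in> U" "u \<in> V - U"
    then have "u \<in> V" "v \<in> V" "u \<noteq> v" using U by auto
    then show "of_bool ((u, v) \<in> E) = (1 - A v u) / 2" using E_ind[of u v] A_skew[of v u] by simp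
  qed
  also have "\<dots> = (card U * (n - card U) - (\<Sum>v\<in>U. \<Sum>u\<in>V - U. A v u)) / 2"
    using cardQ by (simp add: sum_subtractf flip: sum_divide_distrib)
  also have "(\<Sum>v\<in>U. \<Sum>u\<in>V - U. A v u) = sum R U"
  proof -
    have "(\<Sum>v\<in>U. \<Sum>u\<in>U. A v u) = (\<Sum>v\<in>U. \<Sum>u\<in>U. A u v)" by (rule sum.swap)
    also have "\<dots> = (\<Sum>v\<in>U. \<Sum>u\<in>U. - A v u)" by (intro sum.cong refl) (rule A_skew)
    finally have z: "(\<Sum>v\<in>U. \<Sum>u\<in>U. A v u) = 0" by (simp add: sum_negf)
    have "(\<Sum>u\<in>V. A v u) = (\<Sum>u\<in>V - U. A v u) + (\<Sum>u\<in>U. A v u)" for v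
      using U finV by (rule sum.subset_diff)
    then show ?thesis using z by (simp add: R_def sum.distrib)
  qed
  finally show ?thesis .
qed

text \<open>Of the slack \<open>9 * d\<close>, four \<open>d\<close> come from the realisation
  error, four from the distance to extremality and one from \<open>8 * M\<close>.\<close>

lemma cut_arith:
  fixes S X X' d f Z M C W Y :: real
  assumes "f \<le> (X - S) / 4 + d + Z + 2 * M" "Z = C - 2 * W" "X' = X - 8 * W"
    "Y = C - d" "Y < f" "8 * M \<le> d"
  shows "S \<le> X' + 9 * d"
proof -
  have "4 * f \<le> 4 * ((X - S) / 4 + d + Z + 2 * M)" using assms(1) by (rule mult_left_mono) simp
  also have "\<dots> = X - S + 4 * d + 4 * Z + 8 * M" by (simp add: distrib_left)
  finally have "S \<le> X + 4 * d + 4 * Z + 8 * M - 4 * f" by linarith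
  with assms(2-) show ?thesis by linarith
qed

text \<open>If \<open>c\<close> is an eventual bound and the worst tournament on \<open>k\<close> vertices comes close to it, then
  splitting that tournament along an arbitrary cut shows that its scores are nearly balanced,
  which bounds \<open>R2\<close> and so makes the random block ordering profitable.\<close>

lemma improvement:
  fixes c :: real
  assumes c: "257 / 2592 \<le> c" "c \<le> 1"
    and ev: "\<forall>\<^sub>F m in sequentially. real (inv_max 3 m) \<le> c * (real m)\<^sup>2"
  shows "\<forall>\<^sub>F k in sequentially. real (inv_max 3 k) \<le> (c - 1 / 10 ^ 7) * (real k)\<^sup>2"
proof -
  \<comment> \<open>\<open>\<delta>\<close> is the amount by which \<open>c\<close> drops and also
    the unit in which errors are measured; \<open>\<zeta>\<close> is the tolerated deviation of a
    load from its mean.\<close>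
  define \<delta> :: real where "\<delta> = 1 / 10 ^ 7"
  define \<zeta> :: real where "\<zeta> = 1 / 10 ^ 9"
  have \<delta>: "0 < \<delta>" and \<zeta>: "0 < \<zeta>" by (simp_all add: \<delta>_def \<zeta>_def)
  obtain N where N: "\<And>m. N \<le> m \<Longrightarrow> real (inv_max 3 m) \<le> c * (real m)\<^sup>2"
    using ev unfolding eventually_sequentially by blast
  \<comment> \<open>Blocks may be small or empty, where the eventual bound says nothing; the
    constant \<open>N^2\<close> covers them.\<close>
  have f_le: "real (inv_max 3 m) \<le> c * (real m)\<^sup>2 + (real N)\<^sup>2" for m
  proof (cases "N \<le> m")
    case True then show ?thesis using N[OF True] zero_le_power2[of "real N"] by linarith
  next
    case False
    have "real (inv_max 3 m) \<le> real (m * m)" using inv_max_le_square[of m] by (simp only: of_nat_le_iff)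
    also have "\<dots> \<le> real (N * N)" using False by (intro of_nat_mono mult_le_mono) auto
    finally show ?thesis using c(1) by (simp add: power2_eq_square add_increasing)
  qed
  obtain n1 where n1: "\<forall>(V :: nat set) B J. finite V \<longrightarrow> n1 \<le> card V \<longrightarrow> B \<subseteq> V \<times> V \<longrightarrow>
    (\<forall>u. (u, u) \<notin> B) \<longrightarrow> (\<forall>u v. (u, v) \<in> B \<longrightarrow> (v, u) \<notin> B) \<longrightarrow>
    (\<forall>t\<in>J. arcs3 t \<subseteq> B) \<longrightarrow> (\<forall>t\<in>J. \<forall>t'\<in>J. t \<noteq> t' \<longrightarrow> arcs3 t \<inter> arcs3 t' = {}) \<longrightarrow>
    realizes V (\<lambda>u v. (u, v) \<in> B \<or> (v, u) \<in> B) ((real (card B) - card J) / 2 + \<delta> * (card V)\<^sup>2)"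
    using realizes_packing[OF \<delta>] ..
  obtain \<eta> where \<eta>: "0 < \<eta>" and pack: "\<forall>(E :: (nat \<times> nat) set) (I :: (nat \<times> nat \<times> nat) set) ed w. linear_triples E I ed \<longrightarrow>
     (\<forall>i\<in>I. 0 \<le> w i \<and> w i \<le> \<eta>) \<longrightarrow>
     (\<exists>J. linear_triples.packing I ed J \<and>
       sum w I - (\<Sum>e\<in>E. max 0 (linear_triples.load I ed w e - 1)) - \<delta> * card E \<le> card J)"
    using linear_triples_packing[OF \<delta>] by (elim exE conjE)
  define M where "M = Max {1, real n1, 8 / \<eta>, 8 * (real N)\<^sup>2 / \<delta>, err_const / \<delta>, 288 / (\<zeta> * \<zeta>), 1 / \<delta>}"
  have "real (inv_max 3 k) \<le> (c - 1 / 10 ^ 7) * (real k)\<^sup>2" if k: "nat \<lceil>M\<rceil> \<le> k" for k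
  proof (rule ccontr)
    assume "\<not> ?thesis"
    then have large: "(c - \<delta>) * (real k)\<^sup>2 < real (inv_max 3 k)" by (simp add: \<delta>_def)
    have "M \<le> k" using k by linarith
    then have M: "1 \<le> real k" "real n1 \<le> k" "8 / \<eta> \<le> k" "8 * (real N)\<^sup>2 / \<delta> \<le> k" "err_const / \<delta> \<le> k"
      "288 / (\<zeta> * \<zeta>) \<le> k" "1 / \<delta> \<le> k" by (auto simp: M_def)
    have scale: "x \<le> \<delta> * (real k)\<^sup>2" if "x / \<delta> \<le> k" for x
    proof -
      have "x \<le> \<delta> * real k" using that \<delta> by (simp add: pos_divide_le_eq mult.commute)
      also have "\<dots> \<le> \<delta> * (real k)\<^sup>2" using M(1) \<delta> by (intro mult_left_mono) (auto simp: power2_eq_square)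
      finally show ?thesis .
    qed
    have N8: "8 * (real N)\<^sup>2 \<le> \<delta> * (real k)\<^sup>2" by (rule scale) (rule M(4))
    obtain V :: "nat set" and E where VE: "tournament V E" "card V = k"
      and worst: "\<And>x. solvable V E x \<Longrightarrow> real (inv_max 3 k) \<le> x"
      using ex_worst_tournament[of k] by metis
    interpret kernel_blocks V E
      using VE M(1) by unfold_locales auto
    have n: "n = real k" by (simp add: n_def VE(2))
    have step: "real (inv_max 3 k) \<le> (real (card B) - card J) / 2 + \<delta> * n\<^sup>2 + (c * (\<Sum>i<r. (real (card {v\<in>V. p v = i}))\<^sup>2) + r * (real N)\<^sup>2)"
      if p: "\<And>v. v \<in> V \<Longrightarrow> p v < r" and B: "B = {(u, v) \<in> E. p v < p u}"
        and J: "\<And>t. t \<in> J \<Longrightarrow> arcs3 t \<subseteq> B" "\<And>t t'. t \<in> J \<Longrightarrow> t' \<in> J \<Longrightarrow> t \<noteq> t' \<Longrightarrow> arcs3 t \<inter> arcs3 t' = {}"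
      for p :: "nat \<Rightarrow> nat" and r B and J :: "(nat \<times> nat \<times> nat) set"
    proof -
      have "realizes V (\<lambda>u v. (u, v) \<in> B \<or> (v, u) \<in> B) ((real (card B) - card J) / 2 + \<delta> * (card V)\<^sup>2)"
        using M(2) VE(2) E_sub tournament_irrefl[OF VE(1)] tournament_asym[OF VE(1)] J B
        by (intro n1[rule_format] finV) auto
      then have "real (inv_max 3 k) \<le> (real (card B) - card J) / 2 + \<delta> * (card V)\<^sup>2 + (\<Sum>i<r. real (inv_max 3 (card {v\<in>V. p v = i})))"
        by (intro worst solvable_recursion[OF VE(1) p B])
      also have "(\<Sum>i<r. real (inv_max 3 (card {v\<in>V. p v = i}))) \<le> (\<Sum>i<r. c * (real (card {v\<in>V. p v = i}))\<^sup>2 + (real N)\<^sup>2)"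
        by (intro sum_mono f_le)
      finally show ?thesis by (simp add: n_def sum.distrib sum_distrib_left)
    qed
    \<comment> \<open>With \<open>a = card U\<close>, placing \<open>U\<close> first costs at most
      about \<open>c n^2 - 2 c a (n - a)\<close> for the two parts and half a triple for each arc
      entering \<open>U\<close>. Near-extremality forbids this to be much below
      \<open>c n^2\<close>, which bounds the scores by the factor \<open>1 - 8 * c\<close>, and that
      is at most \<open>67 / 324\<close>.\<close>
    have cut: "sum R U \<le> 67 / 324 * card U * (real (card V) - card U) + 9 * \<delta> * (real k)\<^sup>2" if U: "U \<subseteq> V" for U
    proof -
      define p where "p v = (if v \<in> U then 0 else 1 :: nat)" for v
      have B: "{(u, v) \<in> E. p v < p u} = {(u, v) \<in> E. u \<notin> U \<and> v \<in> U}" by (auto simp: p_def)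
      have V0: "{v\<in>V. p v = 0} = U" "{v\<in>V. p v = 1} = V - U" using U by (auto simp: p_def)
      define a where "a = real (card U)"
      have b: "real (card (V - U)) = n - a"
        using U finV finite_subset[OF U finV] by (simp add: n_def a_def card_Diff_subset card_mono of_nat_diff)
      have "real (inv_max 3 k) \<le> (real (card {(u, v) \<in> E. p v < p u}) - card ({} :: (nat \<times> nat \<times> nat) set)) / 2 + \<delta> * n\<^sup>2
          + (c * (\<Sum>i<2. (real (card {v\<in>V. p v = i}))\<^sup>2) + real 2 * (real N)\<^sup>2)"
        by (rule step[OF _ refl]) (auto simp: p_def)
      also have "(\<Sum>i<2. (real (card {v\<in>V. p v = i}))\<^sup>2) = a\<^sup>2 + (n - a)\<^sup>2"
        unfolding numeral_2_eq_2 lessThan_Suc by (simp add: V0 b a_def flip: One_nat_def)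
      finally have f1: "real (inv_max 3 k) \<le> (a * (n - a) - sum R U) / 4 + \<delta> * n\<^sup>2 + c * (a\<^sup>2 + (n - a)\<^sup>2) + 2 * (real N)\<^sup>2"
        unfolding B card_cut[OF U] by (simp add: a_def)
      have f2: "c * (a\<^sup>2 + (n - a)\<^sup>2) = c * (real k)\<^sup>2 - 2 * (c * (a * (n - a)))"
        unfolding n by (simp add: power2_eq_square algebra_simps)
      have f3: "(1 - 8 * c) * (a * (n - a)) = a * (n - a) - 8 * (c * (a * (n - a)))"
        by (simp add: left_diff_distrib)
      have f4: "(c - \<delta>) * (real k)\<^sup>2 = c * (real k)\<^sup>2 - \<delta> * (real k)\<^sup>2"
        by (rule left_diff_distrib)
      have 1: "sum R U \<le> (1 - 8 * c) * (a * (n - a)) + 9 * (\<delta> * (real k)\<^sup>2)"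
        using cut_arith[OF f1[unfolded n] f2[unfolded n] f3[unfolded n] f4 large N8] unfolding n .
      have "0 \<le> a * (n - a)" using b[symmetric] by (simp add: a_def)
      then have "(1 - 8 * c) * (a * (n - a)) \<le> 67 / 324 * (a * (n - a))" using c(1) by (intro mult_right_mono) auto
      then show ?thesis using 1 by (simp add: a_def n_def)
    qed
    have R2: "R2 \<le> (67 / 324)\<^sup>2 * (card V) ^ 3 / 3 + 2 * (9 * \<delta> * (real k)\<^sup>2) * (1 + 67 / 324) * card V"
      unfolding R2_def
      by (rule sum_squares_of_cut_bound[OF finV nonempty _ _ cut sum_R]) (use \<delta> R_abs in \<open>auto simp: n_def\<close>)
    have X: "R2 / n ^ 3 \<le> 713 / 50000"
    proof -
      have "R2 \<le> 713 / 50000 * (real k) ^ 3"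
      proof -
        have "(67 / 324)\<^sup>2 * (real k) ^ 3 / 3 + 2 * (9 * \<delta> * (real k)\<^sup>2) * (1 + 67 / 324) * k
            = ((67 / 324)\<^sup>2 / 3 + 18 * \<delta> * (1 + 67 / 324)) * (real k) ^ 3"
          by (simp add: power2_eq_square power3_eq_cube algebra_simps)
        also have "\<dots> \<le> 713 / 50000 * (real k) ^ 3"
          by (intro mult_right_mono) (simp_all add: \<delta>_def power2_eq_square)
        finally show ?thesis using R2 unfolding VE(2) of_nat_power by (rule order_trans[rotated])
      qed
      then show ?thesis using n_pos by (simp add: n divide_le_eq)
    qed
    have small: "wgt p t \<le> \<eta>" "0 \<le> wgt p t" for p t
    proof -
      obtain x y z where t: "t = (x, y, z)" by (cases t)
      have "wgt p t \<le> 8 / n" unfolding t wgt_def prod.case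
        using kernel_range(2) n_pos by (intro divide_right_mono) auto
      also have "\<dots> \<le> \<eta>" using M(1,3) \<eta> unfolding n by (simp add: pos_divide_le_eq mult.commute)
      finally show "wgt p t \<le> \<eta>" .
      show "0 \<le> wgt p t" unfolding t wgt_def prod.case using kernel_range(1) n_pos by (intro divide_nonneg_pos) auto
    qed
    have F: "real (inv_max 3 k) \<le> (\<Sum>e\<in>backward p. H (linear_triples.load (tri p) arcs3 (wgt p) e))
        + c * (\<Sum>i<24. (real (card {v\<in>V. p v = i}))\<^sup>2) + (24 * (real N)\<^sup>2 + 2 * \<delta> * n\<^sup>2)"
      if p: "p \<in> V \<rightarrow>\<^sub>E {..<24}" for p
    proof -
      have "\<forall>i\<in>tri p. 0 \<le> wgt p i \<and> wgt p i \<le> \<eta>" using small by blast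
      then obtain J where J: "linear_triples.packing (tri p) arcs3 J"
        "sum (wgt p) (tri p) - (\<Sum>e\<in>backward p. max 0 (linear_triples.load (tri p) arcs3 (wgt p) e - 1)) - \<delta> * card (backward p) \<le> card J"
        using pack linear_triples_tri[of p] by meson
      have J': "J \<subseteq> tri p" "\<And>t t'. t \<in> J \<Longrightarrow> t' \<in> J \<Longrightarrow> t \<noteq> t' \<Longrightarrow> arcs3 t \<inter> arcs3 t' = {}"
        using J(1) unfolding linear_triples.packing_def[OF linear_triples_tri] by auto
      have g1: "real (inv_max 3 k) \<le> (real (card (backward p)) - card J) / 2 + \<delta> * n\<^sup>2
          + (c * (\<Sum>i<24. (real (card {v\<in>V. p v = i}))\<^sup>2) + real 24 * (real N)\<^sup>2)"
      proof (rule step)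
        show "p v < 24" if "v \<in> V" for v using p that by (auto simp: PiE_def)
        show "backward p = {(u, v) \<in> E. p v < p u}" by (rule backward_def)
        show "arcs3 t \<subseteq> backward p" if "t \<in> J" for t
          using linear_triples.ed_sub[OF linear_triples_tri[of p]] J'(1) that by blast
      qed (rule J'(2))
      have g2: "\<delta> / 2 * card (backward p) \<le> \<delta> * n\<^sup>2"
      proof -
        have "card (backward p) \<le> card E" using finE by (intro card_mono) (auto simp: backward_def)
        then have "real (card (backward p)) \<le> n * (n - 1) / 2" using card_E by linarith
        also have "\<dots> \<le> n\<^sup>2" using n_pos zero_le_power2[of n] by (simp add: power2_eq_square field_simps)
        finally have "\<delta> * real (card (backward p)) \<le> \<delta> * n\<^sup>2" using \<delta> by (intro mult_left_mono) auto
        moreover have "0 \<le> \<delta> * real (card (backward p))" using \<delta> by simp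
        ultimately show ?thesis by simp
      qed
      have lin: "x \<le> F + C + (24 * M + 2 * d)"
        if "x \<le> q + d + (C + real 24 * M)" "e \<le> d" "q \<le> F + e" for x q d C M e F :: real
        using that by (simp only: of_nat_numeral)
      show ?thesis using lin[OF g1 g2 sum_H_ge[OF J]] by (simp only: mult.assoc)
    qed
    have "real (inv_max 3 k) \<le> n\<^sup>2 * (5911 / 62208 - 3 / 230400) + n * err_const + 276 * n\<^sup>2 * (\<zeta> / 2 + 288 / (n * \<zeta>))
       + c * (n\<^sup>2 / 24 + n) + (24 * (real N)\<^sup>2 + 2 * \<delta> * n\<^sup>2)"
      by (rule averaged_bound[OF X _ \<zeta> F]) (use c in auto)
    moreover have "n * err_const \<le> \<delta> * n\<^sup>2"
    proof -
      have "err_const \<le> \<delta> * n" using M(5) \<delta> unfolding n by (simp add: pos_divide_le_eq mult.commute)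
      then have "n * err_const \<le> n * (\<delta> * n)" using n_pos by (intro mult_left_mono) auto
      then show ?thesis by (simp add: power2_eq_square mult_ac)
    qed
    moreover have "276 * n\<^sup>2 * (\<zeta> / 2 + 288 / (n * \<zeta>)) \<le> 276 * n\<^sup>2 * (2 * \<zeta>)"
    proof -
      have "288 / (n * \<zeta>) \<le> \<zeta>" using M(6) \<zeta> n_pos unfolding n by (simp add: divide_le_eq mult_ac)
      then show ?thesis using \<zeta> by (intro mult_left_mono) auto
    qed
    moreover have "c * n \<le> \<delta> * n\<^sup>2"
    proof -
      have "c * n \<le> 1 * n" using c n_pos by (intro mult_right_mono) auto
      moreover have "1 \<le> \<delta> * n" using M(7) \<delta> unfolding n by (simp add: pos_divide_le_eq mult.commute)
      then have "1 * n \<le> \<delta> * n * n" using n_pos by (intro mult_right_mono) auto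
      ultimately show ?thesis by (simp add: power2_eq_square mult_ac)
    qed
    \<comment> \<open>The break-even comparison: the blocks take \<open>c / 24\<close>, and
      \<open>23 / 24 * c\<close> must pay for the backward arcs. It holds because \<open>c\<close>
      is at least \<open>257 / 2592\<close>.\<close>
    moreover have "5911 / 62208 * n\<^sup>2 \<le> 23 / 24 * c * n\<^sup>2"
      using c(1) by (intro mult_right_mono) auto
    moreover have "24 * (real N)\<^sup>2 \<le> 3 * (\<delta> * n\<^sup>2)" using N8 by (simp add: n)
    moreover have "0 \<le> n\<^sup>2" by simp
    \<comment> \<open>The surplus is about \<open>130 \<delta> n^2\<close> and the errors add up to
      about \<open>12.5 \<delta> n^2\<close>, which leaves room for lowering \<open>c\<close> by
      \<open>\<delta>\<close>.\<close>
    ultimately have "real (inv_max 3 k) \<le> (c - \<delta>) * n\<^sup>2"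
      unfolding \<delta>_def \<zeta>_def by (simp add: distrib_left algebra_simps)
    with large show False by (simp add: n)
  qed
  then show ?thesis unfolding eventually_sequentially by blast
qed

text \<open>Descent from the trivial bound \<open>c = 1\<close>. The decrement does not depend on
  \<open>c\<close>, so \<open>10 ^ 7\<close> improvements reach the floor that \<open>max\<close>
  imposes.\<close>

lemma eventually_bound: "\<forall>\<^sub>F n in sequentially. real (inv_max 3 n) \<le> 257 / 2592 * (real n)\<^sup>2"
proof -
  have "\<forall>\<^sub>F n in sequentially. real (inv_max 3 n) \<le> max (257 / 2592) (1 - real j / 10 ^ 7) * (real n)\<^sup>2" for j
  proof (induction j)
    case 0
    have "real (inv_max 3 n) \<le> (real n)\<^sup>2" for n
      using inv_max_le_square[of n] by (simp add: power2_eq_square flip: of_nat_mult)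
    then show ?case by (simp add: max_def)
  next
    case (Suc j)
    let ?c = "max (257 / 2592) (1 - real j / 10 ^ 7) :: real"
    have "\<forall>\<^sub>F k in sequentially. real (inv_max 3 k) \<le> (?c - 1 / 10 ^ 7) * (real k)\<^sup>2"
      by (rule improvement[OF _ _ Suc]) auto
    then show ?case
    proof (rule eventually_mono)
      fix k assume "real (inv_max 3 k) \<le> (?c - 1 / 10 ^ 7) * (real k)\<^sup>2"
      also have "\<dots> \<le> max (257 / 2592) (1 - real (Suc j) / 10 ^ 7) * (real k)\<^sup>2"
      proof (intro mult_right_mono)
        have "max a x - t \<le> max a (x - t)" if "0 \<le> t" for a x t :: real using that by (auto simp: max_def)
        from this[of "1 / 10 ^ 7" "257 / 2592" "1 - real j / 10 ^ 7"]
        show "?c - 1 / 10 ^ 7 \<le> max (257 / 2592) (1 - real (Suc j) / 10 ^ 7)"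
          by (simp add: add_divide_distrib diff_diff_eq add.commute)
      qed simp
      finally show "real (inv_max 3 k) \<le> max (257 / 2592) (1 - real (Suc j) / 10 ^ 7) * (real k)\<^sup>2" .
    qed
  qed
  from this[of "10 ^ 7"] show ?thesis by (simp add: max_def)
qed

theorem theorem1p3:
  shows "\<exists>\<epsilon> :: nat \<Rightarrow> real. \<epsilon> \<longlonglongrightarrow> 0 \<and>
    (\<forall>n. real (inv_max 3 n) \<le> 257 / 2592 * (1 + \<epsilon> n) * (real n)\<^sup>2)"
proof -
  obtain N where N: "\<And>n. N \<le> n \<Longrightarrow> real (inv_max 3 n) \<le> 257 / 2592 * (real n)\<^sup>2"
    using eventually_bound unfolding eventually_sequentially by blast
  \<comment> \<open>The value \<open>2592 / 257\<close> lifts the whole factor above 1, so for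
    \<open>n < N\<close> the trivial bound \<open>n^2\<close> suffices; from \<open>N\<close> on the
    error term is exactly 0.\<close>
  define \<epsilon> :: "nat \<Rightarrow> real" where "\<epsilon> n = (if n < N then 2592 / 257 else 0)" for n
  have "\<forall>\<^sub>F n in sequentially. \<epsilon> n = 0"
    unfolding eventually_sequentially by (auto simp: \<epsilon>_def intro!: exI[of _ N])
  then have "\<epsilon> \<longlonglongrightarrow> 0" by (rule tendsto_eventually)
  moreover have "real (inv_max 3 n) \<le> 257 / 2592 * (1 + \<epsilon> n) * (real n)\<^sup>2" for n
  proof (cases "n < N")
    case True
    have "real (inv_max 3 n) \<le> (real n)\<^sup>2"
      using inv_max_le_square[of n] by (simp add: power2_eq_square flip: of_nat_mult)
    also have "\<dots> \<le> 257 / 2592 * (1 + \<epsilon> n) * (real n)\<^sup>2"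
      using True by (simp add: \<epsilon>_def mult_le_cancel_right1)
    finally show ?thesis .
  next
    case False
    then show ?thesis using N[of n] by (simp add: \<epsilon>_def)
  qed
  ultimately show ?thesis by blast
qed

end
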